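(* Let $n \geq 2$, $0 \leq k \leq n/2$ and $0 \leq j \leq k$ be integers. Let $A=\{1,2,\dots,k\}$ and $B=\{j+1,j+2,\dots,n\}$, and let $S_A$, $S_B$ be the symmetric groups on $A$, $B$ regarded as subgroups of $S_n$. (i) As a homogeneous polynomial in $x_1,\dots,x_n$, the $j$-th spherical function $\Phi(n,k,j)$ of the Gelfand pair $(S_n,S_k\times S_{n-k})$ is given by $$\frac{(n-2k)!}{k!\,(n-k)!\,2^{k-j}(k-j)!}\left(\sum_{v\in S_A}v\right)\left(\sum_{w\in S_B}w\right)\cdot\beta_j,$$ where $\beta_j=\prod_{i=1}^j(x_i-x_{k+i})\prod_{i=j+1}^k(x_i+x_{k+i})$. (ii) $\Phi(n,k,j)$ is a linear combination of elements of $\mathcal{B}_{n,k}$ whose coefficients are nonnegative integer multiples of $1/N$, where $N=(k)_j(n-k)_k=\dfrac{k!\,(n-k)!}{(k-j)!\,(n-2k)!}$.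
   Context: $V_{n,k}$ is the $\mathbb{Q}$-vector space with basis the squarefree monomials $x_I=\prod_{i\in I}x_i$ of degree $k$ in commuting indeterminates $x_1,\dots,x_n$; $S_n$ acts by permuting subscripts, so $V_{n,k}$ is the permutation module on the cosets of $S_k\times S_{n-k}$ (the identity coset corresponding to $x_1x_2\cdots x_k$, and $S_k\times S_{n-k}$ being the stabilizer of $\{1,\dots,k\}$). Over $\mathbb{C}$, $V_{n,k}$ is a direct sum of irreducible submodules with characters $\chi^{(n-i,i)}$, $0\le i\le k$, each occurring once (here $\chi^{(n-i,i)}$ is the irreducible character of $S_n$ labelled by the partition $(n-i,i)$). The spherical function $\Phi(n,k,j)$ is the unique element of $V_{n,k}$ (scalars extended if needed) that lies in the irreducible summand with character $\chi^{(n-j,j)}$, is fixed by $S_k\times S_{n-k}$, and has coefficient $1$ on $x_1x_2\cdots x_k$. Monomials are ordered lexicographically: for distinct $k$-subsets $I,J$ with $t=\min(I\,\Delta\,J)$, $x_I\prec x_J$ iff $t\in I$. A nonzero $v$ is positive if the $\prec$-minimal monomial in $v$ has positive coefficient. A $k$-root is a product $\prod_{r=1}^k(\pm x_{i_{2r-1}}\pm x_{i_{2r}})$ with independent signs and $2k$ distinct indices; it is positive if positive as an element of $V_{n,k}$. Each positive $k$-root can be written uniquely up to order of factors as $\prod_{r=1}^k(x_{i_{2r-1}}\pm x_{i_{2r}})$ with $i_{2r-1}<i_{2r}$ (normal form); factors $(x_i+x_j)$ are symmetric, indices not appearing are unused. A positive $k$-root has a defect if its normal form has, for some $i<j<r<s$: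 (i) factors $(x_i\pm x_r)$ and $(x_j\pm x_s)$; (ii) a factor $(x_i\pm x_s)$ and a symmetric factor $(x_j+x_r)$; (iii) a factor $(x_i\pm x_r)$ and an unused index $j$; or (iv) a symmetric factor $(x_i+x_j)$ and an unused index $r$. $\mathcal{B}_{n,k}$ is the set of positive $k$-roots with no defects; it is a basis of $V_{n,k}$.
   Formalization: In (i) the factor (n-2k)! is dropped from the constant: with the sum over all of S_B the displayed formula equals (n-2k)! times Φ(n,k,j), e.g. 2(x_1+...+x_4) for n=4, k=1, j=0; the constant proved is 1/(k!(n-k)! 2^{k-j}(k-j)!). *)

theory Defs
  imports Complex_Main "HOL-Library.Poly_Mapping" "HOL-Combinatorics.Permutations"
begin

section \<open>Polynomials and the action of the symmetric group\<close>

text \<open>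
  Polynomials in commuting indeterminates indexed by \<open>nat\<close>: finitely supported maps from exponent
  vectors to coefficients, with the ring structure of \<^theory>\<open>HOL-Library.Poly_Mapping\<close>.
  Only the indeterminates with index in \<open>{1..n}\<close> play a role.
\<close>

type_synonym 'a mpoly = "(nat \<Rightarrow>\<^sub>0 nat) \<Rightarrow>\<^sub>0 'a"

definition Var :: "nat \<Rightarrow> 'a::comm_ring_1 mpoly" where
  "Var i = Poly_Mapping.single (Poly_Mapping.single i 1) 1"

definition smult :: "'a::comm_ring_1 \<Rightarrow> 'a mpoly \<Rightarrow> 'a mpoly" where
  "smult c p = Poly_Mapping.single 0 c * p"

global_interpretation mpoly: vector_space "smult :: 'a::field \<Rightarrow> 'a mpoly \<Rightarrow> 'a mpoly"
  by unfold_locales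
    (simp_all add: smult_def algebra_simps single_add mult_single flip: mult.assoc)

definition xmon :: "nat set \<Rightarrow> 'a::comm_ring_1 mpoly" where
  "xmon I = (\<Prod>i\<in>I. Var i)"

text \<open>\<open>coeff_at f I\<close> is the coefficient of \<open>x\<^sub>I\<close> in \<open>f\<close>.\<close>

definition coeff_at :: "'a::comm_ring_1 mpoly \<Rightarrow> nat set \<Rightarrow> 'a" where
  "coeff_at f I = Poly_Mapping.lookup f (\<Sum>i\<in>I. Poly_Mapping.single i 1)"

text \<open>
  The left action permuting subscripts, \<open>x\<^sub>i \<mapsto> x\<^bsub>\<sigma> i\<^esub>\<close>, for bijective \<open>\<sigma>\<close>: the coefficient of the
  monomial with exponent vector \<open>m\<close> in \<open>act \<sigma> p\<close> is that of \<open>m \<circ> \<sigma>\<close> in \<open>p\<close>.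
  It is the ring homomorphism described by \<open>act_Var\<close>, \<open>act_add\<close> and \<open>act_mult\<close> below.
\<close>

definition act :: "(nat \<Rightarrow> nat) \<Rightarrow> 'a::comm_ring_1 mpoly \<Rightarrow> 'a mpoly" where
  "act \<sigma> p = Poly_Mapping.map_key (Poly_Mapping.map_key \<sigma>) p"

lemma inj_map_key:
  assumes "bij (\<sigma> :: nat \<Rightarrow> nat)"
  shows "inj (Poly_Mapping.map_key \<sigma> :: (nat \<Rightarrow>\<^sub>0 nat) \<Rightarrow> _)"
proof (rule injI)
  fix p q :: "nat \<Rightarrow>\<^sub>0 nat"
  assume eq: "Poly_Mapping.map_key \<sigma> p = Poly_Mapping.map_key \<sigma> q"
  show "p = q"
  proof (rule poly_mapping_eqI)
    fix i
    have "Poly_Mapping.lookup p (\<sigma> (inv \<sigma> i)) = Poly_Mapping.lookup q (\<sigma> (inv \<sigma> i))"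
      using arg_cong[OF eq, of "\<lambda>r. Poly_Mapping.lookup r (inv \<sigma> i)"] bij_is_inj[OF assms]
      by (simp add: map_key.rep_eq)
    then show "Poly_Mapping.lookup p i = Poly_Mapping.lookup q i"
      using assms by (simp add: bij_is_surj surj_f_inv_f)
  qed
qed

lemma lookup_act:
  assumes "bij \<sigma>"
  shows "Poly_Mapping.lookup (act \<sigma> p) m = Poly_Mapping.lookup p (Poly_Mapping.map_key \<sigma> m)"
  using inj_map_key[OF assms] by (simp add: act_def map_key.rep_eq)

lemma act_add: "bij \<sigma> \<Longrightarrow> act \<sigma> (p + q) = act \<sigma> p + act \<sigma> q"
  by (rule poly_mapping_eqI) (simp add: lookup_act lookup_add)

lemma act_single:
  assumes "bij \<sigma>"
  shows "act \<sigma> (Poly_Mapping.single m c) = Poly_Mapping.single (Poly_Mapping.map_key (inv \<sigma>) m) c"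
proof -
  have "Poly_Mapping.map_key \<sigma> (Poly_Mapping.map_key (inv \<sigma>) m) = m"
    using assms bij_imp_bij_inv[OF assms]
    by (intro poly_mapping_eqI) (simp add: map_key.rep_eq bij_is_inj inv_f_f)
  then show ?thesis
    using map_key_single[OF inj_map_key[OF assms], of "Poly_Mapping.map_key (inv \<sigma>) m" c]
    by (simp add: act_def)
qed

lemma act_Var:
  assumes "bij \<sigma>"
  shows "act \<sigma> (Var i) = Var (\<sigma> i)"
proof -
  have "inv \<sigma> (\<sigma> i) = i" using assms by (simp add: bij_is_inj)
  then have "Poly_Mapping.map_key (inv \<sigma>) (Poly_Mapping.single i (1::nat)) = Poly_Mapping.single (\<sigma> i) 1"
    using map_key_single[OF bij_is_inj[OF bij_imp_bij_inv[OF assms]], of "\<sigma> i" "1::nat"] by simp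
  then show ?thesis by (simp add: Var_def act_single[OF assms])
qed

lemma mpoly_single_induct:
  assumes "P 0" and "\<And>p m c. P p \<Longrightarrow> P (Poly_Mapping.single m c + p)"
  shows "P (p :: 'a::comm_ring_1 mpoly)"
proof (induction p rule: update_induct)
  case const
  then show ?case by (rule assms(1))
next
  case (update f a b)
  have "Poly_Mapping.update a b f = Poly_Mapping.single a b + f"
    using update.hyps
    by (intro poly_mapping_eqI)
      (auto simp: lookup_add lookup_single lookup_update when_def in_keys_iff)
  then show ?case using assms(2)[OF update.IH] by simp
qed

lemma act_zero: "bij \<sigma> \<Longrightarrow> act \<sigma> 0 = 0"
  by (rule poly_mapping_eqI) (simp add: lookup_act)

lemma act_mult:
  assumes "bij \<sigma>"
  shows "act \<sigma> (p * q) = act \<sigma> p * act \<sigma> q"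
proof -
  have inj: "inj (inv \<sigma>)" using assms by (simp add: bij_imp_bij_inv bij_is_inj)
  have single: "act \<sigma> (Poly_Mapping.single a c * q) = act \<sigma> (Poly_Mapping.single a c) * act \<sigma> q" for a c
    by (induction q rule: mpoly_single_induct)
      (simp_all add: act_zero[OF assms] distrib_left act_add[OF assms] mult_single act_single[OF assms]
        map_key_plus[OF inj])
  show ?thesis
    by (induction p rule: mpoly_single_induct)
      (simp_all add: act_zero[OF assms] distrib_right act_add[OF assms] single)
qed

text \<open>Left multiplication by the group algebra element \<open>\<Sum>\<^bsub>v \<in> S\<^sub>A\<^esub> v\<close>.\<close>

definition sym_sum :: "nat set \<Rightarrow> 'a::comm_ring_1 mpoly \<Rightarrow> 'a mpoly" where
  "sym_sum A f = (\<Sum>v | v permutes A. act v f)"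

definition V :: "nat \<Rightarrow> nat \<Rightarrow> 'a::field mpoly set" where
  "V n k = mpoly.span {xmon I |I. I \<subseteq> {1..n} \<and> card I = k}"


section \<open>Submodules, characters and Specht modules\<close>

definition submodule :: "nat \<Rightarrow> 'a::field mpoly set \<Rightarrow> bool" where
  "submodule n W \<longleftrightarrow> mpoly.subspace W \<and> (\<forall>\<sigma> f. \<sigma> permutes {1..n} \<longrightarrow> f \<in> W \<longrightarrow> act \<sigma> f \<in> W)"

definition irreducible_submodule :: "nat \<Rightarrow> 'a::field mpoly set \<Rightarrow> bool" where
  "irreducible_submodule n W \<longleftrightarrow>
     submodule n W \<and> W \<noteq> {0} \<and> (\<forall>U. submodule n U \<longrightarrow> U \<subseteq> W \<longrightarrow> U = {0} \<or> U = W)"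

text \<open>Meaningful for finite-dimensional \<open>W\<close> and \<open>T\<close> linear on \<open>W\<close> with \<open>T ` W \<subseteq> W\<close>.\<close>

definition trace_on :: "'a::field mpoly set \<Rightarrow> ('a mpoly \<Rightarrow> 'a mpoly) \<Rightarrow> 'a" where
  "trace_on W T =
     (let B = (SOME B. mpoly.independent B \<and> mpoly.span B = W)
      in \<Sum>b\<in>B. mpoly.representation B (T b) b)"

definition character :: "'a::field mpoly set \<Rightarrow> (nat \<Rightarrow> nat) \<Rightarrow> 'a" where
  "character W \<sigma> = trace_on W (act \<sigma>)"

text \<open>
  The Specht module of a partition \<open>\<lambda>\<close>, in Specht's original realisation: the span of the Specht
  polynomials of all tableaux of shape \<open>\<lambda>\<close>, where the Specht polynomial of a tableau is the product
  over its columns of the Vandermonde products of the indeterminates indexed by the column's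
  entries. Rows and columns are numbered from 0, and \<open>\<lambda>\<close> may have trailing zeros.
\<close>

definition cells :: "nat list \<Rightarrow> (nat \<times> nat) set" where
  "cells lam = {(r, c). r < length lam \<and> c < lam ! r}"

definition specht_poly :: "nat list \<Rightarrow> (nat \<times> nat \<Rightarrow> nat) \<Rightarrow> 'a::comm_ring_1 mpoly" where
  "specht_poly lam T =
     (\<Prod>(r, r', c) | r < r' \<and> (r, c) \<in> cells lam \<and> (r', c) \<in> cells lam.
        Var (T (r, c)) - Var (T (r', c)))"

definition specht_module :: "nat list \<Rightarrow> 'a::field mpoly set" where
  "specht_module lam =
     mpoly.span {specht_poly lam T |T. bij_betw T (cells lam) {1..sum_list lam}}"

definition chi :: "nat list \<Rightarrow> (nat \<Rightarrow> nat) \<Rightarrow> complex" where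
  "chi lam = character (specht_module lam)"


section \<open>Spherical functions\<close>

definition is_spherical :: "nat \<Rightarrow> nat \<Rightarrow> nat \<Rightarrow> complex mpoly \<Rightarrow> bool" where
  "is_spherical n k j f \<longleftrightarrow>
     (\<exists>W. W \<subseteq> V n k \<and> irreducible_submodule n W \<and>
          (\<forall>\<sigma>. \<sigma> permutes {1..n} \<longrightarrow> character W \<sigma> = chi [n - j, j] \<sigma>) \<and> f \<in> W) \<and>
     (\<forall>\<sigma>. \<sigma> permutes {1..n} \<longrightarrow> \<sigma> ` {1..k} = {1..k} \<longrightarrow> act \<sigma> f = f) \<and>
     coeff_at f {1..k} = 1"

definition spherical :: "nat \<Rightarrow> nat \<Rightarrow> nat \<Rightarrow> complex mpoly" where
  "spherical n k j = (THE f. is_spherical n k j f)"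

definition beta :: "nat \<Rightarrow> nat \<Rightarrow> 'a::comm_ring_1 mpoly" where
  "beta k j = (\<Prod>i=1..j. Var i - Var (k + i)) * (\<Prod>i=j+1..k. Var i + Var (k + i))"

text \<open>
  A pitfall about normalisation. The coefficient of \<open>x\<^sub>1 \<cdots> x\<^sub>k\<close> in
  \<open>sym_sum {1..k} (sym_sum {j+1..n} (beta k j))\<close> is \<open>k! (n-k)! 2\<^sup>k\<^sup>-\<^sup>j (k-j)!\<close>: to obtain \<open>x\<^sub>1 \<cdots> x\<^sub>k\<close>
  from \<open>act w (beta k j)\<close> one must choose \<open>x\<^sub>i\<close> from the \<open>i\<close>-th factor for \<open>i \<le> j\<close>, may choose either
  term from each of the other \<open>k - j\<close> factors, and \<open>w\<close> has to map the subscripts of these \<open>k - j\<close>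
  terms onto \<open>{j+1..k}\<close> and the other \<open>n - k\<close> elements of \<open>{j+1..n}\<close> onto \<open>{k+1..n}\<close>; the outer sum
  contributes \<open>k!\<close>. Hence the constant that makes this coefficient 1 is the reciprocal of that
  number. The published formula carries an extra factor
  \<open>(n-2k)!\<close>, which is right only if the inner sum runs over representatives of the left cosets in
  \<open>S\<^sub>B\<close> of the symmetric group on the indices \<open>{2k+1..n}\<close> unused by \<open>beta k j\<close>; with the sum over all
  of \<open>S\<^sub>B\<close> it would give the coefficient \<open>(n-2k)!\<close> instead of 1.
\<close>


section \<open>Roots, defects and the basis\<close>

definition lex_less :: "nat set \<Rightarrow> nat set \<Rightarrow> bool" where
  "lex_less I J \<longleftrightarrow> I \<noteq> J \<and> Min ((I - J) \<union> (J - I)) \<in> I"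

definition positive :: "nat \<Rightarrow> nat \<Rightarrow> rat mpoly \<Rightarrow> bool" where
  "positive n k f \<longleftrightarrow> f \<in> V n k \<and>
     (\<exists>I. I \<subseteq> {1..n} \<and> card I = k \<and> coeff_at f I > 0 \<and>
        (\<forall>J. J \<subseteq> {1..n} \<longrightarrow> card J = k \<longrightarrow> coeff_at f J \<noteq> 0 \<longrightarrow> J = I \<or> lex_less I J))"

definition is_k_root :: "nat \<Rightarrow> nat \<Rightarrow> rat mpoly \<Rightarrow> bool" where
  "is_k_root n k f \<longleftrightarrow>
     (\<exists>i s. inj_on i {1..2*k} \<and> i ` {1..2*k} \<subseteq> {1..n} \<and> (\<forall>r\<in>{1..2*k}. s r \<in> {1, -1}) \<and>
        f = (\<Prod>r=1..k. smult (s (2*r-1)) (Var (i (2*r-1))) + smult (s (2*r)) (Var (i (2*r)))))"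

text \<open>
  A normal form is encoded as the set of its factors, the triple \<open>(a, b, s)\<close> standing for
  \<open>x\<^sub>a + x\<^sub>b\<close> if \<open>s\<close> is true (a symmetric factor) and for \<open>x\<^sub>a - x\<^sub>b\<close> otherwise.
\<close>

type_synonym signed_pair = "nat \<times> nat \<times> bool"

definition is_normal_form :: "nat \<Rightarrow> nat \<Rightarrow> signed_pair set \<Rightarrow> bool" where
  "is_normal_form n k D \<longleftrightarrow> finite D \<and> card D = k \<and>
     (\<forall>(a, b, s)\<in>D. 1 \<le> a \<and> a < b \<and> b \<le> n) \<and>
     (\<forall>(a, b, s)\<in>D. \<forall>(a', b', s')\<in>D. (a, b, s) \<noteq> (a', b', s') \<longrightarrow> {a, b} \<inter> {a', b'} = {})"

definition root_of :: "signed_pair set \<Rightarrow> rat mpoly" where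
  "root_of D = (\<Prod>(a, b, s)\<in>D. if s then Var a + Var b else Var a - Var b)"

definition unused :: "nat \<Rightarrow> signed_pair set \<Rightarrow> nat \<Rightarrow> bool" where
  "unused n D i \<longleftrightarrow> i \<in> {1..n} \<and> (\<forall>(a, b, s)\<in>D. i \<noteq> a \<and> i \<noteq> b)"

definition has_defect :: "nat \<Rightarrow> nat \<Rightarrow> rat mpoly \<Rightarrow> bool" where
  "has_defect n k f \<longleftrightarrow> (\<exists>D. is_normal_form n k D \<and> f = root_of D \<and>
     ((\<exists>i j r s e e'. i < j \<and> j < r \<and> r < s \<and> (i, r, e) \<in> D \<and> (j, s, e') \<in> D) \<or>
      (\<exists>i j r s e. i < j \<and> j < r \<and> r < s \<and> (i, s, e) \<in> D \<and> (j, r, True) \<in> D) \<or>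
      (\<exists>i j r e. i < j \<and> j < r \<and> (i, r, e) \<in> D \<and> unused n D j) \<or>
      (\<exists>i j r. i < j \<and> j < r \<and> (i, j, True) \<in> D \<and> unused n D r)))"

definition root_basis :: "nat \<Rightarrow> nat \<Rightarrow> rat mpoly set" where
  "root_basis n k = {f. is_k_root n k f \<and> positive n k f \<and> \<not> has_defect n k f}"

text \<open>Extension of scalars from the rationals to the complex numbers.\<close>

definition complexify :: "rat mpoly \<Rightarrow> complex mpoly" where
  "complexify p = Poly_Mapping.map of_rat p"

end

theory Submission
  imports "HOL-Computational_Algebra.Fundamental_Theorem_Algebra" Defs
begin

text \<open>
Write \<open>A = {1..k}\<close> and \<open>H = S\<^sub>k \<times> S\<^bsub>n-k\<^esub>\<close>, and let \<open>W\<close> be the submodule of \<open>V n k\<close> generated by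
\<open>w = (\<Prod>i\<le>j. x\<^sub>i - x\<^bsub>n+1-i\<^esub>) e\<^bsub>k-j\<^esub>(x\<^bsub>j+1\<^esub>, \<dots>, x\<^bsub>n-j\<^esub>)\<close>. It is irreducible and isomorphic to the Specht module
of \<open>(n-j, j)\<close>. The sum \<open>T\<close> of all transpositions acts on \<open>W\<close> by a scalar \<open>l\<close>, and on every irreducible
submodule with the same character by the same scalar, because its trace is a sum of character values.
An \<open>H\<close>-fixed solution of \<open>T f = l f\<close> is determined by its coefficient at \<open>A\<close>, by recursion on \<open>card (K - A)\<close>.
So \<open>spherical n k j\<close> is the \<open>H\<close>-fixed element of \<open>W\<close> with coefficient 1 at \<open>A\<close>, and a formula for it is proved
by exhibiting an \<open>H\<close>-fixed element of \<open>W\<close> and computing a single coefficient. Besides (i) this shows that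
it is the average of \<open>w\<close> over \<open>H\<close>.

For (ii), a suitable multiple of \<open>e\<^sub>p\<close> is the sum of all products of \<open>p\<close> disjoint symmetric factors, which turns
the average into a nonnegative combination of positive \<open>k\<close>-roots; and every defect of a positive \<open>k\<close>-root can be
resolved by an identity with coefficients 1.
\<close>

text \<open>That \<open>T\<close> is a scalar on every irreducible submodule is Schur's lemma, and
  the complex numbers enter through the eigenvector it needs. Facts about \<open>w\<close> rest
  instead on one symmetry condition, \<open>alternating\<close>, whose solutions in
  \<open>V n k\<close> form a line: central elements and equivariant maps preserve it, so their
  effect on \<open>w\<close> is a scalar that is read off at \<open>A\<close>. Formula (i) does not
  yield (ii) term by term. An element of \<open>S_B\<close> may carry \<open>k + i\<close> into
  \<open>{j+1..k}\<close>, and then \<open>S_A\<close> can reverse the antisymmetric factor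
  containing \<open>x_i\<close>. In \<open>w\<close> the antisymmetric factors join
  \<open>{1..j}\<close> to \<open>{n+1-j..n}\<close>, and \<open>H\<close> moves no index across
  \<open>k\<close>, so its elements produce no signs. The denominator \<open>N\<close> comes from
  the average of \<open>w\<close>: it carries \<open>1 / (k! (n-k)!)\<close>, invariance of
  \<open>w\<close> under the symmetric groups on \<open>{j+1..k}\<close> and
  \<open>{k+1..n-j}\<close> gives back \<open>(k-j)! (n-j-k)!\<close>, and of the second factorial
  the part \<open>(n-j-k)! / (n-2k)!\<close> is spent on writing the elementary symmetric polynomial
  as a sum over matchings.\<close>

hide_const (open) Polynomial.smult

section \<open>Coefficients and the permutation action\<close>

lemma lookup_smult [simp]: "Poly_Mapping.lookup (smult c p) m = c * Poly_Mapping.lookup p m"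
  unfolding smult_def mult_map_scale_conv_mult[symmetric]
  by (simp add: Poly_Mapping.map.rep_eq when_def)

lemma smult_mult_left [simp]: "smult c p * q = smult c (p * q)"
  by (simp add: smult_def mult.assoc)

lemma smult_mult_right [simp]: "p * smult c q = smult c (p * q)"
  by (simp add: smult_def mult.left_commute)

lemma smult_of_nat: "smult (of_nat m) p = of_nat m * p"
  by (simp add: smult_def)

lemma coeff_at_add: "coeff_at (p + q) I = coeff_at p I + coeff_at q I"
  by (simp add: coeff_at_def lookup_add)

lemma coeff_at_diff: "coeff_at (p - q) I = coeff_at p I - coeff_at q I"
  by (simp add: coeff_at_def lookup_minus)

lemma coeff_at_uminus: "coeff_at (- p) I = - coeff_at p I"
  by (simp add: coeff_at_def)

lemma coeff_at_0 [simp]: "coeff_at 0 I = 0"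
  by (simp add: coeff_at_def)

lemma coeff_at_smult: "coeff_at (smult c p) I = c * coeff_at p I"
  by (simp add: coeff_at_def)

lemma coeff_at_sum: "coeff_at (\<Sum>i\<in>S. f i) I = (\<Sum>i\<in>S. coeff_at (f i) I)"
  by (simp add: coeff_at_def lookup_sum)

lemma lookup_sum_single:
  "finite I \<Longrightarrow> Poly_Mapping.lookup (\<Sum>i\<in>I. Poly_Mapping.single i (1::nat)) x = (if x \<in> I then 1 else 0)"
  by (simp add: lookup_sum lookup_single when_def sum.delta)

lemma sum_single_eq_iff:
  assumes "finite I" "finite J"
  shows "(\<Sum>i\<in>I. Poly_Mapping.single i (1::nat)) = (\<Sum>i\<in>J. Poly_Mapping.single i 1) \<longleftrightarrow> I = J"
proof
  assume eq: "(\<Sum>i\<in>I. Poly_Mapping.single i (1::nat)) = (\<Sum>i\<in>J. Poly_Mapping.single i 1)"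
  have "x \<in> I \<longleftrightarrow> x \<in> J" for x
    using arg_cong[OF eq, of "\<lambda>p. Poly_Mapping.lookup p x"] assms
    by (simp add: lookup_sum_single del: One_nat_def split: if_splits)
  then show "I = J" by blast
qed simp

lemma xmon_eq_single:
  "finite I \<Longrightarrow> xmon I = Poly_Mapping.single (\<Sum>i\<in>I. Poly_Mapping.single i 1) 1"
  unfolding xmon_def
  by (induction I rule: finite_induct) (simp_all add: Var_def mult_single)

lemma coeff_at_xmon:
  "finite I \<Longrightarrow> finite J \<Longrightarrow> coeff_at (xmon I) J = (if I = J then 1 else 0)"
  by (simp add: coeff_at_def xmon_eq_single lookup_single when_def sum_single_eq_iff del: One_nat_def)

lemma xmon_Un: "finite I \<Longrightarrow> finite J \<Longrightarrow> I \<inter> J = {} \<Longrightarrow> xmon (I \<union> J) = xmon I * xmon J"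
  by (simp add: xmon_def prod.union_disjoint)

lemma xmon_insert: "finite I \<Longrightarrow> i \<notin> I \<Longrightarrow> xmon (insert i I) = Var i * xmon I"
  by (simp add: xmon_def)

lemma xmon_image: "inj_on f I \<Longrightarrow> xmon (f ` I) = (\<Prod>i\<in>I. Var (f i))"
  by (simp add: xmon_def prod.reindex)

lemma xmon_empty [simp]: "xmon {} = 1"
  by (simp add: xmon_def)

lemma act_id [simp]: "act id p = p"
  by (rule poly_mapping_eqI) (simp add: lookup_act map_key_id[folded id_def])

lemma act_one: "bij \<sigma> \<Longrightarrow> act \<sigma> 1 = 1"
  using act_single[of \<sigma> 0 1] by (simp add: map_key_zero bij_imp_bij_inv bij_is_inj)

lemma act_diff: "bij \<sigma> \<Longrightarrow> act \<sigma> (p - q) = act \<sigma> p - act \<sigma> q"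
  by (rule poly_mapping_eqI) (simp add: lookup_act lookup_minus)

lemma act_smult: "bij \<sigma> \<Longrightarrow> act \<sigma> (smult c p) = smult c (act \<sigma> p)"
  by (rule poly_mapping_eqI) (simp add: lookup_act)

lemma act_sum: "bij \<sigma> \<Longrightarrow> act \<sigma> (\<Sum>i\<in>I. f i) = (\<Sum>i\<in>I. act \<sigma> (f i))"
  by (induction I rule: infinite_finite_induct) (simp_all add: act_zero act_add)

lemma act_prod: "bij \<sigma> \<Longrightarrow> act \<sigma> (\<Prod>i\<in>I. f i) = (\<Prod>i\<in>I. act \<sigma> (f i))"
  by (induction I rule: infinite_finite_induct) (simp_all add: act_one act_mult)

lemma act_comp:
  assumes "bij \<sigma>" "bij \<tau>"
  shows "act (\<sigma> \<circ> \<tau>) p = act \<sigma> (act \<tau> p)"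
  using assms
  by (intro poly_mapping_eqI)
    (simp add: lookup_act bij_comp map_key_compose bij_is_inj)

lemma act_xmon: "bij \<sigma> \<Longrightarrow> act \<sigma> (xmon I) = xmon (\<sigma> ` I)"
  by (simp add: xmon_def act_prod act_Var prod.reindex inj_on_subset[OF bij_is_inj])

lemma coeff_at_act:
  assumes "bij \<sigma>" "finite I"
  shows "coeff_at (act \<sigma> p) I = coeff_at p (inv \<sigma> ` I)"
proof -
  have "Poly_Mapping.map_key \<sigma> (\<Sum>i\<in>I. Poly_Mapping.single i (1::nat)) =
      (\<Sum>i\<in>inv \<sigma> ` I. Poly_Mapping.single i 1)" (is "?l = ?r")
  proof (rule poly_mapping_eqI)
    fix x
    have "\<sigma> x \<in> I \<longleftrightarrow> x \<in> inv \<sigma> ` I"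
      using assms(1) by (auto simp: bij_is_inj bij_is_surj surj_f_inv_f intro!: image_eqI[of x "inv \<sigma>" "\<sigma> x"])
    then show "Poly_Mapping.lookup ?l x = Poly_Mapping.lookup ?r x"
      using assms by (simp add: map_key.rep_eq bij_is_inj lookup_sum_single del: One_nat_def)
  qed
  then show ?thesis unfolding coeff_at_def lookup_act[OF assms(1)] by simp
qed

lemma coeff_at_act_image:
  assumes "bij \<sigma>" "finite I"
  shows "coeff_at (act \<sigma> p) (\<sigma> ` I) = coeff_at p I"
  using assms by (simp add: coeff_at_act image_image bij_is_inj)

lemma act_sym_sum: "sym_sum A (act u f) = sym_sum A f" if "u permutes A"
  unfolding sym_sum_def
  by (rule sum.reindex_bij_witness[where i="\<lambda>v. v \<circ> inv u" and j="\<lambda>v. v \<circ> u"])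
    (use that in \<open>auto simp: permutes_compose permutes_inv comp_assoc permutes_inv_o act_comp permutes_bij\<close>)

lemma act_sym_sum': "act u (sym_sum A f) = sym_sum A f" if "u permutes A"
  unfolding sym_sum_def act_sum[OF permutes_bij[OF that]]
  by (rule sum.reindex_bij_witness[where i="\<lambda>v. inv u \<circ> v" and j="\<lambda>v. u \<circ> v"])
    (use that in \<open>auto simp: permutes_compose permutes_inv o_assoc permutes_inv_o act_comp permutes_bij\<close>)

section \<open>The space of squarefree forms of degree \<open>k\<close> and its monomial
  basis\<close>

definition ksubs :: "nat \<Rightarrow> nat \<Rightarrow> nat set set" where
  "ksubs n k = {I. I \<subseteq> {1..n} \<and> card I = k}"

lemma finite_ksubs [simp]: "finite (ksubs n k)"
  by (rule finite_subset[of _ "Pow {1..n}"]) (auto simp: ksubs_def)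

lemma ksubs_finite: "I \<in> ksubs n k \<Longrightarrow> finite I"
  by (auto simp: ksubs_def intro: finite_subset)

lemma permutes_ksubs: "\<sigma> permutes {1..n} \<Longrightarrow> I \<in> ksubs n k \<Longrightarrow> \<sigma> ` I \<in> ksubs n k"
  using permutes_in_image[of \<sigma> "{1..n}"] by (auto simp: ksubs_def card_image inj_on_subset[OF permutes_inj])

lemma V_eq_span: "V n k = mpoly.span (xmon ` ksubs n k)"
  by (simp add: V_def ksubs_def image_Collect)

lemma subspace_V: "mpoly.subspace (V n k)"
  by (simp add: V_eq_span)

lemma xmon_in_V: "I \<in> ksubs n k \<Longrightarrow> xmon I \<in> V n k"
  by (simp add: V_eq_span mpoly.span_base)

lemma V_expand:
  assumes "f \<in> V n k"
  shows "f = (\<Sum>I\<in>ksubs n k. smult (coeff_at f I) (xmon I))"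
  using assms unfolding V_eq_span
proof (induction rule: mpoly.span_induct_alt)
  case base
  then show ?case by simp
next
  case (step c x y)
  then obtain J where J: "J \<in> ksubs n k" "x = xmon J" by auto
  have "(\<Sum>I\<in>ksubs n k. smult (coeff_at x I) (xmon I)) = (\<Sum>I\<in>ksubs n k. if I = J then x else 0)"
    using J by (intro sum.cong) (auto simp: coeff_at_xmon ksubs_finite)
  also have "\<dots> = x" using J by simp
  finally have "(\<Sum>I\<in>ksubs n k. smult (coeff_at x I) (xmon I)) = x" .
  then have "(\<Sum>I\<in>ksubs n k. smult (coeff_at (smult c x + y) I) (xmon I)) =
      smult c x + (\<Sum>I\<in>ksubs n k. smult (coeff_at y I) (xmon I))"
    unfolding coeff_at_add coeff_at_smult mpoly.scale_left_distrib sum.distrib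
      mpoly.scale_scale[symmetric] mpoly.scale_sum_right[symmetric] by simp
  then show ?case using step(2) by simp
qed

lemma V_eqI:
  assumes "f \<in> V n k" "g \<in> V n k" "\<And>I. I \<in> ksubs n k \<Longrightarrow> coeff_at f I = coeff_at g I"
  shows "f = g"
proof -
  have "f = (\<Sum>I\<in>ksubs n k. smult (coeff_at f I) (xmon I))"
    by (rule V_expand[OF assms(1)])
  also have "\<dots> = (\<Sum>I\<in>ksubs n k. smult (coeff_at g I) (xmon I))"
    using assms(3) by simp
  also have "\<dots> = g"
    by (rule V_expand[OF assms(2), symmetric])
  finally show ?thesis .
qed

lemma act_V:
  assumes "\<sigma> permutes {1..n}" "f \<in> V n k"
  shows "act \<sigma> f \<in> V n k"
proof -
  have b: "bij \<sigma>" using assms(1) by (rule permutes_bij)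
  have "act \<sigma> f = (\<Sum>I\<in>ksubs n k. smult (coeff_at f I) (xmon (\<sigma> ` I)))"
    by (subst V_expand[OF assms(2)]) (simp add: act_sum[OF b] act_smult[OF b] act_xmon[OF b])
  also have "\<dots> \<in> V n k"
    using subspace_V permutes_ksubs[OF assms(1)]
    by (intro mpoly.subspace_sum mpoly.subspace_scale) (auto intro: xmon_in_V)
  finally show ?thesis .
qed

lemma submodule_V: "submodule n (V n k)"
  by (simp add: submodule_def subspace_V act_V)

section \<open>The sum of all transpositions\<close>

lemma ex_permutes_image:
  assumes "finite B" "K \<subseteq> B" "K' \<subseteq> B" "card K = card K'"
  shows "\<exists>\<sigma>. \<sigma> permutes B \<and> \<sigma> ` K = K'"
proof -
  have fin: "finite K" "finite K'" using assms finite_subset by blast+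
  obtain f where f: "bij_betw f K K'"
    using finite_same_card_bij[OF fin assms(4)] by blast
  have "card (B - K) = card (B - K')"
    using assms fin by (simp add: card_Diff_subset)
  then obtain g where g: "bij_betw g (B - K) (B - K')"
    using finite_same_card_bij[of "B - K" "B - K'"] assms(1) by blast
  define h where "h = (\<lambda>x. if x \<in> K then f x else g x)"
  have hK: "bij_betw h K K'"
    using f by (rule bij_betw_cong[THEN iffD1, rotated]) (simp add: h_def)
  have "bij_betw h (B - K) (B - K')"
    using g by (rule bij_betw_cong[THEN iffD1, rotated]) (simp add: h_def)
  with hK have "bij_betw h (K \<union> (B - K)) (K' \<union> (B - K'))"
    by (rule bij_betw_combine) blast
  then have h: "bij_betw h B B"
    using assms(2,3) by (simp add: Un_absorb1)
  define \<sigma> where "\<sigma> = (\<lambda>x. if x \<in> B then h x else x)"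
  have "\<sigma> permutes B"
    unfolding \<sigma>_def using h by (intro bij_imp_permutes) (auto intro: bij_betw_cong[THEN iffD1, rotated])
  moreover have "\<sigma> ` K = h ` K"
    using assms(2) by (intro image_cong) (auto simp: \<sigma>_def)
  ultimately show ?thesis using hK by (auto simp: bij_betw_def)
qed

lemma transpose_image_iff: "x \<in> transpose a b ` K \<longleftrightarrow> transpose a b x \<in> K"
  by (metis image_iff transpose_involutory)

text \<open>Over all ordered pairs, diagonal included, this is \<open>n\<close> times the identity
  plus twice the class sum of transpositions; in characteristic 0 both have the same eigenvectors.
  The full index square is stable under a permutation in each coordinate.\<close>

definition transp_sum :: "nat \<Rightarrow> 'a::comm_ring_1 mpoly \<Rightarrow> 'a mpoly" where
  "transp_sum n f = (\<Sum>a=1..n. \<Sum>b=1..n. act (transpose a b) f)"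

lemma transp_sum_add: "transp_sum n (f + g) = transp_sum n f + transp_sum n g"
  by (simp add: transp_sum_def act_add sum.distrib)

lemma transp_sum_diff: "transp_sum n (f - g) = transp_sum n f - transp_sum n g"
  by (simp add: transp_sum_def act_diff sum_subtractf)

lemma transp_sum_smult: "transp_sum n (smult (c::'a::field) f) = smult c (transp_sum n f)"
  by (simp add: transp_sum_def act_smult mpoly.scale_sum_right)

text \<open>Centrality: conjugation by \<open>\<sigma>\<close> turns \<open>transpose a b\<close>
  into \<open>transpose (\<sigma> a) (\<sigma> b)\<close>, which only reindexes the square of
  pairs.\<close>

lemma act_transp_sum:
  assumes "\<sigma> permutes {1..n}"
  shows "act \<sigma> (transp_sum n f) = transp_sum n (act \<sigma> f)"
proof -
  have b: "bij \<sigma>" using assms by (rule permutes_bij)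
  have tr: "\<sigma> \<circ> transpose a b = transpose (\<sigma> a) (\<sigma> b) \<circ> \<sigma>" for a b
    by (simp add: fun_eq_iff transpose_apply_commute) (metis b bij_def inv_f_f inj_eq transpose_def)
  have "act \<sigma> (transp_sum n f) = (\<Sum>a=1..n. \<Sum>b=1..n. act (transpose (\<sigma> a) (\<sigma> b)) (act \<sigma> f))"
    by (simp add: transp_sum_def act_sum[OF b] act_comp[symmetric] b tr)
  also have "\<dots> = (\<Sum>a=1..n. \<Sum>b=1..n. act (transpose (\<sigma> a) b) (act \<sigma> f))"
    by (intro sum.cong refl sum.reindex_bij_betw permutes_imp_bij[OF assms])
  also have "\<dots> = (\<Sum>a=1..n. \<Sum>b=1..n. act (transpose a b) (act \<sigma> f))"
    by (rule sum.reindex_bij_betw[OF permutes_imp_bij[OF assms]])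
  finally show ?thesis by (simp add: transp_sum_def)
qed

lemma transp_sum_submodule:
  assumes "submodule n W" "f \<in> W"
  shows "transp_sum n f \<in> W"
  using assms unfolding transp_sum_def submodule_def
  by (auto intro!: mpoly.subspace_sum permutes_swap_id)

text \<open>The levels \<open>card (K - {1..k})\<close> are the orbits of the Young subgroup on
  \<open>k\<close>-sets: the parts of \<open>K\<close> inside and outside \<open>{1..k}\<close> have
  the sizes of those of \<open>K'\<close> and are moved independently, by \<open>u\<close> and by
  \<open>w\<close>.\<close>

lemma ex_permutes_ksubs:
  assumes "k \<le> n" "K \<in> ksubs n k" "K' \<in> ksubs n k" "card (K - {1..k}) = card (K' - {1..k})"
  shows "\<exists>\<sigma>. \<sigma> permutes {1..n} \<and> \<sigma> ` {1..k} = {1..k} \<and> \<sigma> ` K = K'"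
proof -
  have fin: "finite K" "finite K'" using assms ksubs_finite by blast+
  have "card (K \<inter> {1..k}) = card (K' \<inter> {1..k})"
    using assms(2-4) card_Int_Diff[OF fin(1), of "{1..k}"] card_Int_Diff[OF fin(2), of "{1..k}"]
    by (simp add: ksubs_def)
  then obtain u where u: "u permutes {1..k}" "u ` (K \<inter> {1..k}) = K' \<inter> {1..k}"
    using ex_permutes_image[of "{1..k}" "K \<inter> {1..k}" "K' \<inter> {1..k}"] by auto
  have sub: "K - {1..k} \<subseteq> {1..n} - {1..k}" "K' - {1..k} \<subseteq> {1..n} - {1..k}"
    using assms(2,3) by (auto simp: ksubs_def)
  obtain w where w: "w permutes ({1..n} - {1..k})" "w ` (K - {1..k}) = K' - {1..k}"
    using ex_permutes_image[OF _ sub assms(4)] by auto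
  have wA: "w ` {1..k} = {1..k}" "w ` (K \<inter> {1..k}) = K \<inter> {1..k}"
    using permutes_not_in[OF w(1)] by (auto simp: image_iff)
  have uB: "u ` (K' - {1..k}) = K' - {1..k}"
    using permutes_not_in[OF u(1)] by (auto simp: image_iff)
  have "w ` K = (K \<inter> {1..k}) \<union> (K' - {1..k})"
    using wA(2) w(2) by (metis Int_Diff_Un image_Un)
  then have "(u \<circ> w) ` K = K'"
    using u(2) uB by (metis Int_Diff_Un image_Un image_comp)
  moreover have "(u \<circ> w) ` {1..k} = {1..k}"
    using wA(1) permutes_image[OF u(1)] by (metis image_comp)
  moreover have "u \<circ> w permutes {1..n}"
    using permutes_subset[OF u(1), of "{1..n}"] permutes_subset[OF w(1), of "{1..n}"] assms(1)
    by (intro permutes_compose) auto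
  ultimately show ?thesis by blast
qed

section \<open>Vectors fixed by the Young subgroup\<close>

definition fixed_young :: "nat \<Rightarrow> nat \<Rightarrow> 'a::comm_ring_1 mpoly \<Rightarrow> bool" where
  "fixed_young n k f \<longleftrightarrow> (\<forall>\<sigma>. \<sigma> permutes {1..n} \<longrightarrow> \<sigma> ` {1..k} = {1..k} \<longrightarrow> act \<sigma> f = f)"

text \<open>
At a set \<open>K1\<close> with \<open>card (K1 - A) = s\<close>, where \<open>A = {1..k}\<close>, the equation \<open>T f = l f\<close> involves only coefficients
at sets \<open>K\<close> with \<open>card (K - A) \<le> s + 1\<close>, and those with equality are all equal and occur at least once.
\<close>

lemma fixed_young_eigenvector_zero:
  fixes f :: "'a::field_char_0 mpoly"
  assumes kn: "k \<le> n" and f: "f \<in> V n k" and eig: "transp_sum n f = smult l f"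
    and fixed: "fixed_young n k f" and A: "coeff_at f {1..k} = 0"
  shows "f = 0"
proof -
  have trans: "coeff_at f K = coeff_at f K'"
    if "K \<in> ksubs n k" "K' \<in> ksubs n k" "card (K - {1..k}) = card (K' - {1..k})" for K K'
  proof -
    from ex_permutes_ksubs[OF kn that]
    obtain \<sigma> where \<sigma>: "\<sigma> permutes {1..n}" "\<sigma> ` {1..k} = {1..k}" "\<sigma> ` K = K'"
      by auto
    have "coeff_at (act \<sigma> f) (\<sigma> ` K) = coeff_at f K"
      using \<sigma>(1) that(1) by (intro coeff_at_act_image) (auto simp: permutes_bij ksubs_finite)
    then show ?thesis using fixed \<sigma> by (simp add: fixed_young_def)
  qed
  have "coeff_at f K = 0" if "K \<in> ksubs n k" "card (K - {1..k}) \<le> s" for K s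
    using that
  proof (induction s arbitrary: K)
    case 0
    then have "K \<subseteq> {1..k}" "card K = card {1..k}"
      using ksubs_finite[of K n k] by (auto simp: ksubs_def)
    then have "K = {1..k}" by (intro card_subset_eq) auto
    then show ?case using A by simp
  next
    case (Suc s)
    show ?case
    proof (cases "card (K - {1..k}) \<le> s")
      case True
      then show ?thesis using Suc by blast
    next
      case False
      have finK: "finite K" using Suc.prems ksubs_finite by blast
      have card: "card (K - {1..k}) = Suc s" using False Suc.prems by simp
      then obtain b where b: "b \<in> K" "b \<notin> {1..k}" by (metis Diff_iff card.empty ex_in_conv nat.distinct(1))
      have "card ({1..k} - K) = card (K - {1..k})"
        using Suc.prems(1) finK card_Int_Diff[OF finK, of "{1..k}"] card_Int_Diff[of "{1..k}" K]
        by (simp add: ksubs_def Int_commute)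
      then obtain a where a: "a \<in> {1..k}" "a \<notin> K"
        using card by (metis Diff_iff card.empty ex_in_conv nat.distinct(1))
      \<comment> \<open>Exchanging \<open>b\<close> for \<open>a\<close> goes down one level, where
        coefficients are already known to vanish. The eigenvalue equation is read at
        \<open>K1\<close>, which has \<open>K\<close> among its neighbours.\<close>
      define K1 where "K1 = transpose a b ` K"
      have ab: "a \<in> {1..n}" "b \<in> {1..n}" using a b Suc.prems(1) kn by (auto simp: ksubs_def)
      have K1: "K1 \<in> ksubs n k"
        unfolding K1_def using ab Suc.prems(1) by (intro permutes_ksubs permutes_swap_id)
      have K1': "transpose a b ` K1 = K" by (simp add: K1_def image_comp)
      have "K1 - {1..k} = (K - {1..k}) - {b}"
        using a b by (auto simp: K1_def transpose_image_iff) (auto simp: transpose_def split: if_splits)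
      then have cK1: "card (K1 - {1..k}) = s" using card b finK by simp
      have finK1: "finite K1" using K1 ksubs_finite by blast
      \<comment> \<open>A transposition brings at most one new element into a set.\<close>
      have level: "card (transpose x y ` K1 - {1..k}) \<le> Suc s" for x y
      proof -
        consider "transpose x y ` K1 \<subseteq> insert x K1" | "transpose x y ` K1 \<subseteq> insert y K1"
          by (auto simp: transpose_def)
        then obtain z where "transpose x y ` K1 - {1..k} \<subseteq> insert z (K1 - {1..k})"
          by cases blast+
        then have "card (transpose x y ` K1 - {1..k}) \<le> card (insert z (K1 - {1..k}))"
          using finK1 by (intro card_mono) auto
        also have "\<dots> \<le> Suc s" using cK1 by (metis card_insert_le_m1 card_insert_if finK1 finite_Diff le_SucI order_refl)
        finally show ?thesis .
      qed
      define P where "P = {(x, y) \<in> {1..n} \<times> {1..n}. card (transpose x y ` K1 - {1..k}) = Suc s}"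
      have val: "coeff_at f (transpose x y ` K1) = (if (x, y) \<in> P then coeff_at f K else 0)"
        if "x \<in> {1..n}" "y \<in> {1..n}" for x y
      proof -
        have mem: "transpose x y ` K1 \<in> ksubs n k"
          using that K1 by (intro permutes_ksubs permutes_swap_id)
        show ?thesis
        proof (cases "(x, y) \<in> P")
          case True
          then show ?thesis using trans[OF mem Suc.prems(1)] card by (simp add: P_def)
        next
          case False
          then have "card (transpose x y ` K1 - {1..k}) \<le> s"
            using level[of x y] that by (auto simp: P_def)
          then show ?thesis using Suc.IH[OF mem] False by simp
        qed
      qed
      have finP: "finite P" by (rule finite_subset[of _ "{1..n} \<times> {1..n}"]) (auto simp: P_def)
      have "(a, b) \<in> P" using ab card by (simp add: P_def K1')
      then have "card P \<noteq> 0" using finP by auto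
      \<comment> \<open>All neighbours of \<open>K1\<close> on lower levels contribute 0, so the
        equation collapses to \<open>card P\<close> equal copies of the coefficient at
        \<open>K\<close>, with \<open>card P\<close> invertible.\<close>
      have "0 = coeff_at (transp_sum n f) K1"
        using Suc.IH[OF K1] cK1 by (simp add: eig coeff_at_smult)
      also have "\<dots> = (\<Sum>x=1..n. \<Sum>y=1..n. coeff_at f (transpose x y ` K1))"
        by (simp add: transp_sum_def coeff_at_sum coeff_at_act finK1)
      also have "\<dots> = (\<Sum>x=1..n. \<Sum>y=1..n. if (x, y) \<in> P then coeff_at f K else 0)"
        using val by (intro sum.cong) auto
      also have "\<dots> = (\<Sum>p\<in>{1..n} \<times> {1..n}. if p \<in> P then coeff_at f K else 0)"
        by (simp add: sum.cartesian_product)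
      also have "\<dots> = (\<Sum>p\<in>P. coeff_at f K)"
        by (rule sum.mono_neutral_cong_right) (auto simp: P_def)
      finally show ?thesis using \<open>card P \<noteq> 0\<close> by simp
    qed
  qed
  then show ?thesis
    by (intro V_eqI[OF f mpoly.subspace_0[OF subspace_V]]) auto
qed

text \<open>A permutation carries a nonzero coefficient of some element to \<open>{1..k}\<close>.
  Every element of the Young subgroup maps \<open>{1..k}\<close> to itself, so summing over this
  subgroup multiplies that coefficient by the group order, and in characteristic 0 it
  survives.\<close>

lemma submodule_ex_fixed_young:
  fixes U :: "'a::field_char_0 mpoly set"
  assumes kn: "k \<le> n" and U: "submodule n U" "U \<subseteq> V n k" "U \<noteq> {0}"
  shows "\<exists>f\<in>U. fixed_young n k f \<and> coeff_at f {1..k} = 1"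
proof -
  have sub: "mpoly.subspace U" using U(1) by (simp add: submodule_def)
  then obtain f where f: "f \<in> U" "f \<noteq> 0" using U(3) mpoly.subspace_0 by blast
  then obtain K where K: "K \<in> ksubs n k" "coeff_at f K \<noteq> 0"
    using U(2) V_eqI[of f n k 0] mpoly.subspace_0[OF subspace_V] by auto
  obtain \<sigma> where \<sigma>: "\<sigma> permutes {1..n}" "\<sigma> ` K = {1..k}"
    using ex_permutes_image[of "{1..n}" K "{1..k}"] K kn by (auto simp: ksubs_def)
  define g where "g = act \<sigma> f"
  have g: "g \<in> U" using U(1) f(1) \<sigma>(1) by (auto simp: submodule_def g_def)
  have gA: "coeff_at g {1..k} \<noteq> 0"
    using coeff_at_act_image[OF permutes_bij[OF \<sigma>(1)] ksubs_finite[OF K(1)]] K(2) \<sigma>(2)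
    by (metis g_def)
  define H where "H = {\<tau>. \<tau> permutes {1..n} \<and> \<tau> ` {1..k} = {1..k}}"
  have finH: "finite H" unfolding H_def by (rule finite_subset[OF _ finite_permutations[of "{1..n}"]]) auto
  have idH: "id \<in> H" by (simp add: H_def permutes_id)
  have compH: "\<rho> \<circ> \<tau> \<in> H" if "\<rho> \<in> H" "\<tau> \<in> H" for \<rho> \<tau>
    using that by (simp add: H_def permutes_compose image_comp[symmetric] del: o_apply)
  have invH: "inv \<rho> \<in> H" if "\<rho> \<in> H" for \<rho>
  proof -
    have "inv \<rho> ` {1..k} = inv \<rho> ` (\<rho> ` {1..k})" using that by (simp add: H_def)
    also have "\<dots> = {1..k}"
      by (rule image_inv_f_f) (use that in \<open>auto simp: H_def permutes_inj\<close>)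
    finally show ?thesis using that by (simp add: H_def permutes_inv)
  qed
  define h where "h = (\<Sum>\<tau>\<in>H. act \<tau> g)"
  have bH: "bij \<tau>" if "\<tau> \<in> H" for \<tau> using that by (auto simp: H_def permutes_bij)
  have "act \<rho> h = h" if \<rho>: "\<rho> \<in> H" for \<rho>
  proof -
    have pr: "\<rho> permutes {1..n}" using \<rho> by (simp add: H_def)
    show ?thesis
      unfolding h_def act_sum[OF bH[OF \<rho>]]
      by (rule sum.reindex_bij_witness[where i="\<lambda>v. inv \<rho> \<circ> v" and j="\<lambda>v. \<rho> \<circ> v"])
        (simp_all add: \<rho> compH invH o_assoc act_comp bH permutes_inv_o[OF pr])
  qed
  then have fixh: "fixed_young n k h" by (auto simp: fixed_young_def H_def)
  have "coeff_at (act \<tau> g) {1..k} = coeff_at g {1..k}" if "\<tau> \<in> H" for \<tau>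
    using coeff_at_act_image[OF bH[OF that], of "{1..k}" g] that by (simp add: H_def)
  then have hA: "coeff_at h {1..k} = of_nat (card H) * coeff_at g {1..k}"
    by (simp add: h_def coeff_at_sum)
  have "card H \<noteq> 0" using finH idH by auto
  then have ne: "coeff_at h {1..k} \<noteq> 0" using hA gA by simp
  have hU: "h \<in> U"
    unfolding h_def using U(1) g by (intro mpoly.subspace_sum[OF sub]) (auto simp: submodule_def H_def)
  show ?thesis
  proof (intro bexI conjI)
    show "smult (1 / coeff_at h {1..k}) h \<in> U" using hU sub by (rule mpoly.subspace_scale[rotated])
    show "fixed_young n k (smult (1 / coeff_at h {1..k}) h)"
      using fixh by (auto simp: fixed_young_def act_smult permutes_bij)
    show "coeff_at (smult (1 / coeff_at h {1..k}) h) {1..k} = 1"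
      using ne by (simp add: coeff_at_smult)
  qed
qed

section \<open>A generator of each irreducible summand\<close>

text \<open>
The factors of \<open>beta\<close> pair \<open>i\<close> with \<open>k + i\<close>. Pairing \<open>i\<close> with \<open>n + 1 - i\<close> instead gives a product that does not
depend on \<open>k\<close>, so that \<open>V n j\<close> and \<open>V n k\<close> can be compared directly.
\<close>

definition mirror_diffs :: "nat \<Rightarrow> nat \<Rightarrow> 'a::comm_ring_1 mpoly" where
  "mirror_diffs n j = (\<Prod>i=1..j. Var i - Var (Suc n - i))"

definition esym :: "nat set \<Rightarrow> nat \<Rightarrow> 'a::comm_ring_1 mpoly" where
  "esym Z p = (\<Sum>K | K \<subseteq> Z \<and> card K = p. xmon K)"

text \<open>This is \<open>w\<close> of the overview. For \<open>k = j\<close> it is the Specht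
  generator \<open>mirror_diffs n j\<close> (\<open>gen_self\<close>), so facts about generators
  cover that one too.\<close>

definition summand_gen :: "nat \<Rightarrow> nat \<Rightarrow> nat \<Rightarrow> 'a::comm_ring_1 mpoly" where
  "summand_gen n k j = mirror_diffs n j * esym {j+1..n-j} (k - j)"

text \<open>The symmetry that characterises the generator up to a scalar
  (\<open>alternating_unique\<close>). It is checked instead of comparing expansions.\<close>

definition alternating :: "nat \<Rightarrow> nat \<Rightarrow> nat \<Rightarrow> 'a::field mpoly \<Rightarrow> bool" where
  "alternating n k j f \<longleftrightarrow> f \<in> V n k \<and> (\<forall>i\<in>{1..j}. act (transpose i (Suc n - i)) f = - f) \<and>
     (\<forall>u. u permutes {j+1..n-j} \<longrightarrow> act u f = f)"

text \<open>A sign change kills the coefficient at every \<open>K\<close> containing both or neither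
  of \<open>i\<close> and \<open>Suc n - i\<close>. Otherwise swaps bring all of
  \<open>{1..j}\<close> into \<open>K\<close>; the rest of \<open>K\<close> then lies in
  \<open>{j+1..n-j}\<close>, where invariance moves it to \<open>{j+1..k}\<close>. So each
  coefficient is zero or, up to sign, the one at \<open>{1..k}\<close>.\<close>

lemma alternating_zero:
  fixes f :: "'a::field_char_0 mpoly"
  assumes kn: "2 * k \<le> n" and jk: "j \<le> k" and f: "alternating n k j f" and A: "coeff_at f {1..k} = 0"
  shows "f = 0"
proof -
  have fV: "f \<in> V n k" using f by (simp add: alternating_def)
  have swap: "coeff_at f (transpose i (Suc n - i) ` K) = - coeff_at f K"
    if "i \<in> {1..j}" "K \<in> ksubs n k" for i K
  proof -
    have "act (transpose i (Suc n - i)) f = - f" using f that(1) by (simp add: alternating_def)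
    then show ?thesis
      using coeff_at_act_image[of "transpose i (Suc n - i)" K f] ksubs_finite[OF that(2)]
      by (simp add: coeff_at_uminus minus_equation_iff)
  qed
  have bad: "coeff_at f K = 0"
    if "i \<in> {1..j}" "K \<in> ksubs n k" "i \<in> K \<longleftrightarrow> Suc n - i \<in> K" for i K
  proof -
    have "transpose i (Suc n - i) ` K = K"
      using that(3) by (auto simp: transpose_image_iff transpose_def split: if_splits)
    then have "coeff_at f K = - coeff_at f K" using swap[OF that(1,2)] by simp
    then show ?thesis by simp
  qed
  have "coeff_at f K = 0" if "K \<in> ksubs n k" for K
    using that
  proof (induction "card ({1..j} - K)" arbitrary: K)
    case 0
    then have sub: "{1..j} \<subseteq> K" by auto
    have K: "K \<subseteq> {1..n}" "card K = k" "finite K"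
      using 0(2) ksubs_finite[OF 0(2)] by (auto simp: ksubs_def)
    show ?case
    proof (cases "\<exists>i\<in>{1..j}. Suc n - i \<in> K")
      case True
      then show ?thesis using bad[OF _ 0(2)] sub by blast
    next
      case False
      have "K - {1..j} \<subseteq> {j+1..n-j}"
      proof
        fix x assume x: "x \<in> K - {1..j}"
        then have "1 \<le> x" "x \<le> n" using K by auto
        moreover have "\<not> n - j < x"
        proof
          assume "n - j < x"
          then have "Suc n - x \<in> {1..j}" "Suc n - (Suc n - x) = x" using \<open>x \<le> n\<close> by auto
          then show False using False x by (metis DiffD1)
        qed
        ultimately show "x \<in> {j+1..n-j}" using x by auto
      qed
      moreover have "{j+1..k} \<subseteq> {j+1..n-j}" using kn jk by auto
      moreover have "card (K - {1..j}) = card {j+1..k}"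
        using K sub jk by (simp add: card_Diff_subset)
      ultimately obtain u where u: "u permutes {j+1..n-j}" "u ` (K - {1..j}) = {j+1..k}"
        using ex_permutes_image[of "{j+1..n-j}" "K - {1..j}" "{j+1..k}"] by auto
      have "u ` {1..j} = {1..j}" using permutes_not_in[OF u(1)] by (auto simp: image_iff)
      moreover have "K = {1..j} \<union> (K - {1..j})" using sub by auto
      ultimately have "u ` K = {1..j} \<union> {j+1..k}" using u(2) by (metis image_Un)
      also have "\<dots> = {1..k}" using jk by auto
      finally have "u ` K = {1..k}" .
      then have "coeff_at (act u f) {1..k} = coeff_at f K"
        using coeff_at_act_image[OF permutes_bij[OF u(1)] K(3), of f] by simp
      then show ?thesis using f u(1) A by (simp add: alternating_def)
    qed
  next
    case (Suc m)
    then obtain i where i: "i \<in> {1..j}" "i \<notin> K" by (metis Diff_iff card.empty ex_in_conv nat.distinct(1))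
    show ?case
    proof (cases "Suc n - i \<in> K")
      case False
      then show ?thesis using bad[OF i(1) Suc.prems] i by blast
    next
      case True
      let ?K = "transpose i (Suc n - i) ` K"
      have n1: "i \<in> {1..n}" "Suc n - i \<in> {1..n}" "Suc n - i \<notin> {1..j}" using i kn jk by auto
      then have mem: "?K \<in> ksubs n k" using Suc.prems by (intro permutes_ksubs permutes_swap_id)
      have "{1..j} - ?K = ({1..j} - K) - {i}"
        using i n1 True by (auto simp: transpose_image_iff) (auto simp: transpose_def split: if_splits)
      then have "m = card ({1..j} - ?K)" using Suc.hyps(2) i by simp
      then have "coeff_at f ?K = 0" using Suc.hyps(1) mem by blast
      then show ?thesis using swap[OF i(1) Suc.prems] by simp
    qed
  qed
  then show ?thesis
    by (intro V_eqI[OF fV mpoly.subspace_0[OF subspace_V]]) auto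
qed

lemma alternating_smult: "alternating n k j f \<Longrightarrow> alternating n k j (smult c f)"
  by (auto simp: alternating_def act_smult permutes_bij intro: mpoly.subspace_scale[OF subspace_V])

lemma alternating_diff: "alternating n k j f \<Longrightarrow> alternating n k j g \<Longrightarrow> alternating n k j (f - g)"
  by (auto simp: alternating_def act_diff permutes_bij intro: mpoly.subspace_diff[OF subspace_V])

lemma alternating_transp_sum:
  assumes "2 * j \<le> n" "alternating n k j f"
  shows "alternating n k j (transp_sum n f)"
proof -
  have neg: "transp_sum n (- f) = - transp_sum n f"
    using transp_sum_smult[of n "-1" f] by simp
  have "act (transpose i (Suc n - i)) (transp_sum n f) = - transp_sum n f" if "i \<in> {1..j}" for i
  proof -
    have "transpose i (Suc n - i) permutes {1..n}" using that assms(1) by (intro permutes_swap_id) auto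
    then show ?thesis using assms(2) that neg by (simp add: act_transp_sum alternating_def)
  qed
  moreover have "act u (transp_sum n f) = transp_sum n f" if "u permutes {j+1..n-j}" for u
  proof -
    have "u permutes {1..n}" using that by (rule permutes_subset) auto
    then show ?thesis using assms(2) that by (simp add: act_transp_sum alternating_def)
  qed
  moreover have "transp_sum n f \<in> V n k"
    using assms(2) by (auto simp: alternating_def intro: transp_sum_submodule[OF submodule_V])
  ultimately show ?thesis by (simp add: alternating_def)
qed

lemma alternating_unique:
  fixes f g :: "'a::field_char_0 mpoly"
  assumes "2 * k \<le> n" "j \<le> k" "alternating n k j f" "alternating n k j g" "coeff_at g {1..k} = 1"
  shows "f = smult (coeff_at f {1..k}) g"
proof -
  have "f - smult (coeff_at f {1..k}) g = 0"
    using assms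
    by (intro alternating_zero[OF assms(1,2)] alternating_diff alternating_smult)
      (simp_all add: coeff_at_diff coeff_at_smult)
  then show ?thesis by simp
qed

text \<open>All indices are distinct, so every choice of one term per factor gives a squarefree
  monomial; \<open>T\<close> records the factors that contribute their first term. The expansions of
  \<open>mirror_diffs\<close>, \<open>mirror_beta\<close> and \<open>root_of\<close> are all
  instances.\<close>

lemma prod_pairs_expand:
  fixes d :: "'i \<Rightarrow> 'a::field"
  assumes "finite I" "inj_on a I" "inj_on b I" "a ` I \<inter> b ` I = {}"
  shows "(\<Prod>i\<in>I. Var (a i) + smult (d i) (Var (b i))) =
    (\<Sum>T\<in>Pow I. smult (\<Prod>i\<in>I-T. d i) (xmon (a ` T \<union> b ` (I - T))))"
proof -
  have smult_prod: "(\<Prod>i\<in>S. smult (d i) (Var (b i))) = smult (\<Prod>i\<in>S. d i) (\<Prod>i\<in>S. Var (b i))" for S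
    by (induction S rule: infinite_finite_induct) simp_all
  have "(\<Prod>i\<in>I. Var (a i) + smult (d i) (Var (b i))) =
      (\<Sum>T\<in>Pow I. (\<Prod>i\<in>T. Var (a i)) * (\<Prod>i\<in>I-T. smult (d i) (Var (b i))))"
    by (rule prod_add[OF assms(1)])
  also have "\<dots> = (\<Sum>T\<in>Pow I. smult (\<Prod>i\<in>I-T. d i) (xmon (a ` T \<union> b ` (I - T))))"
  proof (rule sum.cong[OF refl])
    fix T assume "T \<in> Pow I"
    then have T: "T \<subseteq> I" by simp
    have inj: "inj_on a T" "inj_on b (I - T)" using assms T by (auto intro: inj_on_subset)
    have "xmon (a ` T \<union> b ` (I - T)) = (xmon (a ` T) * xmon (b ` (I - T)) :: 'a mpoly)"
      using assms T by (intro xmon_Un) (auto intro: finite_subset)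
    also have "\<dots> = (\<Prod>i\<in>T. Var (a i)) * (\<Prod>i\<in>I-T. Var (b i))"
      by (simp add: xmon_image inj)
    finally show "(\<Prod>i\<in>T. Var (a i)) * (\<Prod>i\<in>I-T. smult (d i) (Var (b i))) =
        smult (\<Prod>i\<in>I-T. d i) (xmon (a ` T \<union> b ` (I - T)))"
      by (simp add: smult_prod)
  qed
  finally show ?thesis .
qed

lemma card_pairs:
  assumes "finite I" "inj_on a I" "inj_on b I" "a ` I \<inter> b ` I = {}" "T \<subseteq> I"
  shows "card (a ` T \<union> b ` (I - T)) = card I"
proof -
  have "card (a ` T \<union> b ` (I - T)) = card (a ` T) + card (b ` (I - T))"
    using assms by (intro card_Un_disjoint) (auto intro: finite_subset)
  also have "\<dots> = card T + card (I - T)"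
    using assms by (simp add: card_image inj_on_subset[OF assms(2)] inj_on_subset[OF assms(3)])
  also have "\<dots> = card I"
    using assms(1,5) by (metis card_Diff_subset card_mono finite_subset le_add_diff_inverse)
  finally show ?thesis .
qed

lemma inj_on_mirror: "inj_on ((-) (Suc n)) {1..n}"
  by (auto intro!: inj_onI)

lemma mirror_diffs_expand:
  assumes "2 * j \<le> n"
  shows "(mirror_diffs n j :: 'a::field mpoly) =
    (\<Sum>T\<in>Pow {1..j}. smult ((-1) ^ card ({1..j} - T)) (xmon (T \<union> ((-) (Suc n)) ` ({1..j} - T))))"
proof -
  have "(mirror_diffs n j :: 'a mpoly) = (\<Prod>i\<in>{1..j}. Var i + smult (-1) (Var (Suc n - i)))"
    by (simp add: mirror_diffs_def)
  also have "\<dots> = (\<Sum>T\<in>Pow {1..j}. smult (\<Prod>i\<in>{1..j}-T. -1) (xmon ((\<lambda>i. i) ` T \<union> ((-) (Suc n)) ` ({1..j} - T))))"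
    using assms by (intro prod_pairs_expand) (auto intro: inj_on_subset[OF inj_on_mirror])
  finally show ?thesis by simp
qed

lemma mirror_diffs_set:
  assumes "2 * j \<le> n" "T \<subseteq> {1..j}"
  shows "T \<union> ((-) (Suc n)) ` ({1..j} - T) \<subseteq> {1..n} - {j+1..n-j}"
    and "card (T \<union> ((-) (Suc n)) ` ({1..j} - T)) = j"
proof -
  show "T \<union> ((-) (Suc n)) ` ({1..j} - T) \<subseteq> {1..n} - {j+1..n-j}"
    using assms by auto
  have "card ((\<lambda>i. i) ` T \<union> ((-) (Suc n)) ` ({1..j} - T)) = card {1..j}"
    using assms by (intro card_pairs) (auto intro: inj_on_subset[OF inj_on_mirror])
  then show "card (T \<union> ((-) (Suc n)) ` ({1..j} - T)) = j" by simp
qed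

lemma gen_expand:
  assumes "2 * k \<le> n" "j \<le> k"
  shows "(summand_gen n k j :: 'a::field mpoly) =
    (\<Sum>T\<in>Pow {1..j}. \<Sum>Q | Q \<subseteq> {j+1..n-j} \<and> card Q = k - j.
      smult ((-1) ^ card ({1..j} - T)) (xmon (T \<union> ((-) (Suc n)) ` ({1..j} - T) \<union> Q)))"
proof -
  have j: "2 * j \<le> n" using assms by simp
  have "xmon (T \<union> ((-) (Suc n)) ` ({1..j} - T)) * xmon Q =
      (xmon (T \<union> ((-) (Suc n)) ` ({1..j} - T) \<union> Q) :: 'a mpoly)"
    if "T \<subseteq> {1..j}" "Q \<subseteq> {j+1..n-j}" for T Q
    using mirror_diffs_set(1)[OF j that(1)] that
    by (intro xmon_Un[symmetric]) (auto intro: finite_subset)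
  then show ?thesis
    unfolding summand_gen_def mirror_diffs_expand[OF j] esym_def sum_product
    by (intro sum.cong) auto
qed

lemma gen_in_V:
  assumes "2 * k \<le> n" "j \<le> k"
  shows "summand_gen n k j \<in> V n k"
proof -
  have j: "2 * j \<le> n" using assms by simp
  have "T \<union> ((-) (Suc n)) ` ({1..j} - T) \<union> Q \<in> ksubs n k"
    if "T \<subseteq> {1..j}" "Q \<subseteq> {j+1..n-j}" "card Q = k - j" for T Q
  proof -
    have "card (T \<union> ((-) (Suc n)) ` ({1..j} - T) \<union> Q) =
        card (T \<union> ((-) (Suc n)) ` ({1..j} - T)) + card Q"
      using mirror_diffs_set(1)[OF j that(1)] that by (intro card_Un_disjoint) (auto intro: finite_subset)
    then have "card (T \<union> ((-) (Suc n)) ` ({1..j} - T) \<union> Q) = k"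
      using mirror_diffs_set(2)[OF j that(1)] that(3) assms by simp
    moreover have "Q \<subseteq> {1..n}" using that(2) by (rule subset_trans) auto
    moreover have "T \<union> ((-) (Suc n)) ` ({1..j} - T) \<subseteq> {1..n}"
      using mirror_diffs_set(1)[OF j that(1)] by (rule subset_trans) auto
    ultimately show ?thesis unfolding ksubs_def by blast
  qed
  then show ?thesis
    unfolding gen_expand[OF assms]
    by (intro mpoly.subspace_sum[OF subspace_V] mpoly.subspace_scale[OF subspace_V] xmon_in_V) auto
qed

text \<open>An index \<open>Suc n - i\<close> with \<open>i \<le> j\<close> exceeds
  \<open>k\<close>. Reaching \<open>{1..k}\<close> therefore forces the first term of every
  difference, and then \<open>Q = {j+1..k}\<close>.\<close>

lemma coeff_at_gen:
  assumes "2 * k \<le> n" "j \<le> k"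
  shows "coeff_at (summand_gen n k j :: 'a::field mpoly) {1..k} = 1"
proof -
  have j: "2 * j \<le> n" using assms by simp
  let ?Q = "{Q. Q \<subseteq> {j+1..n-j} \<and> card Q = k - j}"
  have finQ: "finite ?Q" by (rule finite_subset[of _ "Pow {j+1..n-j}"]) auto
  have eq: "T \<union> ((-) (Suc n)) ` ({1..j} - T) \<union> Q = {1..k} \<longleftrightarrow> T = {1..j} \<and> Q = {j+1..k}"
    if "T \<subseteq> {1..j}" "Q \<subseteq> {j+1..n-j}" for T Q
  proof
    assume e: "T \<union> ((-) (Suc n)) ` ({1..j} - T) \<union> Q = {1..k}"
    have "i \<in> T" if "i \<in> {1..j}" for i
    proof (rule ccontr)
      assume "i \<notin> T"
      then have "Suc n - i \<in> {1..k}" using e that by blast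
      then show False using that assms by auto
    qed
    then have T: "T = {1..j}" using that by auto
    then have "{1..j} \<union> Q = {1..k}" using e by simp
    then have "Q = {1..k} - {1..j}" using that by auto
    then show "T = {1..j} \<and> Q = {j+1..k}" using T by auto
  next
    assume "T = {1..j} \<and> Q = {j+1..k}"
    then show "T \<union> ((-) (Suc n)) ` ({1..j} - T) \<union> Q = {1..k}" using assms by auto
  qed
  have "coeff_at (summand_gen n k j :: 'a mpoly) {1..k} =
    (\<Sum>T\<in>Pow {1..j}. \<Sum>Q\<in>?Q. if T = {1..j} \<and> Q = {j+1..k} then 1 else 0)"
    unfolding gen_expand[OF assms] coeff_at_sum
  proof (intro sum.cong refl)
    fix T Q assume TQ: "T \<in> Pow {1..j}" "Q \<in> ?Q"
    then have "finite T" "finite Q" by (auto intro: finite_subset)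
    then show "coeff_at (smult ((-1) ^ card ({1..j} - T)) (xmon (T \<union> ((-) (Suc n)) ` ({1..j} - T) \<union> Q))) {1..k} =
        (if T = {1..j} \<and> Q = {j+1..k} then 1 else (0::'a))"
      using eq[of T Q] TQ by (auto simp: coeff_at_smult coeff_at_xmon)
  qed
  also have "\<dots> = (\<Sum>T\<in>Pow {1..j}. if T = {1..j} then 1 else 0)"
  proof (intro sum.cong refl)
    fix T
    have "{j+1..k} \<in> ?Q" using assms by auto
    then show "(\<Sum>Q\<in>?Q. if T = {1..j} \<and> Q = {j+1..k} then 1 else 0) = (if T = {1..j} then 1 else (0::'a))"
      using finQ by (cases "T = {1..j}") auto
  qed
  also have "\<dots> = 1" by simp
  finally show ?thesis .
qed

lemma act_esym:
  assumes "u permutes Z"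
  shows "act u (esym Z p) = esym Z p"
proof -
  have b: "bij u" using assms by (rule permutes_bij)
  show ?thesis
    unfolding esym_def act_sum[OF b] act_xmon[OF b]
  proof (rule sum.reindex_bij_witness[where i="\<lambda>K. inv u ` K" and j="\<lambda>K. u ` K"])
    fix K assume "K \<in> {K. K \<subseteq> Z \<and> card K = p}"
    then show "inv u ` K \<in> {K. K \<subseteq> Z \<and> card K = p}" "u ` inv u ` K = K"
      using permutes_in_image[OF permutes_inv[OF assms]] permutes_inj[OF permutes_inv[OF assms]]
      by (auto simp: card_image inj_on_subset image_comp permutes_inv_o[OF assms])
  next
    fix K assume "K \<in> {K. K \<subseteq> Z \<and> card K = p}"
    then show "u ` K \<in> {K. K \<subseteq> Z \<and> card K = p}" "inv u ` u ` K = K"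
      using permutes_in_image[OF assms] permutes_inj[OF assms]
      by (auto simp: card_image inj_on_subset image_inv_f_f)
  qed auto
qed

lemma act_esym_fixed:
  assumes "bij u" "\<And>x. x \<in> Z \<Longrightarrow> u x = x"
  shows "act u (esym Z p) = esym Z p"
proof -
  have "u ` K = K" if "K \<subseteq> Z" for K using assms(2) that by (auto simp: image_iff subset_iff)
  then show ?thesis
    unfolding esym_def act_sum[OF assms(1)] act_xmon[OF assms(1)]
    by (intro sum.cong) auto
qed

lemma alternating_gen:
  assumes "2 * k \<le> n" "j \<le> k"
  shows "alternating n k j (summand_gen n k j :: 'a::field mpoly)"
  unfolding alternating_def
proof (intro conjI ballI allI impI)
  show "summand_gen n k j \<in> (V n k :: 'a mpoly set)" by (rule gen_in_V[OF assms])
next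
  fix i assume i: "i \<in> {1..j}"
  let ?s = "transpose i (Suc n - i)"
  have d: "mirror_diffs n j = ((Var i - Var (Suc n - i)) * (\<Prod>l\<in>{1..j}-{i}. Var l - Var (Suc n - l)) :: 'a mpoly)"
    unfolding mirror_diffs_def by (rule prod.remove) (use i in auto)
  have "act ?s (mirror_diffs n j) = - (mirror_diffs n j :: 'a mpoly)"
  proof -
    have bs: "bij ?s" by simp
    have "act ?s (\<Prod>l\<in>{1..j}-{i}. Var l - Var (Suc n - l)) = (\<Prod>l\<in>{1..j}-{i}. Var l - Var (Suc n - l) :: 'a mpoly)"
      unfolding act_prod[OF bs]
    proof (intro prod.cong refl)
      fix l assume "l \<in> {1..j} - {i}"
      then have "?s l = l" "?s (Suc n - l) = Suc n - l" using i assms by (auto simp: transpose_def)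
      then show "act ?s (Var l - Var (Suc n - l)) = (Var l - Var (Suc n - l) :: 'a mpoly)"
        by (simp add: act_diff act_Var)
    qed
    then show ?thesis
      unfolding d by (simp add: act_mult act_diff act_Var) (simp add: algebra_simps)
  qed
  moreover have "act ?s (esym {j+1..n-j} (k-j)) = (esym {j+1..n-j} (k-j) :: 'a mpoly)"
    using i assms by (intro act_esym_fixed) (auto simp: transpose_def)
  ultimately show "act ?s (summand_gen n k j) = - (summand_gen n k j :: 'a mpoly)"
    by (simp add: summand_gen_def act_mult)
next
  fix u assume u: "u permutes {j+1..n-j}"
  have b: "bij u" using u by (rule permutes_bij)
  have "act u (mirror_diffs n j) = (mirror_diffs n j :: 'a mpoly)"
    unfolding mirror_diffs_def act_prod[OF b]
  proof (intro prod.cong refl)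
    fix l assume "l \<in> {1..j}"
    then have "u l = l" "u (Suc n - l) = Suc n - l" using assms by (auto intro!: permutes_not_in[OF u])
    then show "act u (Var l - Var (Suc n - l)) = (Var l - Var (Suc n - l) :: 'a mpoly)"
      by (simp add: act_diff act_Var b)
  qed
  then show "act u (summand_gen n k j) = (summand_gen n k j :: 'a mpoly)"
    unfolding summand_gen_def act_mult[OF b] act_esym[OF u] by simp
qed

lemma finite_subsets_card: "finite Z \<Longrightarrow> finite {K. K \<subseteq> Z \<and> card K = p}"
  by (rule finite_subset[of _ "Pow Z"]) auto

lemma esym_0: "finite Z \<Longrightarrow> esym Z 0 = 1"
proof -
  assume "finite Z"
  then have "{K. K \<subseteq> Z \<and> card K = 0} = {{}}" by (auto dest: finite_subset)
  then show ?thesis by (simp add: esym_def)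
qed

lemma gen_self: "summand_gen n j j = mirror_diffs n j"
  by (simp add: summand_gen_def esym_0)

text \<open>The inclusion map from \<open>j\<close>-sets to \<open>k\<close>-sets: it sends
  \<open>x_J\<close> to the sum of the \<open>x_K\<close> with \<open>K\<close> containing
  \<open>J\<close>. Written through coefficients, it is linear on all polynomials, as
  \<open>act\<close> is.\<close>

definition raise :: "nat \<Rightarrow> nat \<Rightarrow> nat \<Rightarrow> 'a::field mpoly \<Rightarrow> 'a mpoly" where
  "raise n k j f = (\<Sum>K\<in>ksubs n k. smult (\<Sum>J | J \<subseteq> K \<and> card J = j. coeff_at f J) (xmon K))"

lemma raise_in_V: "raise n k j f \<in> V n k"
  unfolding raise_def
  by (intro mpoly.subspace_sum[OF subspace_V] mpoly.subspace_scale[OF subspace_V] xmon_in_V)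

lemma coeff_at_raise:
  assumes "K \<in> ksubs n k"
  shows "coeff_at (raise n k j f) K = (\<Sum>J | J \<subseteq> K \<and> card J = j. coeff_at f J)"
proof -
  have "coeff_at (raise n k j f) K =
      (\<Sum>L\<in>ksubs n k. if L = K then (\<Sum>J | J \<subseteq> K \<and> card J = j. coeff_at f J) else 0)"
    unfolding raise_def coeff_at_sum
    using assms by (intro sum.cong) (auto simp: coeff_at_smult coeff_at_xmon ksubs_finite)
  then show ?thesis using assms by simp
qed

lemma raise_add: "raise n k j (f + g) = raise n k j f + raise n k j g"
  by (simp add: raise_def coeff_at_add sum.distrib mpoly.scale_left_distrib)

lemma raise_smult: "raise n k j (smult c f) = smult c (raise n k j f)"
  by (simp add: raise_def coeff_at_smult mpoly.scale_sum_right flip: sum_distrib_left)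

lemma act_raise:
  assumes "\<sigma> permutes {1..n}"
  shows "act \<sigma> (raise n k j f) = raise n k j (act \<sigma> f)"
proof (rule V_eqI[of _ n k])
  have b: "bij \<sigma>" using assms by (rule permutes_bij)
  show "act \<sigma> (raise n k j f) \<in> V n k" by (intro act_V assms raise_in_V)
  show "raise n k j (act \<sigma> f) \<in> V n k" by (rule raise_in_V)
  fix K assume K: "K \<in> ksubs n k"
  have fin: "finite K" using K ksubs_finite by blast
  have inv: "inv \<sigma> ` K \<in> ksubs n k" using K by (intro permutes_ksubs permutes_inv assms)
  have "coeff_at (act \<sigma> (raise n k j f)) K = (\<Sum>J | J \<subseteq> inv \<sigma> ` K \<and> card J = j. coeff_at f J)"
    by (simp add: coeff_at_act[OF b fin] coeff_at_raise[OF inv])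
  also have "\<dots> = (\<Sum>J | J \<subseteq> K \<and> card J = j. coeff_at f (inv \<sigma> ` J))"
  proof (rule sum.reindex_bij_witness[where i="\<lambda>J. inv \<sigma> ` J" and j="\<lambda>J. \<sigma> ` J"])
    fix J assume J: "J \<in> {J. J \<subseteq> inv \<sigma> ` K \<and> card J = j}"
    show "inv \<sigma> ` \<sigma> ` J = J" by (intro image_inv_f_f bij_is_inj b)
    have "\<sigma> ` J \<subseteq> \<sigma> ` inv \<sigma> ` K" using J by blast
    also have "\<dots> = K" using b by (simp add: image_f_inv_f bij_is_surj)
    finally show "\<sigma> ` J \<in> {J. J \<subseteq> K \<and> card J = j}"
      using J b by (simp add: card_image inj_on_subset[OF bij_is_inj])
    show "coeff_at f (inv \<sigma> ` \<sigma> ` J) = coeff_at f J" by (simp add: \<open>inv \<sigma> ` \<sigma> ` J = J\<close>)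
  next
    fix J assume J: "J \<in> {J. J \<subseteq> K \<and> card J = j}"
    show "\<sigma> ` inv \<sigma> ` J = J" using b by (simp add: image_f_inv_f bij_is_surj)
    show "inv \<sigma> ` J \<in> {J. J \<subseteq> inv \<sigma> ` K \<and> card J = j}"
      using J bij_is_inj[OF bij_imp_bij_inv[OF b]] by (auto simp: card_image inj_on_subset)
  qed
  also have "\<dots> = coeff_at (raise n k j (act \<sigma> f)) K"
    unfolding coeff_at_raise[OF K]
    using fin by (intro sum.cong) (auto simp: coeff_at_act[OF b] dest: finite_subset)
  finally show "coeff_at (act \<sigma> (raise n k j f)) K = coeff_at (raise n k j (act \<sigma> f)) K" .
qed

text \<open>By equivariance the image is again alternating, hence a multiple of the generator. The
  multiple is 1: among the \<open>j\<close>-subsets of \<open>{1..k}\<close> only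
  \<open>{1..j}\<close> occurs in \<open>mirror_diffs n j\<close>, because each
  \<open>Suc n - i\<close> exceeds \<open>k\<close>.\<close>

lemma raise_mirror_diffs:
  assumes "2 * k \<le> n" "j \<le> k"
  shows "raise n k j (mirror_diffs n j) = (summand_gen n k j :: 'a::field_char_0 mpoly)"
proof -
  have j: "2 * j \<le> n" using assms by simp
  have alt: "alternating n j j (mirror_diffs n j :: 'a mpoly)"
    using alternating_gen[of j n j] j by (simp add: gen_self)
  have neg: "raise n k j (- f) = - raise n k j f" for f :: "'a mpoly"
    using raise_smult[of n k j "-1" f] by simp
  have "act (transpose i (Suc n - i)) (raise n k j (mirror_diffs n j)) = - (raise n k j (mirror_diffs n j) :: 'a mpoly)"
    if "i \<in> {1..j}" for i
  proof -
    have "transpose i (Suc n - i) permutes {1..n}" using that assms by (intro permutes_swap_id) auto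
    then show ?thesis using alt that neg by (simp add: act_raise alternating_def)
  qed
  moreover have "act u (raise n k j (mirror_diffs n j)) = (raise n k j (mirror_diffs n j) :: 'a mpoly)"
    if "u permutes {j+1..n-j}" for u
  proof -
    have "u permutes {1..n}" using that by (rule permutes_subset) auto
    then show ?thesis using alt that by (simp add: act_raise alternating_def)
  qed
  ultimately have "alternating n k j (raise n k j (mirror_diffs n j) :: 'a mpoly)"
    using raise_in_V by (auto simp: alternating_def)
  then have "raise n k j (mirror_diffs n j) = smult (coeff_at (raise n k j (mirror_diffs n j)) {1..k}) (summand_gen n k j :: 'a mpoly)"
    by (rule alternating_unique[OF assms _ alternating_gen[OF assms] coeff_at_gen[OF assms]])
  moreover have "coeff_at (raise n k j (mirror_diffs n j) :: 'a mpoly) {1..k} = 1"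
  proof -
    have mem: "{1..k} \<in> ksubs n k" using assms by (auto simp: ksubs_def)
    have "coeff_at (mirror_diffs n j :: 'a mpoly) J = (if J = {1..j} then 1 else 0)"
      if "J \<subseteq> {1..k}" "card J = j" for J
    proof (cases "J = {1..j}")
      case True
      then show ?thesis using coeff_at_gen[of j n j] j by (simp add: gen_self)
    next
      case False
      have finJ: "finite J" using that(1) finite_subset by blast
      have "T \<union> ((-) (Suc n)) ` ({1..j} - T) \<noteq> J" if T: "T \<subseteq> {1..j}" for T
      proof
        assume e: "T \<union> ((-) (Suc n)) ` ({1..j} - T) = J"
        have "i \<in> T" if "i \<in> {1..j}" for i
        proof (rule ccontr)
          assume "i \<notin> T"
          then have "Suc n - i \<in> {1..k}" using e that \<open>J \<subseteq> {1..k}\<close> by blast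
          then show False using that assms by auto
        qed
        then have "T = {1..j}" using T by auto
        then show False using e False by simp
      qed
      then have "coeff_at (smult ((-1) ^ card ({1..j} - T))
          (xmon (T \<union> ((-) (Suc n)) ` ({1..j} - T)))) J = (0::'a)" if "T \<in> Pow {1..j}" for T
        using finJ finite_subset[of T "{1..j}"] that by (simp add: coeff_at_smult coeff_at_xmon)
      then show ?thesis
        unfolding mirror_diffs_expand[OF j] coeff_at_sum using False by simp
    qed
    then have "coeff_at (raise n k j (mirror_diffs n j) :: 'a mpoly) {1..k} =
        (\<Sum>J | J \<subseteq> {1..k} \<and> card J = j. if J = {1..j} then 1 else 0)"
      unfolding coeff_at_raise[OF mem] by (intro sum.cong) auto
    also have "\<dots> = 1"
    proof -
      have "finite {J. J \<subseteq> {1..k} \<and> card J = j}" by (rule finite_subset[of _ "Pow {1..k}"]) auto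
      then show ?thesis using assms by (simp add: sum.delta)
    qed
    finally show ?thesis .
  qed
  ultimately show ?thesis by simp
qed

lemma transp_sum_raise: "raise n k j (transp_sum n f) = transp_sum n (raise n k j f)"
proof -
  have sum: "raise n k j (\<Sum>i\<in>I. g i) = (\<Sum>i\<in>I. raise n k j (g i))" for I :: "nat set" and g :: "nat \<Rightarrow> 'a mpoly"
    by (induction I rule: infinite_finite_induct) (simp_all add: raise_add, simp_all add: raise_def)
  show ?thesis
    unfolding transp_sum_def sum
    by (intro sum.cong refl act_raise[symmetric] permutes_swap_id)
qed

text \<open>The eigenvalue is kept as a coefficient, without a closed form; it is read at
  \<open>{1..j}\<close>, where \<open>mirror_diffs n j\<close> has coefficient 1. It depends on
  \<open>n\<close> and \<open>j\<close> only, and \<open>raise\<close> carries it to every degree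
  \<open>k\<close>.\<close>

definition eigval :: "nat \<Rightarrow> nat \<Rightarrow> 'a::field" where
  "eigval n j = coeff_at (transp_sum n (mirror_diffs n j)) {1..j}"

lemma transp_sum_mirror_diffs:
  assumes "2 * j \<le> n"
  shows "transp_sum n (mirror_diffs n j) = smult (eigval n j) (mirror_diffs n j :: 'a::field_char_0 mpoly)"
  unfolding eigval_def
proof (rule alternating_unique[OF assms order_refl])
  have alt: "alternating n j j (mirror_diffs n j :: 'a mpoly)"
    using alternating_gen[of j n j] assms by (simp add: gen_self)
  then show "alternating n j j (mirror_diffs n j :: 'a mpoly)" "alternating n j j (transp_sum n (mirror_diffs n j :: 'a mpoly))"
    using assms by (auto intro: alternating_transp_sum)
  show "coeff_at (mirror_diffs n j :: 'a mpoly) {1..j} = 1"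
    using coeff_at_gen[of j n j] assms by (simp add: gen_self)
qed

lemma transp_sum_gen:
  assumes "2 * k \<le> n" "j \<le> k"
  shows "transp_sum n (summand_gen n k j) = smult (eigval n j) (summand_gen n k j :: 'a::field_char_0 mpoly)"
  using assms by (simp flip: raise_mirror_diffs transp_sum_raise add: transp_sum_mirror_diffs raise_smult)

section \<open>Irreducibility\<close>

definition orbit_span :: "nat \<Rightarrow> 'a::field mpoly \<Rightarrow> 'a mpoly set" where
  "orbit_span n f = mpoly.span ((\<lambda>\<sigma>. act \<sigma> f) ` {\<sigma>. \<sigma> permutes {1..n}})"

lemma act_inv_act: "\<sigma> permutes S \<Longrightarrow> act (inv \<sigma>) (act \<sigma> f) = f"
  using act_comp[OF bij_imp_bij_inv[OF permutes_bij] permutes_bij, of \<sigma> S \<sigma> S f]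
  by (simp add: permutes_inv_o)

lemma act_act_inv: "\<sigma> permutes S \<Longrightarrow> act \<sigma> (act (inv \<sigma>) f) = f"
  using act_comp[OF permutes_bij bij_imp_bij_inv[OF permutes_bij], of \<sigma> S \<sigma> S f]
  by (simp add: permutes_inv_o)

lemma act_orbit_span:
  "\<sigma> permutes {1..n} \<Longrightarrow> act \<sigma> f \<in> orbit_span n f"
  unfolding orbit_span_def by (intro mpoly.span_base) auto

lemma orbit_span_self: "f \<in> orbit_span n f"
  using act_orbit_span[OF permutes_id, where f = f] by simp

lemma subspace_orbit_span: "mpoly.subspace (orbit_span n f)"
  by (simp add: orbit_span_def)

lemma submodule_orbit_span: "submodule n (orbit_span n f)"
  unfolding submodule_def
proof (intro conjI allI impI)
  show "mpoly.subspace (orbit_span n f)" by (rule subspace_orbit_span)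
  fix \<sigma> g assume \<sigma>: "\<sigma> permutes {1..n}" and g: "g \<in> orbit_span n f"
  have b: "bij \<sigma>" using \<sigma> by (rule permutes_bij)
  show "act \<sigma> g \<in> orbit_span n f"
    using g unfolding orbit_span_def
  proof (induction rule: mpoly.span_induct_alt)
    case base
    then show ?case by (simp add: act_zero[OF b] mpoly.span_zero)
  next
    case (step c x y)
    then obtain \<tau> where \<tau>: "\<tau> permutes {1..n}" "x = act \<tau> f" by auto
    have "act \<sigma> x = act (\<sigma> \<circ> \<tau>) f" using \<tau> b by (simp add: act_comp permutes_bij)
    moreover have "\<sigma> \<circ> \<tau> permutes {1..n}" using \<tau> \<sigma> by (simp add: permutes_compose)
    ultimately have "act \<sigma> x \<in> (\<lambda>\<sigma>. act \<sigma> f) ` {\<sigma>. \<sigma> permutes {1..n}}" by auto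
    then show ?case
      unfolding act_add[OF b] act_smult[OF b]
      by (intro mpoly.span_add mpoly.span_scale) (use step in \<open>auto intro: mpoly.span_base\<close>)
  qed
qed

lemma orbit_span_subset:
  assumes "submodule n U" "f \<in> U"
  shows "orbit_span n f \<subseteq> U"
  unfolding orbit_span_def
  using assms by (intro mpoly.span_minimal) (auto simp: submodule_def)

text \<open>Centrality of \<open>transp_sum n\<close>, in the form used for Schur's lemma.\<close>

lemma submodule_eigenspace:
  assumes "submodule n W"
  shows "submodule n {f \<in> W. transp_sum n f = smult (l::'a::field) f}"
proof -
  have "transp_sum n (0 :: 'a mpoly) = 0" using transp_sum_smult[of n 0] by simp
  then show ?thesis
    using assms unfolding submodule_def mpoly.subspace_def
    by (auto simp: transp_sum_add transp_sum_smult mpoly.scale_right_distrib act_smult permutes_bij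
        simp flip: act_transp_sum)
qed

lemma orbit_span_eigenvector:
  assumes "transp_sum n f = smult l f" "g \<in> orbit_span n f"
  shows "transp_sum n g = smult l g"
proof -
  have "orbit_span n f \<subseteq> {h \<in> orbit_span n f. transp_sum n h = smult l h}"
    using assms(1) orbit_span_self
    by (intro orbit_span_subset submodule_eigenspace submodule_orbit_span) auto
  then show ?thesis using assms(2) by auto
qed

section \<open>An invariant hermitian form and irreducibility\<close>

definition hinner :: "nat \<Rightarrow> nat \<Rightarrow> complex mpoly \<Rightarrow> complex mpoly \<Rightarrow> complex" where
  "hinner n k f g = (\<Sum>K\<in>ksubs n k. coeff_at f K * cnj (coeff_at g K))"

lemma hinner_act:
  assumes \<sigma>: "\<sigma> permutes {1..n}"
  shows "hinner n k (act \<sigma> f) (act \<sigma> g) = hinner n k f g"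
proof -
  have b: "bij \<sigma>" using \<sigma> by (rule permutes_bij)
  show ?thesis unfolding hinner_def
  proof (rule sum.reindex_bij_witness[where j="\<lambda>K. inv \<sigma> ` K" and i="\<lambda>K. \<sigma> ` K"])
    fix K assume K: "K \<in> ksubs n k"
    show "\<sigma> ` inv \<sigma> ` K = K" using b by (simp add: image_f_inv_f bij_is_surj)
    show "inv \<sigma> ` K \<in> ksubs n k" using K by (intro permutes_ksubs permutes_inv \<sigma>)
    show "inv \<sigma> ` \<sigma> ` K = K" using b by (simp add: image_inv_f_f bij_is_inj)
    show "\<sigma> ` K \<in> ksubs n k" using K by (intro permutes_ksubs \<sigma>)
    show "coeff_at f (inv \<sigma> ` K) * cnj (coeff_at g (inv \<sigma> ` K)) =
        coeff_at (act \<sigma> f) K * cnj (coeff_at (act \<sigma> g) K)"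
      using K by (simp add: coeff_at_act[OF b ksubs_finite])
  qed
qed

lemma hinner_add_left: "hinner n k (f + f') g = hinner n k f g + hinner n k f' g"
  by (simp add: hinner_def coeff_at_add distrib_right sum.distrib)

lemma hinner_add_right: "hinner n k f (g + g') = hinner n k f g + hinner n k f g'"
  by (simp add: hinner_def coeff_at_add distrib_left sum.distrib)

lemma hinner_smult_left: "hinner n k (smult c f) g = c * hinner n k f g"
  by (simp add: hinner_def coeff_at_smult sum_distrib_left mult.assoc)

lemma hinner_smult_right: "hinner n k f (smult c g) = cnj c * hinner n k f g"
  by (simp add: hinner_def coeff_at_smult sum_distrib_left ac_simps)

lemma hinner_zero_left [simp]: "hinner n k 0 g = 0"
  by (simp add: hinner_def)

lemma hinner_zero_right [simp]: "hinner n k f 0 = 0"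
  by (simp add: hinner_def)

lemma hinner_sum_left: "hinner n k (\<Sum>i\<in>I. f i) g = (\<Sum>i\<in>I. hinner n k (f i) g)"
  by (induction I rule: infinite_finite_induct) (simp_all add: hinner_add_left)

lemma hinner_self_zero:
  assumes "f \<in> V n k" "hinner n k f f = 0"
  shows "f = 0"
proof (rule V_eqI[OF assms(1) mpoly.subspace_0[OF subspace_V]])
  fix K assume K: "K \<in> ksubs n k"
  have "complex_of_real (\<Sum>K\<in>ksubs n k. (cmod (coeff_at f K))\<^sup>2) = hinner n k f f"
    unfolding hinner_def of_real_sum by (intro sum.cong refl complex_norm_square)
  then have "(\<Sum>K\<in>ksubs n k. (cmod (coeff_at f K))\<^sup>2) = 0"
    using assms(2) by (metis of_real_eq_0_iff)
  then show "coeff_at f K = coeff_at 0 K"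
    using K by (simp add: sum_nonneg_eq_0_iff)
qed

lemma orbit_span_gen_subset:
  "2 * k \<le> n \<Longrightarrow> j \<le> k \<Longrightarrow> orbit_span n (summand_gen n k j) \<subseteq> V n k"
  by (intro orbit_span_subset submodule_V gen_in_V)

lemma gen_nonzero: "2 * k \<le> n \<Longrightarrow> j \<le> k \<Longrightarrow> summand_gen n k j \<noteq> (0 :: 'a::field mpoly)"
  using coeff_at_gen[of k n j, where 'a='a] by auto

text \<open>
The permutations sending the generator to itself or to its negative form a group. Projecting \<open>f\<close> to
the corresponding linear character gives a multiple of the generator, which is nonzero since the
projection does not change the inner product with the generator up to a positive factor.
\<close>

lemma gen_in_submodule:
  fixes U :: "complex mpoly set"
  assumes kn: "2 * k \<le> n" and jk: "j \<le> k" and U: "submodule n U" "U \<subseteq> V n k"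
    and f: "f \<in> U" "hinner n k f (summand_gen n k j) \<noteq> 0"
  shows "summand_gen n k j \<in> U"
proof -
  let ?g = "summand_gen n k j :: complex mpoly"
  have sub: "mpoly.subspace U" using U(1) by (simp add: submodule_def)
  define G where "G = {\<sigma>. \<sigma> permutes {1..n} \<and> (\<exists>e\<in>{1, -1}. act \<sigma> ?g = smult e ?g)}"
  \<comment> \<open>Since the generator has coefficient 1 at \<open>{1..k}\<close>, this coefficient
    recovers the sign by which \<open>\<sigma>\<close> acts on it.\<close>
  define e where "e \<sigma> = coeff_at (act \<sigma> ?g) {1..k}" for \<sigma>
  have e_eq: "e \<sigma> = c" if "act \<sigma> ?g = smult c ?g" for \<sigma> c
    using that by (simp add: e_def coeff_at_smult coeff_at_gen[OF kn jk] del: One_nat_def)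
  have eG: "act \<sigma> ?g = smult (e \<sigma>) ?g" "e \<sigma> * e \<sigma> = 1" "cnj (e \<sigma>) = e \<sigma>" "\<sigma> permutes {1..n}" "bij \<sigma>"
    if "\<sigma> \<in> G" for \<sigma>
  proof -
    from that obtain c where c: "c = 1 \<or> c = -1" "act \<sigma> ?g = smult c ?g" unfolding G_def by blast
    then have "e \<sigma> = c" by (intro e_eq)
    with c show "act \<sigma> ?g = smult (e \<sigma>) ?g" "e \<sigma> * e \<sigma> = 1" "cnj (e \<sigma>) = e \<sigma>" by auto
    show "\<sigma> permutes {1..n}" "bij \<sigma>" using that by (auto simp: G_def permutes_bij)
  qed
  have comp: "\<tau> \<circ> \<sigma> \<in> G" "e (\<tau> \<circ> \<sigma>) = e \<tau> * e \<sigma>" if "\<tau> \<in> G" "\<sigma> \<in> G" for \<tau> \<sigma>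
  proof -
    have a: "act (\<tau> \<circ> \<sigma>) ?g = smult (e \<tau> * e \<sigma>) ?g"
      using that by (simp add: act_comp eG act_smult mult.commute)
    then show "e (\<tau> \<circ> \<sigma>) = e \<tau> * e \<sigma>" by (rule e_eq)
    have "e \<tau> * e \<sigma> \<in> {1, -1}"
      using eG(2)[OF that(1)] eG(2)[OF that(2)] by (auto simp: square_eq_1_iff)
    with a show "\<tau> \<circ> \<sigma> \<in> G"
      using that by (auto simp: G_def intro: permutes_compose)
  qed
  have inv: "inv \<tau> \<in> G" if "\<tau> \<in> G" for \<tau>
  proof -
    have "act (inv \<tau>) (act \<tau> ?g) = ?g"
      by (rule act_inv_act[OF eG(4)[OF that]])
    then have "smult (e \<tau>) (act (inv \<tau>) ?g) = ?g"
      using eG[OF that] by (simp add: act_smult bij_imp_bij_inv)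
    then have "smult (e \<tau> * e \<tau>) (act (inv \<tau>) ?g) = smult (e \<tau>) ?g"
      by (metis mpoly.scale_scale)
    then have a: "act (inv \<tau>) ?g = smult (e \<tau>) ?g" using eG(2)[OF that] by simp
    have "e \<tau> \<in> {1, -1}" using eG(2)[OF that] by (auto simp: square_eq_1_iff)
    with a show ?thesis using eG(4)[OF that] by (auto simp: G_def intro: permutes_inv)
  qed
  have finG: "finite G"
    unfolding G_def by (rule finite_subset[OF _ finite_permutations[of "{1..n}"]]) auto
  have "id \<in> G" by (auto simp: G_def permutes_id intro!: bexI[of _ 1])
  then have cardG: "card G \<noteq> 0" using finG by auto
  define h where "h = (\<Sum>\<sigma>\<in>G. smult (e \<sigma>) (act \<sigma> f))"
  have hU: "h \<in> U"
    unfolding h_def using U(1) f(1) eG(4)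
    by (intro mpoly.subspace_sum[OF sub] mpoly.subspace_scale[OF sub]) (auto simp: submodule_def)
  have acth: "act \<tau> h = smult (e \<tau>) h" if \<tau>: "\<tau> \<in> G" for \<tau>
  proof -
    have "act \<tau> h = (\<Sum>\<sigma>\<in>G. smult (e \<sigma>) (act (\<tau> \<circ> \<sigma>) f))"
      unfolding h_def act_sum[OF eG(5)[OF \<tau>]]
      by (intro sum.cong refl) (simp add: act_smult act_comp eG(5) \<tau>)
    also have "\<dots> = (\<Sum>\<sigma>\<in>G. smult (e \<tau> * e \<sigma>) (act \<sigma> f))"
    proof (rule sum.reindex_bij_witness[where i="\<lambda>v. inv \<tau> \<circ> v" and j="\<lambda>v. \<tau> \<circ> v"])
      fix \<sigma> assume \<sigma>: "\<sigma> \<in> G"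
      have "e \<tau> * e (\<tau> \<circ> \<sigma>) = (e \<tau> * e \<tau>) * e \<sigma>" using comp(2)[OF \<tau> \<sigma>] by simp
      then show "smult (e \<tau> * e (\<tau> \<circ> \<sigma>)) (act (\<tau> \<circ> \<sigma>) f) = smult (e \<sigma>) (act (\<tau> \<circ> \<sigma>) f)"
        using eG(2)[OF \<tau>] by simp
    qed (use \<tau> eG(4)[OF \<tau>] in \<open>simp_all add: comp inv o_assoc permutes_inv_o\<close>)
    also have "\<dots> = smult (e \<tau>) h"
      by (simp add: h_def mpoly.scale_sum_right)
    finally show ?thesis .
  qed
  have alt: "alternating n k j ?g" by (rule alternating_gen[OF kn jk])
  \<comment> \<open>The swaps lie in \<open>G\<close> with sign -1 and the permutations of
    \<open>{j+1..n-j}\<close> with sign 1, so \<open>h\<close> lies on the line of the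
    generator.\<close>
  have "alternating n k j h"
    unfolding alternating_def
  proof (intro conjI ballI allI impI)
    show "h \<in> V n k" using hU U(2) by blast
  next
    fix i assume i: "i \<in> {1..j}"
    then have "transpose i (Suc n - i) permutes {1..n}" using kn jk by (intro permutes_swap_id) auto
    moreover have a: "act (transpose i (Suc n - i)) ?g = smult (-1) ?g"
      using alt i by (simp add: alternating_def)
    ultimately have "transpose i (Suc n - i) \<in> G" by (auto simp: G_def)
    then show "act (transpose i (Suc n - i)) h = - h" using acth e_eq[OF a] by simp
  next
    fix u assume u: "u permutes {j+1..n-j}"
    then have "u permutes {1..n}" by (rule permutes_subset) auto
    moreover have a: "act u ?g = smult 1 ?g" using alt u by (simp add: alternating_def)
    ultimately have "u \<in> G" by (auto simp: G_def)
    then show "act u h = h" using acth e_eq[OF a] by simp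
  qed
  then have h: "h = smult (coeff_at h {1..k}) ?g"
    by (rule alternating_unique[OF kn jk _ alt coeff_at_gen[OF kn jk]])
  have "hinner n k h ?g = (\<Sum>\<sigma>\<in>G. hinner n k f ?g)"
    unfolding h_def hinner_sum_left
  proof (intro sum.cong refl)
    fix \<sigma> assume \<sigma>: "\<sigma> \<in> G"
    have "hinner n k f ?g = hinner n k (act \<sigma> f) (act \<sigma> ?g)"
      using eG(4)[OF \<sigma>] by (simp add: hinner_act)
    also have "\<dots> = e \<sigma> * hinner n k (act \<sigma> f) ?g"
      by (simp add: eG(1)[OF \<sigma>] eG(3)[OF \<sigma>] hinner_smult_right)
    finally show "hinner n k (smult (e \<sigma>) (act \<sigma> f)) ?g = hinner n k f ?g"
      by (simp add: hinner_smult_left)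
  qed
  then have "h \<noteq> 0" using f(2) cardG by auto
  then have c: "coeff_at h {1..k} \<noteq> 0" using h by auto
  have "smult (1 / coeff_at h {1..k}) h \<in> U" using hU by (rule mpoly.subspace_scale[OF sub])
  moreover have "smult (1 / coeff_at h {1..k}) h = ?g"
    using c by (subst h) simp
  ultimately show ?thesis by simp
qed

text \<open>James' dichotomy: a submodule not orthogonal to the generator contains it. Otherwise it
  is orthogonal to all translates of the generator, hence to the orbit span in which it lies, hence
  to itself, and positive definiteness makes it zero.\<close>

lemma irreducible_orbit_span_gen:
  assumes kn: "2 * k \<le> n" and jk: "j \<le> k"
  shows "irreducible_submodule n (orbit_span n (summand_gen n k j :: complex mpoly))"
  unfolding irreducible_submodule_def
proof (intro conjI allI impI)
  let ?g = "summand_gen n k j :: complex mpoly"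
  show "submodule n (orbit_span n ?g)" by (rule submodule_orbit_span)
  show "orbit_span n ?g \<noteq> {0}" using orbit_span_self[of ?g n] gen_nonzero[OF kn jk] by auto
  fix U assume U: "submodule n U" "U \<subseteq> orbit_span n ?g"
  have UV: "U \<subseteq> V n k" using U(2) orbit_span_gen_subset[OF kn jk] by blast
  show "U = {0} \<or> U = orbit_span n ?g"
  proof (cases "\<exists>f\<in>U. hinner n k f ?g \<noteq> 0")
    case True
    then have "?g \<in> U" using gen_in_submodule[OF kn jk U(1) UV] by blast
    then show ?thesis using orbit_span_subset[OF U(1)] U(2) by blast
  next
    case False
    have orth: "hinner n k f g = 0" if "f \<in> U" "g \<in> orbit_span n ?g" for f g
      using that(2) unfolding orbit_span_def
    proof (induction rule: mpoly.span_induct_alt)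
      case base
      then show ?case by simp
    next
      case (step c x y)
      then obtain \<tau> where \<tau>: "\<tau> permutes {1..n}" "x = act \<tau> ?g" by auto
      have "act (inv \<tau>) f \<in> U" using U(1) \<tau>(1) that(1) by (auto simp: submodule_def permutes_inv)
      then have "0 = hinner n k (act \<tau> (act (inv \<tau>) f)) (act \<tau> ?g)"
        using False by (simp add: hinner_act[OF \<tau>(1)])
      also have "act \<tau> (act (inv \<tau>) f) = f"
        by (rule act_act_inv[OF \<tau>(1)])
      finally show ?case using step \<tau>(2) by (simp add: hinner_add_right hinner_smult_right)
    qed
    have "f = 0" if "f \<in> U" for f
      using hinner_self_zero[of f n k] orth[OF that] that U(2) UV by blast
    then show ?thesis using U(1) mpoly.subspace_0[of U] by (auto simp: submodule_def)
  qed
qed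

section \<open>Characters and uniqueness of the spherical function\<close>

text \<open>If \<open>l\<close> is a root of \<open>p\<close> and \<open>p = [:-l, 1:] * q\<close>,
  then \<open>w = q(L) v\<close> is killed by \<open>L - l\<close>. Either \<open>w\<close> is
  nonzero and is the eigenvector, or \<open>q\<close> annihilates \<open>v\<close> and has smaller
  degree.\<close>

lemma polynomial_root_eigenvector:
  fixes L :: "complex mpoly \<Rightarrow> complex mpoly" and p :: "complex poly"
  assumes L: "\<And>f g. L (f + g) = L f + L g" "\<And>c f. L (smult c f) = smult c (L f)"
    and W: "mpoly.subspace W" "\<And>f. f \<in> W \<Longrightarrow> L f \<in> W"
    and v: "v \<in> W" "v \<noteq> 0"
    and p: "p \<noteq> 0" "degree p \<le> m" "(\<Sum>i\<le>m. smult (coeff p i) ((L ^^ i) v)) = 0"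
  shows "\<exists>l. \<exists>w\<in>W. w \<noteq> 0 \<and> L w = smult l w"
  using p
proof (induction m arbitrary: p)
  case 0
  then have "coeff p 0 \<noteq> 0" by (metis le_zero_eq leading_coeff_0_iff)
  then show ?case using 0 v by simp
next
  case (Suc m)
  have L0: "L 0 = 0" using L(2)[of 0 0] by simp
  have Lsum: "L (\<Sum>i\<in>I. g i) = (\<Sum>i\<in>I. L (g i))" for I and g :: "nat \<Rightarrow> complex mpoly"
    by (induction I rule: infinite_finite_induct) (simp_all add: L0 L)
  show ?case
  proof (cases "degree p \<le> m")
    case True
    then have "coeff p (Suc m) = 0" by (intro coeff_eq_0) simp
    then show ?thesis using Suc True by simp
  next
    case False
    then have "degree p = Suc m" using Suc.prems by simp
    then obtain l where "poly p l = 0"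
      using fundamental_theorem_of_algebra[of p] constant_degree[of p] by auto
    then obtain q where q: "p = [:-l, 1:] * q" by (auto simp: poly_eq_0_iff_dvd)
    have q0: "q \<noteq> 0" using Suc.prems(1) q by auto
    then have "degree p = Suc (degree q)" unfolding q by (subst degree_mult_eq) auto
    then have dq: "degree q = m" using \<open>degree p = Suc m\<close> by simp
    define w where "w = (\<Sum>i\<le>m. smult (coeff q i) ((L ^^ i) v))"
    have pow: "(L ^^ i) v \<in> W" for i by (induction i) (auto simp: v W)
    have wW: "w \<in> W" unfolding w_def using pow
      by (intro mpoly.subspace_sum[OF W(1)] mpoly.subspace_scale[OF W(1)])
    have c: "coeff p i = coeff (pCons 0 q) i - l * coeff q i" for i by (simp add: q)
    have "(\<Sum>i\<le>Suc m. smult (coeff (pCons 0 q) i) ((L ^^ i) v)) =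
        (\<Sum>i\<le>m. smult (coeff q i) ((L ^^ Suc i) v))"
      by (subst sum.atMost_Suc_shift) simp
    also have "\<dots> = L w" by (simp add: w_def Lsum L)
    finally have a: "(\<Sum>i\<le>Suc m. smult (coeff (pCons 0 q) i) ((L ^^ i) v)) = L w" .
    have "coeff q (Suc m) = 0" using dq by (intro coeff_eq_0) simp
    then have b: "(\<Sum>i\<le>Suc m. smult (l * coeff q i) ((L ^^ i) v)) = smult l w"
      by (simp add: w_def mpoly.scale_sum_right)
    have "0 = (\<Sum>i\<le>Suc m. smult (coeff (pCons 0 q) i - l * coeff q i) ((L ^^ i) v))"
      using Suc.prems(3) unfolding c by simp
    also have "\<dots> = L w - smult l w"
      unfolding mpoly.scale_left_diff_distrib sum_subtractf a b ..
    finally have eig: "L w = smult l w" by simp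
    show ?thesis
    proof (cases "w = 0")
      case True
      then show ?thesis using Suc.IH[OF q0] dq by (simp add: w_def)
    next
      case False
      then show ?thesis using eig wW by blast
    qed
  qed
qed

text \<open>With \<open>m = card S\<close>, the \<open>m + 1\<close> vectors \<open>v\<close>,
  \<open>L v\<close>, ..., \<open>L^m v\<close> are linearly dependent, and the coefficients of a
  relation form an annihilating polynomial.\<close>

lemma ex_eigenvector:
  fixes L :: "complex mpoly \<Rightarrow> complex mpoly"
  assumes L: "\<And>f g. L (f + g) = L f + L g" "\<And>c f. L (smult c f) = smult c (L f)"
    and W: "mpoly.subspace W" "\<And>f. f \<in> W \<Longrightarrow> L f \<in> W" "W \<noteq> {0}"
    and S: "finite S" "W \<subseteq> mpoly.span S"
  shows "\<exists>l. \<exists>w\<in>W. w \<noteq> 0 \<and> L w = smult l w"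
proof -
  obtain v where v: "v \<in> W" "v \<noteq> 0" using W(1,3) mpoly.subspace_0 by blast
  define g where "g i = (L ^^ i) v" for i
  have gW: "g i \<in> W" for i unfolding g_def by (induction i) (auto simp: v W)
  define m where "m = card S"
  have "\<exists>c. (\<exists>i\<le>m. c i \<noteq> 0) \<and> (\<Sum>i\<le>m. smult (c i) (g i)) = 0"
  proof (cases "inj_on g {..m}")
    case True
    then have "card (g ` {..m}) = Suc m" by (simp add: card_image)
    then have "mpoly.dependent (g ` {..m})"
      using mpoly.independent_span_bound[OF S(1), of "g ` {..m}"] gW S(2) by (auto simp: m_def)
    then obtain u where u: "\<exists>w\<in>g ` {..m}. u w \<noteq> 0" "(\<Sum>w\<in>g ` {..m}. smult (u w) w) = 0"
      by (subst (asm) mpoly.dependent_finite) auto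
    then show ?thesis
      by (intro exI[of _ "\<lambda>i. u (g i)"]) (auto simp: sum.reindex[OF True])
  next
    \<comment> \<open>\<open>mpoly.dependent\<close> is a property of sets and does not see a
      repetition among the iterates, so a repeated vector is turned into a relation by hand.\<close>
    case False
    then obtain a b where ab: "a \<le> m" "b \<le> m" "a \<noteq> b" "g a = g b" by (auto simp: inj_on_def)
    let ?c = "\<lambda>i. (if i = a then 1 else 0) - (if i = b then 1 else (0::complex))"
    have "(\<Sum>i\<le>m. smult (?c i) (g i)) =
        (\<Sum>i\<le>m. if i = a then g i else 0) - (\<Sum>i\<le>m. if i = b then g i else 0)"
      unfolding sum_subtractf[symmetric] by (intro sum.cong) (auto simp: mpoly.scale_left_diff_distrib)
    also have "\<dots> = 0" using ab by simp
    finally show ?thesis using ab by (intro exI[of _ ?c]) (auto intro: exI[of _ a])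
  qed
  then obtain c where c: "\<exists>i\<le>m. c i \<noteq> 0" "(\<Sum>i\<le>m. smult (c i) (g i)) = 0" by blast
  define p where "p = (\<Sum>i\<le>m. monom (c i) i)"
  have cp: "coeff p i = (if i \<le> m then c i else 0)" for i
    by (simp add: p_def coeff_sum)
  have "p \<noteq> 0" using c(1) cp by (metis coeff_0)
  moreover have "degree p \<le> m" by (intro degree_le) (simp add: cp)
  moreover have "(\<Sum>i\<le>m. smult (coeff p i) ((L ^^ i) v)) = 0"
    using c(2) by (simp add: cp g_def)
  ultimately show ?thesis using polynomial_root_eigenvector[OF L W(1,2) v] by blast
qed

text \<open>Repeats the choice made inside \<open>trace_on\<close>, to give the basis behind
  \<open>character\<close> a name.\<close>

definition some_basis :: "'a::field mpoly set \<Rightarrow> 'a mpoly set" where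
  "some_basis W = (SOME B. mpoly.independent B \<and> mpoly.span B = W)"

lemma some_basis:
  assumes "mpoly.subspace W"
  shows "mpoly.independent (some_basis W)" "mpoly.span (some_basis W) = W"
proof -
  obtain B where "B \<subseteq> W" "mpoly.independent B" "W \<subseteq> mpoly.span B"
    using mpoly.maximal_independent_subset[of W] by blast
  then have "\<exists>B. mpoly.independent B \<and> mpoly.span B = W"
    using mpoly.span_subspace[OF _ _ assms] by blast
  then have "mpoly.independent (some_basis W) \<and> mpoly.span (some_basis W) = W"
    unfolding some_basis_def by (rule someI_ex)
  then show "mpoly.independent (some_basis W)" "mpoly.span (some_basis W) = W" by auto
qed

lemma finite_some_basis:
  assumes "mpoly.subspace W" "W \<subseteq> V n k"
  shows "finite (some_basis W)"
proof -
  have "some_basis W \<subseteq> W"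
    using mpoly.span_superset[of "some_basis W"] some_basis(2)[OF assms(1)] by simp
  then have "some_basis W \<subseteq> mpoly.span (xmon ` ksubs n k)"
    using assms(2) by (simp add: V_eq_span)
  then show ?thesis
    using mpoly.independent_span_bound[OF finite_imageI[OF finite_ksubs] some_basis(1)[OF assms(1)]] by simp
qed

lemma character_some_basis:
  "character W \<sigma> = (\<Sum>b\<in>some_basis W. mpoly.representation (some_basis W) (act \<sigma> b) b)"
  by (simp add: character_def trace_on_def some_basis_def Let_def)

lemma character_id:
  assumes "mpoly.subspace W"
  shows "character W id = of_nat (card (some_basis W))"
  by (simp add: character_some_basis mpoly.representation_basis[OF some_basis(1)[OF assms]])

text \<open>Both sides are the trace of \<open>transp_sum n\<close> on \<open>W\<close>: summand by
  summand on the left, scalar times dimension on the right.\<close>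

lemma sum_character_transpose:
  assumes W: "submodule n W" and eig: "\<And>f. f \<in> W \<Longrightarrow> transp_sum n f = smult l f"
  shows "(\<Sum>a=1..n. \<Sum>b=1..n. character W (transpose a b)) = l * character W id"
proof -
  have sub: "mpoly.subspace W" using W by (simp add: submodule_def)
  let ?B = "some_basis W"
  note B = some_basis[OF sub]
  have BW: "x \<in> W" if "x \<in> ?B" for x using mpoly.span_base[OF that] B(2) by simp
  have act: "act (transpose a b) x \<in> mpoly.span ?B" if "x \<in> ?B" "a \<in> {1..n}" "b \<in> {1..n}" for a b x
    using W BW[OF that(1)] permutes_swap_id[OF that(2,3)] B(2) by (auto simp: submodule_def)
  have "(\<Sum>a=1..n. \<Sum>b=1..n. character W (transpose a b)) =
      (\<Sum>x\<in>?B. \<Sum>a=1..n. \<Sum>b=1..n. mpoly.representation ?B (act (transpose a b) x) x)"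
    unfolding character_some_basis by (subst sum.swap, subst (2) sum.swap) simp
  also have "\<dots> = (\<Sum>x\<in>?B. mpoly.representation ?B (transp_sum n x) x)"
  proof (intro sum.cong refl)
    fix x assume x: "x \<in> ?B"
    have "mpoly.representation ?B (transp_sum n x) =
        (\<lambda>y. \<Sum>a=1..n. mpoly.representation ?B (\<Sum>b=1..n. act (transpose a b) x) y)"
      unfolding transp_sum_def using act[OF x]
      by (intro mpoly.representation_sum B(1) mpoly.span_sum) auto
    moreover have "mpoly.representation ?B (\<Sum>b=1..n. act (transpose a b) x) =
        (\<lambda>y. \<Sum>b=1..n. mpoly.representation ?B (act (transpose a b) x) y)" if "a \<in> {1..n}" for a
      using act[OF x that] by (intro mpoly.representation_sum B(1)) auto
    ultimately show "(\<Sum>a=1..n. \<Sum>b=1..n. mpoly.representation ?B (act (transpose a b) x) x) =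
        mpoly.representation ?B (transp_sum n x) x" by simp
  qed
  also have "\<dots> = (\<Sum>x\<in>?B. l)"
    using B(1) by (intro sum.cong refl)
      (simp add: eig BW mpoly.representation_scale mpoly.span_base mpoly.representation_basis)
  finally show ?thesis by (simp add: character_id[OF sub])
qed

text \<open>The eigenvalue is the sum of the character values at all \<open>transpose a b\<close>
  divided by the value at \<open>id\<close>, which is the nonzero dimension.\<close>

lemma character_determines_eigenvalue:
  fixes W W' :: "'a::field_char_0 mpoly set"
  assumes W: "submodule n W" "W \<subseteq> V n k" "W \<noteq> {0}" "\<And>f. f \<in> W \<Longrightarrow> transp_sum n f = smult l f"
    and W': "submodule n W'" "\<And>f. f \<in> W' \<Longrightarrow> transp_sum n f = smult l' f"
    and eq: "\<And>\<sigma>. \<sigma> permutes {1..n} \<Longrightarrow> character W \<sigma> = character W' \<sigma>"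
  shows "l = l'"
proof -
  have sub: "mpoly.subspace W" using W by (simp add: submodule_def)
  have "some_basis W \<noteq> {}" using W(3) some_basis(2)[OF sub] by auto
  then have "card (some_basis W) \<noteq> 0" using finite_some_basis[OF sub W(2)] by simp
  then have ne: "character W id \<noteq> 0" by (simp add: character_id[OF sub])
  have "l * character W id = (\<Sum>a=1..n. \<Sum>b=1..n. character W (transpose a b))"
    by (rule sum_character_transpose[OF W(1,4), symmetric])
  also have "\<dots> = (\<Sum>a=1..n. \<Sum>b=1..n. character W' (transpose a b))"
    by (intro sum.cong refl eq permutes_swap_id)
  also have "\<dots> = l' * character W id"
    using sum_character_transpose[OF W'] eq[OF permutes_id] by simp
  finally show ?thesis using ne by simp
qed

text \<open>
Both traces expand to the same double sum over pairs of basis elements.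
\<close>

lemma character_iso:
  fixes \<phi> :: "'a::field mpoly \<Rightarrow> 'a mpoly"
  assumes S: "submodule n S" "S \<subseteq> V n k" and W: "submodule n W" "W \<subseteq> V n m"
    and \<phi>: "\<And>f g. \<phi> (f + g) = \<phi> f + \<phi> g" "\<And>c f. \<phi> (smult c f) = smult c (\<phi> f)"
    and bij: "bij_betw \<phi> S W" and \<sigma>: "\<sigma> permutes {1..n}"
    and comm: "\<And>f. f \<in> S \<Longrightarrow> act \<sigma> (\<phi> f) = \<phi> (act \<sigma> f)"
  shows "character W \<sigma> = character S \<sigma>"
proof -
  have subS: "mpoly.subspace S" and subW: "mpoly.subspace W" using S W by (auto simp: submodule_def)
  let ?B = "some_basis S" and ?C = "some_basis W"
  let ?R = "mpoly.representation ?B" and ?Q = "mpoly.representation ?C"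
  note B = some_basis[OF subS] finite_some_basis[OF subS S(2)]
  note C = some_basis[OF subW] finite_some_basis[OF subW W(2)]
  have b\<sigma>: "bij \<sigma>" using \<sigma> by (rule permutes_bij)
  define \<psi> where "\<psi> = the_inv_into S \<phi>"
  have inj: "inj_on \<phi> S" using bij by (rule bij_betw_imp_inj_on)
  have \<psi>: "\<psi> w \<in> S" "\<phi> (\<psi> w) = w" if "w \<in> W" for w
    using that bij inj by (auto simp: \<psi>_def bij_betw_def f_the_inv_into_f intro: the_inv_into_into)
  have \<psi>\<phi>: "\<psi> (\<phi> s) = s" if "s \<in> S" for s using that inj by (simp add: \<psi>_def the_inv_into_f_f)
  have \<phi>S: "\<phi> s \<in> W" if "s \<in> S" for s using that bij by (auto simp: bij_betw_def)
  have \<phi>0: "\<phi> 0 = 0" using \<phi>(2)[of 0 0] by simp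
  have \<phi>sum: "\<phi> (\<Sum>i\<in>I. g i) = (\<Sum>i\<in>I. \<phi> (g i))" for I and g :: "'a mpoly \<Rightarrow> 'a mpoly"
    by (induction I rule: infinite_finite_induct) (simp_all add: \<phi>0 \<phi>)
  have actS: "act \<sigma> s \<in> S" if "s \<in> S" for s using that S \<sigma> by (auto simp: submodule_def)
  have BS: "b \<in> S" if "b \<in> ?B" for b using mpoly.span_base[OF that] B(2) by simp
  have CW: "c \<in> W" if "c \<in> ?C" for c using mpoly.span_base[OF that] C(2) by simp
  have expB: "(\<Sum>b\<in>?B. smult (?R s b) b) = s" if "s \<in> S" for s
    using that B by (intro mpoly.sum_representation_eq) auto
  have expC: "(\<Sum>c\<in>?C. smult (?Q w c) c) = w" if "w \<in> W" for w
    using that C by (intro mpoly.sum_representation_eq) auto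
  have "character W \<sigma> = (\<Sum>c\<in>?C. \<Sum>b\<in>?B. ?R (\<psi> c) b * ?Q (\<phi> (act \<sigma> b)) c)"
    unfolding character_some_basis
  proof (intro sum.cong refl)
    fix c assume c: "c \<in> ?C"
    have "act \<sigma> c = act \<sigma> (\<phi> (\<psi> c))" using \<psi>(2)[OF CW[OF c]] by simp
    also have "\<dots> = \<phi> (act \<sigma> (\<Sum>b\<in>?B. smult (?R (\<psi> c) b) b))"
      using comm \<psi>(1)[OF CW[OF c]] expB by simp
    also have "\<dots> = (\<Sum>b\<in>?B. smult (?R (\<psi> c) b) (\<phi> (act \<sigma> b)))"
      by (simp add: act_sum[OF b\<sigma>] act_smult[OF b\<sigma>] \<phi>sum \<phi>)
    finally have "?Q (act \<sigma> c) = (\<lambda>x. \<Sum>b\<in>?B. ?Q (smult (?R (\<psi> c) b) (\<phi> (act \<sigma> b))) x)"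
      using C(1,2) \<phi>S actS BS by (simp add: mpoly.representation_sum mpoly.subspace_scale[OF subW])
    then show "?Q (act \<sigma> c) c = (\<Sum>b\<in>?B. ?R (\<psi> c) b * ?Q (\<phi> (act \<sigma> b)) c)"
      using C(1,2) \<phi>S actS BS by (simp add: mpoly.representation_scale)
  qed
  also have "\<dots> = (\<Sum>b\<in>?B. \<Sum>c\<in>?C. ?R (\<psi> c) b * ?Q (\<phi> (act \<sigma> b)) c)" by (rule sum.swap)
  also have "\<dots> = (\<Sum>b\<in>?B. ?R (act \<sigma> b) b)"
  proof (intro sum.cong refl)
    fix b assume b: "b \<in> ?B"
    let ?w = "\<phi> (act \<sigma> b)"
    have w: "?w \<in> W" using \<phi>S actS BS b by blast
    have mem: "(\<Sum>c\<in>?C. smult (?Q ?w c) (\<psi> c)) \<in> S"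
      using \<psi> CW by (intro mpoly.subspace_sum[OF subS] mpoly.subspace_scale[OF subS]) auto
    have "\<phi> (\<Sum>c\<in>?C. smult (?Q ?w c) (\<psi> c)) = (\<Sum>c\<in>?C. smult (?Q ?w c) c)"
      unfolding \<phi>sum \<phi>(2) using \<psi> CW by (intro sum.cong refl) simp
    also have "\<dots> = ?w" by (rule expC[OF w])
    finally have "(\<Sum>c\<in>?C. smult (?Q ?w c) (\<psi> c)) = act \<sigma> b"
      using inj mem actS[OF BS[OF b]] by (metis inj_onD)
    then have "?R (act \<sigma> b) = ?R (\<Sum>c\<in>?C. smult (?Q ?w c) (\<psi> c))" by simp
    also have "\<dots> = (\<lambda>x. \<Sum>c\<in>?C. ?R (smult (?Q ?w c) (\<psi> c)) x)"
      using B(1,2) \<psi> CW by (intro mpoly.representation_sum) (auto intro: mpoly.subspace_scale[OF subS])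
    finally show "(\<Sum>c\<in>?C. ?R (\<psi> c) b * ?Q ?w c) = ?R (act \<sigma> b) b"
      using B(1,2) \<psi> CW by (simp add: mpoly.representation_scale mult.commute)
  qed
  finally show ?thesis by (simp add: character_some_basis)
qed

text \<open>The kernel is a submodule of an irreducible module and misses the generator, so it is
  zero. The image is a submodule and contains the generator of the target.\<close>

lemma bij_betw_raise:
  assumes kn: "2 * k \<le> n" and jk: "j \<le> k"
  shows "bij_betw (raise n k j) (orbit_span n (mirror_diffs n j)) (orbit_span n (summand_gen n k j :: complex mpoly))"
proof -
  let ?S = "orbit_span n (mirror_diffs n j) :: complex mpoly set"
  let ?f = "raise n k j :: complex mpoly \<Rightarrow> complex mpoly"
  have j: "2 * j \<le> n" using assms by simp
  have irr: "irreducible_submodule n ?S"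
    using irreducible_orbit_span_gen[of j n j] j by (simp add: gen_self)
  then have sm: "submodule n ?S" and sub: "mpoly.subspace ?S"
    by (auto simp: irreducible_submodule_def submodule_def)
  have f0: "?f 0 = 0" using raise_smult[of n k j 0 0] by simp
  have fdiff: "?f (f - g) = ?f f - ?f g" for f g
    using raise_add[of n k j "f - g" g] by simp
  have raise_act: "?f (act \<sigma> (mirror_diffs n j)) = act \<sigma> (summand_gen n k j)" if "\<sigma> permutes {1..n}" for \<sigma>
    by (simp only: act_raise[OF that, symmetric] raise_mirror_diffs[OF assms])
  let ?K = "{f \<in> ?S. ?f f = 0}"
  have "submodule n ?K"
    using sm unfolding submodule_def mpoly.subspace_def
    by (auto simp: f0 raise_add raise_smult act_zero permutes_bij simp flip: act_raise)
  moreover have "mirror_diffs n j \<notin> ?K"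
    using raise_mirror_diffs[OF assms, where 'a=complex] gen_nonzero[OF assms, where 'a=complex] by auto
  then have "?K \<noteq> ?S" using orbit_span_self by blast
  ultimately have K: "?K = {0}" using irr by (auto simp: irreducible_submodule_def)
  have "inj_on ?f ?S"
  proof (rule inj_onI)
    fix f g assume fg: "f \<in> ?S" "g \<in> ?S" "?f f = ?f g"
    then have "f - g \<in> ?K" using mpoly.subspace_diff[OF sub] by (simp add: fdiff)
    then show "f = g" unfolding K by simp
  qed
  moreover have "?f ` ?S = orbit_span n (summand_gen n k j)"
  proof
    have "?f f \<in> orbit_span n (summand_gen n k j)" if "f \<in> ?S" for f
      using that unfolding orbit_span_def
    proof (induction rule: mpoly.span_induct_alt)
      case base
      then show ?case by (simp add: f0 mpoly.span_zero)
    next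
      case (step c x y)
      then have "?f x \<in> (\<lambda>\<sigma>. act \<sigma> (summand_gen n k j)) ` {\<sigma>. \<sigma> permutes {1..n}}"
        using raise_act by auto
      then have "?f x \<in> mpoly.span ((\<lambda>\<sigma>. act \<sigma> (summand_gen n k j)) ` {\<sigma>. \<sigma> permutes {1..n}})"
        by (rule mpoly.span_base)
      then show ?case
        unfolding raise_add raise_smult using step by (intro mpoly.span_add mpoly.span_scale)
    qed
    then show "?f ` ?S \<subseteq> orbit_span n (summand_gen n k j)" by blast
    have "submodule n (?f ` ?S)"
      unfolding submodule_def mpoly.subspace_def
    proof (intro conjI ballI allI impI)
      show "0 \<in> ?f ` ?S" using f0 mpoly.subspace_0[OF sub] by (metis image_eqI)
    next
      fix x y assume "x \<in> ?f ` ?S" "y \<in> ?f ` ?S"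
      then show "x + y \<in> ?f ` ?S" using mpoly.subspace_add[OF sub] by (auto simp flip: raise_add)
    next
      fix c x assume "x \<in> ?f ` ?S"
      then show "smult c x \<in> ?f ` ?S" using mpoly.subspace_scale[OF sub] by (auto simp flip: raise_smult)
    next
      fix \<sigma> x assume "\<sigma> permutes {1..n}" "x \<in> ?f ` ?S"
      then show "act \<sigma> x \<in> ?f ` ?S" using sm by (auto simp: act_raise submodule_def)
    qed
    moreover have "summand_gen n k j \<in> ?f ` ?S"
      using raise_mirror_diffs[OF assms, where 'a=complex] orbit_span_self by (metis image_eqI)
    ultimately show "orbit_span n (summand_gen n k j) \<subseteq> ?f ` ?S" by (rule orbit_span_subset)
  qed
  ultimately show ?thesis by (simp add: bij_betw_def)
qed

lemma character_orbit_span_gen: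
  assumes kn: "2 * k \<le> n" and jk: "j \<le> k" and \<sigma>: "\<sigma> permutes {1..n}"
  shows "character (orbit_span n (summand_gen n k j)) \<sigma> = character (orbit_span n (mirror_diffs n j) :: complex mpoly set) \<sigma>"
proof (rule character_iso[OF submodule_orbit_span _ submodule_orbit_span _ raise_add raise_smult bij_betw_raise[OF kn jk] \<sigma>])
  show "orbit_span n (mirror_diffs n j) \<subseteq> (V n j :: complex mpoly set)"
    using orbit_span_gen_subset[of j n j] assms by (simp add: gen_self)
  show "orbit_span n (summand_gen n k j) \<subseteq> (V n k :: complex mpoly set)"
    by (rule orbit_span_gen_subset[OF kn jk])
qed (rule act_raise[OF \<sigma>])

text \<open>Only the first \<open>j\<close> columns of a two-row shape have two cells, so a Specht
  polynomial is a product of \<open>j\<close> differences. Every tableau is a permutation applied to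
  one fixed tableau \<open>T0\<close>, chosen so that its Specht polynomial is
  \<open>mirror_diffs n j\<close>.\<close>

lemma specht_module_two_rows:
  assumes j: "2 * j \<le> n"
  shows "specht_module [n - j, j] = (orbit_span n (mirror_diffs n j) :: 'a::field mpoly set)"
proof -
  let ?lam = "[n - j, j]"
  have cells: "cells ?lam = ({0} \<times> {..<n-j}) \<union> ({1} \<times> {..<j})"
    by (auto simp: cells_def less_Suc_eq)
  have card: "card (cells ?lam) = n" "finite (cells ?lam)"
    unfolding cells using j by (subst card_Un_disjoint) (auto simp: card_cartesian_product)
  have n: "sum_list ?lam = n" using j by simp
  have specht: "specht_poly ?lam T = (\<Prod>c<j. Var (T (0, c)) - Var (T (1, c)) :: 'a mpoly)" for T
  proof -
    have "{(r, r', c). r < r' \<and> (r, c) \<in> cells ?lam \<and> (r', c) \<in> cells ?lam} =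
        (\<lambda>c. (0, 1, c)) ` {..<j}"
      using j by (auto simp: cells)
    then show ?thesis
      unfolding specht_poly_def by (simp add: prod.reindex inj_on_def)
  qed
  \<comment> \<open>Columns count from 0: column \<open>c\<close> receives \<open>i = Suc c\<close>
    and \<open>Suc n - i = n - c\<close>. The cells of the first row from column \<open>j\<close> on
    do not enter the Specht polynomial and are filled by an arbitrary bijection
    \<open>g\<close>.\<close>
  define h where "h = (\<lambda>(r::nat, c). if r = 0 then Suc c else n - c)"
  define D where "D = {0, 1::nat} \<times> {..<j}"
  have Dsub: "D \<subseteq> cells ?lam" using j by (auto simp: D_def cells)
  have injh: "inj_on h D" using j by (auto simp: D_def h_def inj_on_def)
  have hD: "h ` D \<subseteq> {1..n}" using j by (auto simp: D_def h_def)
  have "card (cells ?lam - D) = card ({1..n} - h ` D)"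
    using card Dsub hD by (simp add: card_Diff_subset card_image[OF injh] finite_subset)
  then obtain g where g: "bij_betw g (cells ?lam - D) ({1..n} - h ` D)"
    using finite_same_card_bij[of "cells ?lam - D" "{1..n} - h ` D"] card by auto
  define T0 where "T0 = (\<lambda>x. if x \<in> D then h x else g x)"
  have "bij_betw T0 D (h ` D)"
    using injh by (auto simp: T0_def bij_betw_def inj_on_def)
  moreover have "bij_betw T0 (cells ?lam - D) ({1..n} - h ` D)"
    using g by (rule bij_betw_cong[THEN iffD1, rotated]) (simp add: T0_def)
  ultimately have "bij_betw T0 (D \<union> (cells ?lam - D)) (h ` D \<union> ({1..n} - h ` D))"
    by (rule bij_betw_combine) blast
  then have T0: "bij_betw T0 (cells ?lam) {1..n}"
    using Dsub hD by (simp add: Un_absorb1)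
  have T0_spec: "specht_poly ?lam (\<sigma> \<circ> T0) = act \<sigma> (mirror_diffs n j :: 'a mpoly)" if "bij \<sigma>" for \<sigma>
  proof -
    have "specht_poly ?lam (\<sigma> \<circ> T0) = (\<Prod>c<j. Var (\<sigma> (Suc c)) - Var (\<sigma> (n - c)) :: 'a mpoly)"
      unfolding specht by (intro prod.cong) (auto simp: T0_def D_def h_def)
    also have "\<dots> = (\<Prod>i=1..j. Var (\<sigma> i) - Var (\<sigma> (Suc n - i)))"
      by (rule prod.reindex_bij_witness[where i="\<lambda>i. i - 1" and j=Suc]) auto
    also have "\<dots> = act \<sigma> (mirror_diffs n j)"
      by (simp add: mirror_diffs_def act_prod act_diff act_Var that)
    finally show ?thesis .
  qed
  have "{specht_poly ?lam T | T. bij_betw T (cells ?lam) {1..sum_list ?lam}} =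
      (\<lambda>\<sigma>. act \<sigma> (mirror_diffs n j :: 'a mpoly)) ` {\<sigma>. \<sigma> permutes {1..n}}"
  proof (intro equalityI subsetI)
    fix x :: "'a mpoly" assume "x \<in> {specht_poly ?lam T | T. bij_betw T (cells ?lam) {1..sum_list ?lam}}"
    then obtain T where T: "x = specht_poly ?lam T" "bij_betw T (cells ?lam) {1..n}" using n by auto
    define \<sigma> where "\<sigma> = (\<lambda>i. if i \<in> {1..n} then T (the_inv_into (cells ?lam) T0 i) else i)"
    have "bij_betw (T \<circ> the_inv_into (cells ?lam) T0) {1..n} {1..n}"
      by (rule bij_betw_trans[OF bij_betw_the_inv_into[OF T0] T(2)])
    then have "bij_betw \<sigma> {1..n} {1..n}"
      by (rule bij_betw_cong[THEN iffD1, rotated]) (simp add: \<sigma>_def)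
    then have \<sigma>: "\<sigma> permutes {1..n}" by (rule bij_imp_permutes) (auto simp: \<sigma>_def)
    have "(\<sigma> \<circ> T0) y = T y" if "y \<in> cells ?lam" for y
      using that T0 by (auto simp: \<sigma>_def bij_betw_def the_inv_into_f_f)
    then have "specht_poly ?lam (\<sigma> \<circ> T0) = (specht_poly ?lam T :: 'a mpoly)"
      unfolding specht using j by (intro prod.cong) (auto simp: cells)
    then have "x = act \<sigma> (mirror_diffs n j)"
      using T(1) T0_spec[OF permutes_bij[OF \<sigma>]] by simp
    with \<sigma> show "x \<in> (\<lambda>\<sigma>. act \<sigma> (mirror_diffs n j)) ` {\<sigma>. \<sigma> permutes {1..n}}" by blast
  next
    fix x :: "'a mpoly" assume "x \<in> (\<lambda>\<sigma>. act \<sigma> (mirror_diffs n j)) ` {\<sigma>. \<sigma> permutes {1..n}}"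
    then obtain \<sigma> where \<sigma>: "\<sigma> permutes {1..n}" "x = act \<sigma> (mirror_diffs n j)" by auto
    have "bij_betw (\<sigma> \<circ> T0) (cells ?lam) {1..n}"
      by (rule bij_betw_trans[OF T0 permutes_imp_bij[OF \<sigma>(1)]])
    moreover have "x = specht_poly ?lam (\<sigma> \<circ> T0)"
      using T0_spec[OF permutes_bij[OF \<sigma>(1)]] \<sigma>(2) by simp
    ultimately show "x \<in> {specht_poly ?lam T | T. bij_betw T (cells ?lam) {1..sum_list ?lam}}"
      unfolding n by blast
  qed
  then show ?thesis by (simp add: specht_module_def orbit_span_def)
qed

text \<open>The submodule \<open>U\<close> provided by the definition is compared with the orbit
  span through the eigenvalue alone. Then \<open>f\<close> in \<open>U\<close> and a normalised
  fixed vector \<open>g\<close> of the orbit span satisfy the same equation with the same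
  coefficient at \<open>{1..k}\<close>, which forces \<open>f = g\<close>.\<close>

lemma is_spherical_iff:
  assumes kn: "2 * k \<le> n" and jk: "j \<le> k"
  shows "is_spherical n k j f \<longleftrightarrow>
    f \<in> orbit_span n (summand_gen n k j) \<and> fixed_young n k f \<and> coeff_at f {1..k} = 1" (is "?l \<longleftrightarrow> ?r")
proof -
  have j: "2 * j \<le> n" "k \<le> n" using assms by simp_all
  let ?W = "orbit_span n (summand_gen n k j) :: complex mpoly set"
  have char: "character ?W \<sigma> = chi [n - j, j] \<sigma>" if "\<sigma> permutes {1..n}" for \<sigma>
    using character_orbit_span_gen[OF kn jk that] by (simp add: chi_def specht_module_two_rows[OF j(1)])
  note irr = irreducible_orbit_span_gen[OF kn jk]
  have WV: "?W \<subseteq> V n k" by (rule orbit_span_gen_subset[OF kn jk])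
  have eigW: "transp_sum n g = smult (eigval n j) g" if "g \<in> ?W" for g
    using transp_sum_gen[OF kn jk] that by (rule orbit_span_eigenvector)
  have r_l: "is_spherical n k j g"
    if "g \<in> ?W" "fixed_young n k g" "coeff_at g {1..k} = 1" for g
    using that irr WV char unfolding is_spherical_def fixed_young_def by blast
  show ?thesis
  proof
    assume ?l
    then obtain U where U: "U \<subseteq> V n k" "irreducible_submodule n U" "f \<in> U"
      "\<And>\<sigma>. \<sigma> permutes {1..n} \<Longrightarrow> character U \<sigma> = chi [n - j, j] \<sigma>"
      and f: "fixed_young n k f" "coeff_at f {1..k} = 1"
      unfolding is_spherical_def fixed_young_def by blast
    have smU: "submodule n U" "mpoly.subspace U" "U \<noteq> {0}"
      using U(2) by (auto simp: irreducible_submodule_def submodule_def)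
    have U_fin: "U \<subseteq> mpoly.span (xmon ` ksubs n k)" using U(1) by (simp add: V_eq_span)
    obtain l w where w: "w \<in> U" "w \<noteq> 0" "transp_sum n w = smult l w"
      using ex_eigenvector[OF transp_sum_add transp_sum_smult smU(2) transp_sum_submodule[OF smU(1)] smU(3)
          finite_imageI[OF finite_ksubs] U_fin]
      by blast
    \<comment> \<open>Schur's lemma: an eigenspace of a central element is a nonzero submodule of
      the irreducible \<open>U\<close>.\<close>
    have "{g \<in> U. transp_sum n g = smult l g} = U"
      using submodule_eigenspace[OF smU(1), of l] w U(2) unfolding irreducible_submodule_def by blast
    then have eigU: "transp_sum n g = smult l g" if "g \<in> U" for g using that by blast
    have "l = eigval n j"
    proof (rule character_determines_eigenvalue[OF smU(1) U(1) smU(3) eigU submodule_orbit_span eigW])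
      show "character U \<sigma> = character ?W \<sigma>" if "\<sigma> permutes {1..n}" for \<sigma>
        using U(4)[OF that] char[OF that] by simp
    qed
    then have eigf: "transp_sum n f = smult (eigval n j) f" using eigU[OF U(3)] by simp
    obtain g where g: "g \<in> ?W" "fixed_young n k g" "coeff_at g {1..k} = 1"
      using submodule_ex_fixed_young[OF j(2) submodule_orbit_span WV] irr
      by (auto simp: irreducible_submodule_def)
    have "f - g = 0"
    proof (rule fixed_young_eigenvector_zero[OF j(2)])
      show "f - g \<in> V n k" using U(1,3) g(1) WV by (intro mpoly.subspace_diff[OF subspace_V]) auto
      show "transp_sum n (f - g) = smult (eigval n j) (f - g)"
        by (simp add: transp_sum_diff eigf eigW[OF g(1)] mpoly.scale_right_diff_distrib)
      show "fixed_young n k (f - g)"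
        using f(1) g(2) by (simp add: fixed_young_def act_diff permutes_bij)
      show "coeff_at (f - g) {1..k} = 0" using f(2) g(3) by (simp add: coeff_at_diff)
    qed
    then show ?r using g by simp
  qed (use r_l in blast)
qed

lemma spherical_eqI:
  assumes kn: "2 * k \<le> n" and jk: "j \<le> k"
    and f: "f \<in> orbit_span n (summand_gen n k j)" "fixed_young n k f" "coeff_at f {1..k} = 1"
  shows "spherical n k j = f"
  unfolding spherical_def
proof (rule the_equality)
  show "is_spherical n k j f" using f by (simp add: is_spherical_iff[OF kn jk])
  fix g assume "is_spherical n k j g"
  then have g: "g \<in> orbit_span n (summand_gen n k j)" "fixed_young n k g" "coeff_at g {1..k} = 1"
    by (simp_all add: is_spherical_iff[OF kn jk])
  have "g - f = 0"
  proof (rule fixed_young_eigenvector_zero)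
    show "k \<le> n" using kn by simp
    show "g - f \<in> V n k"
      using f(1) g(1) orbit_span_gen_subset[OF kn jk] by (intro mpoly.subspace_diff[OF subspace_V]) auto
    show "transp_sum n (g - f) = smult (eigval n j) (g - f)"
      using orbit_span_eigenvector[OF transp_sum_gen[OF kn jk, where 'a=complex]] f(1) g(1)
      by (simp add: transp_sum_diff mpoly.scale_right_diff_distrib)
    show "fixed_young n k (g - f)"
      using f(2) g(2) by (simp add: fixed_young_def act_diff permutes_bij)
    show "coeff_at (g - f) {1..k} = 0" using f(3) g(3) by (simp add: coeff_at_diff)
  qed
  then show "g = f" by simp
qed

section \<open>The two symmetrisation formulas\<close>

lemma sym_sum_smult: "sym_sum A (smult c f) = smult (c::'a::field) (sym_sum A f)"
  unfolding sym_sum_def mpoly.scale_sum_right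
  by (intro sum.cong refl act_smult) (auto intro: permutes_bij)

lemma sym_sum_sum: "sym_sum A (\<Sum>i\<in>I. f i) = (\<Sum>i\<in>I. sym_sum A (f i))"
proof -
  have "sym_sum A (\<Sum>i\<in>I. f i) = (\<Sum>v | v permutes A. \<Sum>i\<in>I. act v (f i))"
    unfolding sym_sum_def by (intro sum.cong refl act_sum) (auto intro: permutes_bij)
  then show ?thesis unfolding sym_sum_def by (subst (asm) sum.swap)
qed

lemma sym_sum_submodule:
  assumes "submodule n U" "f \<in> U" "A \<subseteq> {1..n}"
  shows "sym_sum A f \<in> U"
  using assms unfolding sym_sum_def submodule_def
  by (auto intro!: mpoly.subspace_sum intro: permutes_subset)

lemma act_sym_sum_commute:
  assumes "bij w" "\<And>x. x \<in> A \<Longrightarrow> w x = x"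
  shows "act w (sym_sum A f) = sym_sum A (act w f)"
  unfolding sym_sum_def act_sum[OF assms(1)]
proof (intro sum.cong refl)
  fix v assume "v \<in> {v. v permutes A}"
  then have v: "v permutes A" by simp
  have "w (v x) = v (w x)" for x
  proof (cases "x \<in> A")
    case True
    then show ?thesis using assms(2) permutes_in_image[OF v] by simp
  next
    case False
    then have "w x \<notin> A" using assms by (metis bij_pointE)
    then show ?thesis using False v by (simp add: permutes_not_in)
  qed
  then have "w \<circ> v = v \<circ> w" by (simp add: fun_eq_iff)
  then show "act w (act v f) = act v (act w f)"
    using act_comp[OF assms(1) permutes_bij[OF v], of f] act_comp[OF permutes_bij[OF v] assms(1), of f]
    by simp
qed

lemma sym_sum_sym_sum:
  assumes "Z \<subseteq> B" "finite B"
  shows "sym_sum B (sym_sum Z f) = smult (fact (card Z)) (sym_sum B (f :: 'a::field_char_0 mpoly))"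
proof -
  have fin: "finite Z" using assms finite_subset by blast
  have "sym_sum B (sym_sum Z f) = (\<Sum>v | v permutes Z. sym_sum B (act v f))"
    by (simp only: sym_sum_def[of Z] sym_sum_sum)
  also have "\<dots> = (\<Sum>v | v permutes Z. sym_sum B f)"
    using assms(1) by (intro sum.cong refl act_sym_sum) (auto intro: permutes_subset)
  also have "\<dots> = smult (of_nat (fact (card Z))) (sym_sum B f)"
    using card_permutations[OF refl fin] by (simp add: smult_of_nat del: of_nat_fact)
  finally show ?thesis by simp
qed

lemma fixed_youngI:
  assumes "k \<le> n" "\<And>u. u permutes {1..k} \<Longrightarrow> act u f = f" "\<And>w. w permutes {k+1..n} \<Longrightarrow> act w f = f"
  shows "fixed_young n k f"
  unfolding fixed_young_def
proof (intro allI impI)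
  fix \<sigma> assume \<sigma>: "\<sigma> permutes {1..n}" "\<sigma> ` {1..k} = {1..k}"
  have mem: "\<sigma> x \<in> {1..k} \<longleftrightarrow> x \<in> {1..k}" for x
    using \<sigma> permutes_inj[OF \<sigma>(1)] by (metis inj_image_mem_iff)
  define u where "u = (\<lambda>x. if x \<in> {1..k} then \<sigma> x else x)"
  define w where "w = (\<lambda>x. if x \<in> {k+1..n} then \<sigma> x else x)"
  have "bij_betw \<sigma> {1..k} {1..k}" using \<sigma> by (simp add: bij_betw_def permutes_inj_on)
  then have "bij_betw u {1..k} {1..k}"
    by (rule bij_betw_cong[THEN iffD1, rotated]) (simp add: u_def)
  then have u: "u permutes {1..k}" by (rule bij_imp_permutes) (auto simp: u_def)
  have "\<sigma> ` ({1..n} - {1..k}) = {1..n} - {1..k}"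
    using \<sigma> by (simp add: image_set_diff permutes_inj permutes_image)
  moreover have "{1..n} - {1..k} = {k+1..n}" by auto
  ultimately have "bij_betw \<sigma> {k+1..n} {k+1..n}" using \<sigma> by (simp add: bij_betw_def permutes_inj_on)
  then have "bij_betw w {k+1..n} {k+1..n}"
    by (rule bij_betw_cong[THEN iffD1, rotated]) (simp add: w_def)
  then have w: "w permutes {k+1..n}" by (rule bij_imp_permutes) (auto simp: w_def)
  have "\<sigma> = u \<circ> w"
  proof
    fix x
    consider "x \<in> {1..k}" | "x \<in> {k+1..n}" | "x \<notin> {1..n}" using assms(1) by force
    then show "\<sigma> x = (u \<circ> w) x"
    proof cases
      case 2
      then have "\<sigma> x \<notin> {1..k}" using mem by simp
      then show ?thesis using 2 by (auto simp: u_def w_def)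
    next
      case 3
      then show ?thesis using \<sigma>(1) assms(1) by (auto simp: u_def w_def permutes_not_in)
    qed (auto simp: u_def w_def)
  qed
  then show "act \<sigma> f = f"
    by (simp add: act_comp[OF permutes_bij[OF u] permutes_bij[OF w]] assms(2)[OF u] assms(3)[OF w])
qed

text \<open>The outer sum absorbs permutations of \<open>{1..k}\<close>. Those of
  \<open>{k+1..n}\<close> commute with the outer sum and, lying in the symmetric group on
  \<open>{j+1..n}\<close>, are absorbed by the inner one.\<close>

lemma fixed_young_sym_sum:
  assumes "k \<le> n" "j \<le> k"
  shows "fixed_young n k (sym_sum {1..k} (sym_sum {j+1..n} f))"
proof (rule fixed_youngI[OF assms(1)])
  fix w assume w: "w permutes {k+1..n}"
  have w': "w permutes {j+1..n}" using w by (rule permutes_subset) (use assms in auto)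
  have "act w (sym_sum {1..k} (sym_sum {j+1..n} f)) = sym_sum {1..k} (act w (sym_sum {j+1..n} f))"
    by (rule act_sym_sum_commute[OF permutes_bij[OF w]]) (auto intro!: permutes_not_in[OF w])
  then show "act w (sym_sum {1..k} (sym_sum {j+1..n} f)) = sym_sum {1..k} (sym_sum {j+1..n} f)"
    by (simp only: act_sym_sum'[OF w'])
qed (rule act_sym_sum')

lemma coeff_at_sym_sum_invariant:
  assumes "finite A" "finite I" "\<And>v. v permutes A \<Longrightarrow> v ` I = I"
  shows "coeff_at (sym_sum A f) I = of_nat (fact (card A)) * coeff_at f I"
proof -
  have "coeff_at (act v f) I = coeff_at f I" if "v permutes A" for v
    using coeff_at_act_image[OF permutes_bij[OF that] assms(2)] assms(3)[OF that] by metis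
  then have "coeff_at (sym_sum A f) I = (\<Sum>v | v permutes A. coeff_at f I)"
    by (simp add: sym_sum_def coeff_at_sum)
  then show ?thesis using card_permutations[OF refl assms(1)] by simp
qed

text \<open>The average over the Young subgroup. Both sums preserve the set \<open>{1..k}\<close>,
  so the coefficient 1 of the generator there is only multiplied by the two group orders.\<close>

lemma spherical_eq_sym_sum_gen:
  assumes kn: "2 * k \<le> n" and jk: "j \<le> k"
  shows "spherical n k j = smult (1 / (fact k * fact (n - k))) (sym_sum {1..k} (sym_sum {k+1..n} (summand_gen n k j)))"
proof (rule spherical_eqI[OF kn jk])
  let ?g = "summand_gen n k j :: complex mpoly"
  let ?f = "sym_sum {1..k} (sym_sum {k+1..n} ?g)"
  have k: "k \<le> n" using kn by simp
  have "?f \<in> orbit_span n ?g"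
    using k by (intro sym_sum_submodule[OF submodule_orbit_span] orbit_span_self) auto
  then show "smult (1 / (fact k * fact (n - k))) ?f \<in> orbit_span n ?g"
    by (rule mpoly.subspace_scale[OF subspace_orbit_span])
  show "fixed_young n k (smult (1 / (fact k * fact (n - k))) ?f)"
    using fixed_young_sym_sum[OF k order_refl, of ?g] by (simp add: fixed_young_def act_smult permutes_bij)
  have "coeff_at ?f {1..k} = of_nat (fact (card {1..k})) * coeff_at (sym_sum {k+1..n} ?g) {1..k}"
    by (rule coeff_at_sym_sum_invariant) (auto simp: permutes_image)
  also have "coeff_at (sym_sum {k+1..n} ?g) {1..k} = of_nat (fact (card {k+1..n})) * coeff_at ?g {1..k}"
  proof (rule coeff_at_sym_sum_invariant)
    fix v assume "v permutes {k+1..n}"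
    then show "v ` {1..k} = {1..k}" by (auto simp: permutes_not_in image_iff)
  qed auto
  finally show "coeff_at (smult (1 / (fact k * fact (n - k))) ?f) {1..k} = 1"
    unfolding coeff_at_smult coeff_at_gen[OF kn jk] by simp
qed

text \<open>By transitivity each of the \<open>card B choose p\<close> possible images of
  \<open>K\<close> is attained by the same number of permutations.\<close>

lemma card_permutes_image:
  assumes "finite B" "K \<subseteq> B" "K' \<subseteq> B" "card K = p" "card K' = p"
  shows "card {w. w permutes B \<and> w ` K = K'} = fact p * fact (card B - p)"
proof -
  define S where "S = {L. L \<subseteq> B \<and> card L = p}"
  have finS: "finite S" unfolding S_def by (rule finite_subset[of _ "Pow B"]) (use assms in auto)
  have finW: "finite {w. w permutes B}" using assms(1) by (rule finite_permutations)
  have same: "card {w. w permutes B \<and> w ` K = L} = card {w. w permutes B \<and> w ` K = K'}" if "L \<in> S" for L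
  proof -
    have "L \<subseteq> B" "card K' = card L" using that assms(5) by (auto simp: S_def)
    then obtain u where u: "u permutes B" "u ` K' = L"
      using ex_permutes_image[OF assms(1,3)] by blast
    have iu: "inv u ` L = K'" using u by (metis image_inv_f_f permutes_inj)
    show ?thesis
    proof (rule bij_betw_same_card[of "\<lambda>w. inv u \<circ> w"], rule bij_betw_byWitness[where f'="\<lambda>w. u \<circ> w"])
      show "\<forall>w\<in>{w. w permutes B \<and> w ` K = L}. u \<circ> (inv u \<circ> w) = w"
        by (simp add: o_assoc permutes_inv_o[OF u(1)])
      show "\<forall>w\<in>{w. w permutes B \<and> w ` K = K'}. inv u \<circ> (u \<circ> w) = w"
        by (simp add: o_assoc permutes_inv_o[OF u(1)])
      show "(\<lambda>w. inv u \<circ> w) ` {w. w permutes B \<and> w ` K = L} \<subseteq> {w. w permutes B \<and> w ` K = K'}"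
        using iu permutes_compose[OF _ permutes_inv[OF u(1)]] by (auto simp: image_comp)
      show "(\<lambda>w. u \<circ> w) ` {w. w permutes B \<and> w ` K = K'} \<subseteq> {w. w permutes B \<and> w ` K = L}"
        using u(2) permutes_compose[OF _ u(1)] by (auto simp: image_comp)
    qed
  qed
  have "fact (card B) = card {w. w permutes B}"
    using card_permutations[OF refl assms(1)] by simp
  also have "{w. w permutes B} = (\<Union>L\<in>S. {w. w permutes B \<and> w ` K = L})"
  proof -
    have "w ` K \<in> S" if "w permutes B" for w
      using assms that permutes_in_image[OF that]
      by (auto simp: S_def card_image inj_on_subset[OF permutes_inj[OF that]])
    then show ?thesis by auto
  qed
  also have "card \<dots> = (\<Sum>L\<in>S. card {w. w permutes B \<and> w ` K = L})"
    by (rule card_UN_disjoint) (use finS finW in \<open>auto intro: finite_subset\<close>)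
  also have "\<dots> = (card B choose p) * card {w. w permutes B \<and> w ` K = K'}"
    using same n_subsets[OF assms(1), of p] by (simp add: S_def)
  finally have "fact (card B) = (card B choose p) * card {w. w permutes B \<and> w ` K = K'}" .
  moreover have "fact (card B) = (card B choose p) * (fact p * fact (card B - p))"
    using binomial_fact_lemma[of p "card B"] assms card_mono[OF assms(1,2)] by (simp add: ac_simps)
  moreover have "card B choose p > 0" using assms card_mono[OF assms(1,2)] by simp
  ultimately show ?thesis by (metis mult_left_cancel not_gr_zero)
qed

definition mirror_beta :: "nat \<Rightarrow> nat \<Rightarrow> nat \<Rightarrow> 'a::comm_ring_1 mpoly" where
  "mirror_beta n k j = mirror_diffs n j * (\<Prod>i=j+1..k. Var i + Var (Suc n - i))"

text \<open>Reversing \<open>{k+1..n}\<close> sends \<open>k + i\<close> to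
  \<open>Suc n - i\<close>. This permutation belongs to the symmetric group on
  \<open>{j+1..n}\<close>, so the sum over that group takes the same value on both products.\<close>

lemma ex_act_beta:
  assumes kn: "2 * k \<le> n" and jk: "j \<le> k"
  shows "\<exists>\<rho>. \<rho> permutes {j+1..n} \<and> act \<rho> (beta k j) = mirror_beta n k j"
proof -
  define \<rho> where "\<rho> = (\<lambda>x. if x \<in> {k+1..n} then n + 1 + k - x else x)"
  have inv: "\<rho> (\<rho> x) = x" for x by (auto simp: \<rho>_def)
  have "bij_betw \<rho> {k+1..n} {k+1..n}"
    by (rule bij_betw_byWitness[where f'=\<rho>]) (auto simp: \<rho>_def)
  then have p: "\<rho> permutes {k+1..n}" by (rule bij_imp_permutes) (auto simp: \<rho>_def)
  have b: "bij \<rho>" using p by (rule permutes_bij)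
  have v: "\<rho> i = i" "\<rho> (k + i) = Suc n - i" if "i \<in> {1..k}" for i using that kn by (auto simp: \<rho>_def)
  have "act \<rho> (beta k j) = mirror_beta n k j"
    unfolding beta_def mirror_beta_def mirror_diffs_def act_mult[OF b] act_prod[OF b] act_diff[OF b] act_add[OF b] act_Var[OF b]
    using v jk by (intro arg_cong2[where f="(*)"] prod.cong refl) auto
  moreover have "\<rho> permutes {j+1..n}" using p by (rule permutes_subset) (use jk in auto)
  ultimately show ?thesis by blast
qed

lemma mirror_beta_expand:
  assumes kn: "2 * k \<le> n" and jk: "j \<le> k"
  shows "(mirror_beta n k j :: 'a::field mpoly) =
    (\<Sum>T\<in>Pow {1..k}. smult (\<Prod>i\<in>{1..k}-T. if i \<le> j then -1 else 1)
      (xmon (T \<union> ((-) (Suc n)) ` ({1..k} - T))))"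
proof -
  let ?d = "\<lambda>i. if i \<le> j then -1 else (1::'a)"
  have "(mirror_beta n k j :: 'a mpoly) = (\<Prod>i\<in>{1..j}. Var i + smult (?d i) (Var (Suc n - i))) *
      (\<Prod>i\<in>{j+1..k}. Var i + smult (?d i) (Var (Suc n - i)))"
    unfolding mirror_beta_def mirror_diffs_def by (intro arg_cong2[where f="(*)"] prod.cong refl) auto
  also have "\<dots> = (\<Prod>i\<in>{1..j} \<union> {j+1..k}. Var i + smult (?d i) (Var (Suc n - i)))"
    by (rule prod.union_disjoint[symmetric]) auto
  also have "{1..j} \<union> {j+1..k} = {1..k}" using jk by auto
  also have "(\<Prod>i\<in>{1..k}. Var i + smult (?d i) (Var (Suc n - i))) =
      (\<Sum>T\<in>Pow {1..k}. smult (\<Prod>i\<in>{1..k}-T. ?d i) (xmon ((\<lambda>i. i) ` T \<union> ((-) (Suc n)) ` ({1..k} - T))))"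
    using kn by (intro prod_pairs_expand) (auto intro: inj_on_subset[OF inj_on_mirror])
  finally show ?thesis by simp
qed

lemma mirror_set:
  assumes "2 * k \<le> n" "T \<subseteq> {1..k}"
  shows "T \<union> ((-) (Suc n)) ` ({1..k} - T) \<in> ksubs n k"
  using mirror_diffs_set[OF assms] by (auto simp: ksubs_def)

text \<open>Permutations of \<open>{j+1..n}\<close> fix \<open>{1..j}\<close> pointwise, so only
  choices \<open>T\<close> containing \<open>{1..j}\<close> contribute. There are
  \<open>2 ^ (k - j)\<close> of them, all with sign 1, and for each the other \<open>k - j\<close>
  chosen indices must be mapped onto \<open>{j+1..k}\<close>.\<close>

lemma coeff_at_sym_sum_mirror_beta:
  assumes kn: "2 * k \<le> n" and jk: "j \<le> k"
  shows "coeff_at (sym_sum {j+1..n} (mirror_beta n k j :: 'a::field_char_0 mpoly)) {1..k} =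
    2 ^ (k - j) * fact (k - j) * fact (n - k)"
proof -
  let ?B = "{j+1..n}" and ?d = "\<lambda>i. if i \<le> j then -1 else (1::'a)"
  let ?S = "\<lambda>T. T \<union> ((-) (Suc n)) ` ({1..k} - T)"
  have finW: "finite {w. w permutes ?B}" by (rule finite_permutations) simp
  have "coeff_at (sym_sum ?B (xmon S) :: 'a mpoly) {1..k} = of_nat (card {w. w permutes ?B \<and> w ` S = {1..k}})"
    if "finite S" for S
  proof -
    have "coeff_at (sym_sum ?B (xmon S) :: 'a mpoly) {1..k} =
        (\<Sum>w | w permutes ?B. if w ` S = {1..k} then 1 else 0)"
      unfolding sym_sum_def coeff_at_sum
      using that by (intro sum.cong refl) (auto simp: act_xmon permutes_bij coeff_at_xmon)
    also have "\<dots> = (\<Sum>w\<in>{w. w permutes ?B \<and> w ` S = {1..k}}. 1)"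
      using finW by (intro sum.mono_neutral_cong_right) auto
    finally show ?thesis by simp
  qed
  then have "coeff_at (sym_sum ?B (mirror_beta n k j :: 'a mpoly)) {1..k} =
      (\<Sum>T\<in>Pow {1..k}. (\<Prod>i\<in>{1..k}-T. ?d i) * of_nat (card {w. w permutes ?B \<and> w ` ?S T = {1..k}}))"
    unfolding mirror_beta_expand[OF assms] sym_sum_sum sym_sum_smult coeff_at_sum coeff_at_smult
    using ksubs_finite[OF mirror_set[OF kn]] by (intro sum.cong refl) simp
  also have "\<dots> = (\<Sum>T\<in>Pow {1..k}. if {1..j} \<subseteq> T then fact (k - j) * fact (n - k) else 0)"
  proof (intro sum.cong refl)
    fix T assume "T \<in> Pow {1..k}"
    then have T: "T \<subseteq> {1..k}" by simp
    show "(\<Prod>i\<in>{1..k}-T. ?d i) * of_nat (card {w. w permutes ?B \<and> w ` ?S T = {1..k}}) =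
        (if {1..j} \<subseteq> T then fact (k - j) * fact (n - k) else 0)"
    proof (cases "{1..j} \<subseteq> T")
      case True
      have K: "?S T \<in> ksubs n k" by (rule mirror_set[OF kn T])
      have jS: "{1..j} \<subseteq> ?S T" using True by auto
      have iff: "w ` ?S T = {1..k} \<longleftrightarrow> w ` (?S T - {1..j}) = {j+1..k}" if w: "w permutes ?B" for w
      proof -
        have wj: "w ` {1..j} = {1..j}" using permutes_not_in[OF w] by (auto simp: image_iff)
        have aux: "X = J \<union> R \<longleftrightarrow> X - J = R" if "J \<subseteq> X" "J \<inter> R = {}" for X J R :: "nat set"
          using that by auto
        have "{1..j} \<subseteq> w ` ?S T" using image_mono[OF jS, of w] unfolding wj .
        moreover have "{1..j} \<inter> {j+1..k} = {}" by auto
        ultimately have "w ` ?S T = {1..j} \<union> {j+1..k} \<longleftrightarrow> w ` ?S T - {1..j} = {j+1..k}" by (rule aux)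
        moreover have "{1..j} \<union> {j+1..k} = {1..k}" using jk by auto
        ultimately show ?thesis
          unfolding image_set_diff[OF permutes_inj[OF w]] wj by simp
      qed
      have "{w. w permutes ?B \<and> w ` ?S T = {1..k}} = {w. w permutes ?B \<and> w ` (?S T - {1..j}) = {j+1..k}}"
        by (intro Collect_cong conj_cong refl iff)
      also have "card \<dots> = fact (k - j) * fact (card ?B - (k - j))"
      proof (rule card_permutes_image)
        have S: "?S T \<subseteq> {1..n}" "card (?S T) = k" using K by (simp_all only: ksubs_def mem_Collect_eq)
        have "?S T - {1..j} \<subseteq> {1..n} - {1..j}" using S(1) by (rule Diff_mono) simp
        also have "\<dots> = ?B" by auto
        finally show "?S T - {1..j} \<subseteq> ?B" .
        show "card (?S T - {1..j}) = k - j"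
          by (simp only: card_Diff_subset[OF finite_atLeastAtMost jS] S(2)) simp
        show "{j+1..k} \<subseteq> ?B" using kn by auto
      qed auto
      also have "card ?B - (k - j) = n - k" using kn jk by simp
      finally have "card {w. w permutes ?B \<and> w ` ?S T = {1..k}} = fact (k - j) * fact (n - k)" .
      moreover have "(\<Prod>i\<in>{1..k}-T. ?d i) = 1" using True by (intro prod.neutral) auto
      ultimately show ?thesis using True by simp
    next
      case False
      then obtain i where i: "i \<in> {1..j}" "i \<notin> T" by blast
      have "i \<notin> ?S T"
      proof
        assume "i \<in> ?S T"
        then obtain l where "l \<in> {1..k}" "i = Suc n - l" using i by auto
        then show False using i kn jk by auto
      qed
      then have iS: "w i \<notin> w ` ?S T" if "w permutes ?B" for w
        by (simp only: inj_image_mem_iff[OF permutes_inj[OF that]] not_False_eq_True)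
      have "w ` ?S T \<noteq> {1..k}" if w: "w permutes ?B" for w
      proof
        assume "w ` ?S T = {1..k}"
        then have "w i \<notin> {1..k}" using iS[OF w] by simp
        then show False using permutes_not_in[OF w, of i] i jk by auto
      qed
      then have empty: "{w. w permutes ?B \<and> w ` ?S T = {1..k}} = {}" by blast
      show ?thesis unfolding empty using False by simp
    qed
  qed
  also have "\<dots> = (\<Sum>T\<in>{T. {1..j} \<subseteq> T \<and> T \<subseteq> {1..k}}. fact (k - j) * fact (n - k))"
    by (rule sum.mono_neutral_cong_right) auto
  also have "\<dots> = of_nat (card {T. {1..j} \<subseteq> T \<and> T \<subseteq> {1..k}}) * (fact (k - j) * fact (n - k))"
    by simp
  also have "card {T. {1..j} \<subseteq> T \<and> T \<subseteq> {1..k}} = card (Pow {j+1..k})"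
    by (rule bij_betw_same_card[of "\<lambda>T. T - {1..j}"], rule bij_betw_byWitness[where f'="\<lambda>T. T \<union> {1..j}"])
      (use jk in auto)
  finally show ?thesis by (simp add: card_Pow)
qed

text \<open>\<open>mirror_beta n k j\<close> itself need not lie in the orbit span. Its sum over the
  smaller group on \<open>{j+1..n-j}\<close> is alternating, hence a multiple of the generator, and
  the sum over \<open>{j+1..n}\<close> absorbs the smaller one up to a factorial.\<close>

lemma sym_sum_mirror_beta_in_orbit_span:
  assumes kn: "2 * k \<le> n" and jk: "j \<le> k"
  shows "sym_sum {j+1..n} (mirror_beta n k j) \<in> orbit_span n (summand_gen n k j :: 'a::field_char_0 mpoly)"
proof -
  let ?Z = "{j+1..n-j}" and ?B = "{j+1..n}"
  let ?g = "summand_gen n k j :: 'a mpoly" and ?m = "mirror_beta n k j :: 'a mpoly"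
  let ?P = "\<Prod>i=j+1..k. Var i + Var (Suc n - i) :: 'a mpoly"
  have j: "2 * j \<le> n" using kn jk by simp
  have d: "alternating n j j (mirror_diffs n j :: 'a mpoly)"
    using alternating_gen[of j n j] j by (simp add: gen_self)
  have mV: "?m \<in> V n k"
    unfolding mirror_beta_expand[OF assms]
    by (intro mpoly.subspace_sum[OF subspace_V] mpoly.subspace_scale[OF subspace_V] xmon_in_V mirror_set[OF kn]) auto
  have "alternating n k j (sym_sum ?Z ?m)"
    unfolding alternating_def
  proof (intro conjI ballI allI impI)
    show "sym_sum ?Z ?m \<in> V n k" by (rule sym_sum_submodule[OF submodule_V mV]) auto
  next
    fix i assume i: "i \<in> {1..j}"
    let ?s = "transpose i (Suc n - i)"
    have "act ?s (Var l + Var (Suc n - l)) = (Var l + Var (Suc n - l) :: 'a mpoly)" if "l \<in> {j+1..k}" for l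
    proof -
      have "?s l = l" "?s (Suc n - l) = Suc n - l" using i that kn jk by (auto simp: transpose_def)
      then show ?thesis by (simp add: act_add act_Var)
    qed
    then have "act ?s ?P = ?P" by (subst act_prod) auto
    then have s: "act ?s ?m = - ?m"
      using d i by (simp add: mirror_beta_def act_mult alternating_def)
    have "act ?s (sym_sum ?Z ?m) = sym_sum ?Z (act ?s ?m)"
      using i kn jk by (intro act_sym_sum_commute) (auto simp: transpose_def)
    also have "\<dots> = - sym_sum ?Z ?m"
      using sym_sum_smult[of ?Z "-1" ?m] by (simp add: s)
    finally show "act ?s (sym_sum ?Z ?m) = - sym_sum ?Z ?m" .
  qed (rule act_sym_sum')
  then have eq: "sym_sum ?Z ?m = smult (coeff_at (sym_sum ?Z ?m) {1..k}) ?g"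
    by (rule alternating_unique[OF kn jk _ alternating_gen[OF kn jk] coeff_at_gen[OF kn jk]])
  have "sym_sum ?B (sym_sum ?Z ?m) \<in> orbit_span n ?g"
    by (subst eq) (intro sym_sum_submodule[OF submodule_orbit_span]
      mpoly.subspace_scale[OF subspace_orbit_span] orbit_span_self, auto)
  then have "smult (fact (card ?Z)) (sym_sum ?B ?m) \<in> orbit_span n ?g"
    by (subst (asm) sym_sum_sym_sum) auto
  then have "smult (1 / fact (card ?Z)) (smult (fact (card ?Z)) (sym_sum ?B ?m)) \<in> orbit_span n ?g"
    by (rule mpoly.subspace_scale[OF subspace_orbit_span])
  then show ?thesis by simp
qed

lemma spherical_eq_sym_sum_beta:
  assumes kn: "2 * k \<le> n" and jk: "j \<le> k"
  shows "spherical n k j = smult (1 / (fact k * fact (n - k) * 2 ^ (k - j) * fact (k - j)))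
    (sym_sum {1..k} (sym_sum {j+1..n} (beta k j)))"
proof (rule spherical_eqI[OF kn jk])
  let ?c = "1 / (fact k * fact (n - k) * 2 ^ (k - j) * fact (k - j)) :: complex"
  have k: "k \<le> n" using kn by simp
  obtain \<rho> where \<rho>: "\<rho> permutes {j+1..n}" "act \<rho> (beta k j) = (mirror_beta n k j :: complex mpoly)"
    using ex_act_beta[OF assms] by blast
  have eq: "sym_sum {j+1..n} (beta k j) = sym_sum {j+1..n} (mirror_beta n k j :: complex mpoly)"
    using act_sym_sum[OF \<rho>(1), of "beta k j :: complex mpoly"] \<rho>(2) by simp
  let ?f = "sym_sum {1..k} (sym_sum {j+1..n} (mirror_beta n k j)) :: complex mpoly"
  have "?f \<in> orbit_span n (summand_gen n k j)"
    using k by (intro sym_sum_submodule[OF submodule_orbit_span] sym_sum_mirror_beta_in_orbit_span assms) auto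
  then show "smult ?c (sym_sum {1..k} (sym_sum {j+1..n} (beta k j))) \<in> orbit_span n (summand_gen n k j)"
    unfolding eq by (rule mpoly.subspace_scale[OF subspace_orbit_span])
  show "fixed_young n k (smult ?c (sym_sum {1..k} (sym_sum {j+1..n} (beta k j))))"
    using fixed_young_sym_sum[OF k jk] unfolding fixed_young_def by (simp add: act_smult permutes_bij)
  have "coeff_at ?f {1..k} = of_nat (fact (card {1..k})) * (2 ^ (k - j) * fact (k - j) * fact (n - k))"
    unfolding coeff_at_sym_sum_mirror_beta[OF assms, symmetric]
    by (rule coeff_at_sym_sum_invariant) (auto simp: permutes_image)
  then show "coeff_at (smult ?c (sym_sum {1..k} (sym_sum {j+1..n} (beta k j)))) {1..k} = 1"
    unfolding eq coeff_at_smult by simp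
qed

section \<open>Normal forms and removal of defects\<close>

definition factor :: "signed_pair \<Rightarrow> rat mpoly" where
  "factor = (\<lambda>(a, b, s). if s then Var a + Var b else Var a - Var b)"

definition lft :: "signed_pair \<Rightarrow> nat" where "lft = fst"
definition rgt :: "signed_pair \<Rightarrow> nat" where "rgt = (\<lambda>d. fst (snd d))"
definition sgnf :: "signed_pair \<Rightarrow> rat" where "sgnf = (\<lambda>(a, b, s). if s then 1 else -1)"

lemma signed_pair_simps [simp]: "lft (a, b, s) = a" "rgt (a, b, s) = b" "sgnf (a, b, s) = (if s then 1 else -1)"
  by (simp_all add: lft_def rgt_def sgnf_def)

lemma factor_eq: "factor d = Var (lft d) + smult (sgnf d) (Var (rgt d))"
  by (cases d) (auto simp: factor_def)

lemma root_of_factor: "root_of D = (\<Prod>d\<in>D. factor d)"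
  by (simp add: root_of_def factor_def)

lemma is_normal_form_iff:
  "is_normal_form n k D \<longleftrightarrow> finite D \<and> card D = k \<and> (\<forall>d\<in>D. 1 \<le> lft d \<and> lft d < rgt d \<and> rgt d \<le> n) \<and>
    (\<forall>d\<in>D. \<forall>d'\<in>D. d \<noteq> d' \<longrightarrow> {lft d, rgt d} \<inter> {lft d', rgt d'} = {})"
  unfolding is_normal_form_def by (simp only: case_prod_unfold prod.collapse lft_def rgt_def)

lemma unused_iff: "unused n D i \<longleftrightarrow> i \<in> {1..n} \<and> (\<forall>d\<in>D. i \<noteq> lft d \<and> i \<noteq> rgt d)"
  by (auto simp: unused_def split: prod.splits)

definition choice :: "signed_pair set \<Rightarrow> signed_pair set \<Rightarrow> nat set" where
  "choice D T = lft ` T \<union> rgt ` (D - T)"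

lemma normal_form_inj:
  assumes "is_normal_form n k D"
  shows "inj_on lft D" "inj_on rgt D" "lft ` D \<inter> rgt ` D = {}"
proof -
  have disj: "d = d'" if "d \<in> D" "d' \<in> D" "{lft d, rgt d} \<inter> {lft d', rgt d'} \<noteq> {}" for d d'
    using assms that unfolding is_normal_form_iff by blast
  show "inj_on lft D" "inj_on rgt D" by (rule inj_onI, rule disj, simp_all)+
  have False if "d \<in> D" "d' \<in> D" "lft d = rgt d'" for d d'
  proof -
    have "d = d'" using that by (intro disj) auto
    then show False using that assms unfolding is_normal_form_iff by auto
  qed
  then show "lft ` D \<inter> rgt ` D = {}" by blast
qed

lemma root_of_expand:
  assumes "is_normal_form n k D"
  shows "root_of D = (\<Sum>T\<in>Pow D. smult (\<Prod>d\<in>D-T. sgnf d) (xmon (choice D T)))"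
  unfolding root_of_factor factor_eq choice_def
  using normal_form_inj[OF assms] assms
  by (intro prod_pairs_expand) (auto simp: is_normal_form_iff)

lemma choice_ksubs:
  assumes "is_normal_form n k D" "T \<subseteq> D"
  shows "choice D T \<in> ksubs n k"
proof -
  have "card (choice D T) = card D"
    unfolding choice_def
    using normal_form_inj[OF assms(1)] assms by (intro card_pairs) (auto simp: is_normal_form_iff)
  moreover have "x \<in> {1..n}" if "x \<in> choice D T" for x
  proof -
    obtain d where "d \<in> D" "x = lft d \<or> x = rgt d" using \<open>x \<in> choice D T\<close> assms(2) by (auto simp: choice_def)
    then show ?thesis using assms(1) unfolding is_normal_form_iff by fastforce
  qed
  ultimately show ?thesis using assms(1) by (auto simp: ksubs_def is_normal_form_iff)
qed

lemma root_of_in_V: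
  assumes "is_normal_form n k D"
  shows "root_of D \<in> V n k"
  unfolding root_of_expand[OF assms]
proof (rule mpoly.subspace_sum[OF subspace_V])
  fix T assume "T \<in> Pow D"
  then have "choice D T \<in> ksubs n k" using choice_ksubs[OF assms] by simp
  then show "smult (\<Prod>d\<in>D-T. sgnf d) (xmon (choice D T)) \<in> V n k"
    by (rule mpoly.subspace_scale[OF subspace_V xmon_in_V])
qed

text \<open>Compared with the set of all left endpoints, a choice shows which factors contributed
  their right term. In this way \<open>T\<close>, and later the factors themselves, are read off
  from monomials.\<close>

lemma choice_diff:
  assumes "is_normal_form n k D" "T \<subseteq> D"
  shows "lft ` D - choice D T = lft ` (D - T)" "choice D T - lft ` D = rgt ` (D - T)"
proof -
  note inj = normal_form_inj[OF assms(1)]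
  have "lft ` D - lft ` T = lft ` (D - T)"
    by (rule inj_on_image_set_diff[OF inj(1) _ assms(2), symmetric]) auto
  moreover have "lft ` D \<inter> rgt ` (D - T) = {}" using inj(3) by blast
  moreover have "lft ` T \<subseteq> lft ` D" using assms(2) by blast
  ultimately show "lft ` D - choice D T = lft ` (D - T)" "choice D T - lft ` D = rgt ` (D - T)"
    unfolding choice_def by blast+
qed

lemma choice_inj:
  assumes "is_normal_form n k D" "T \<subseteq> D" "T' \<subseteq> D" "choice D T = choice D T'"
  shows "T = T'"
proof -
  have "lft ` (D - T) = lft ` (D - T')" using choice_diff(1)[OF assms(1)] assms by metis
  then have "D - T = D - T'" using normal_form_inj(1)[OF assms(1)] by (metis Diff_subset inj_on_image_eq_iff)
  then show ?thesis using assms by blast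
qed

lemma coeff_at_root_of:
  assumes "is_normal_form n k D" "T \<subseteq> D"
  shows "coeff_at (root_of D) (choice D T) = (\<Prod>d\<in>D-T. sgnf d)"
proof -
  have "finite D" using assms by (simp add: is_normal_form_iff)
  have "coeff_at (root_of D) (choice D T) = (\<Sum>T'\<in>Pow D. if T' = T then (\<Prod>d\<in>D-T. sgnf d) else 0)"
    unfolding root_of_expand[OF assms(1)] coeff_at_sum
  proof (intro sum.cong refl)
    fix T' assume "T' \<in> Pow D"
    then have T': "T' \<subseteq> D" by simp
    show "coeff_at (smult (\<Prod>d\<in>D-T'. sgnf d) (xmon (choice D T'))) (choice D T) =
        (if T' = T then (\<Prod>d\<in>D-T. sgnf d) else 0)"
      using choice_inj[OF assms(1) T' assms(2)] ksubs_finite[OF choice_ksubs[OF assms(1) T']]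
        ksubs_finite[OF choice_ksubs[OF assms]]
      by (auto simp: coeff_at_smult coeff_at_xmon)
  qed
  then show ?thesis using assms(2) \<open>finite D\<close> by simp
qed

lemma coeff_at_root_of_nonzero:
  assumes "is_normal_form n k D" "K \<in> ksubs n k" "coeff_at (root_of D) K \<noteq> 0"
  shows "\<exists>T\<subseteq>D. K = choice D T"
proof (rule ccontr)
  assume no: "\<not> (\<exists>T\<subseteq>D. K = choice D T)"
  have "coeff_at (smult (\<Prod>d\<in>D-T. sgnf d) (xmon (choice D T))) K = 0" if "T \<in> Pow D" for T
  proof -
    have "choice D T \<noteq> K" using no that by blast
    moreover have "finite (choice D T)" using choice_ksubs[OF assms(1)] that ksubs_finite by blast
    ultimately show ?thesis using ksubs_finite[OF assms(2)] by (simp add: coeff_at_smult coeff_at_xmon)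
  qed
  then show False using assms(3) unfolding root_of_expand[OF assms(1)] coeff_at_sum by simp
qed

lemma choice_full: "choice D D = lft ` D"
  by (simp add: choice_def)

text \<open>Each right endpoint in the symmetric difference is accompanied by the smaller left
  endpoint of its factor, so the minimum is a left endpoint. Thus the left endpoints form the
  leading monomial of \<open>root_of D\<close>.\<close>

lemma lex_less_choice:
  assumes "is_normal_form n k D" "T \<subseteq> D" "T \<noteq> D"
  shows "lex_less (lft ` D) (choice D T)"
proof -
  let ?S = "lft ` (D - T) \<union> rgt ` (D - T)"
  have ne: "D - T \<noteq> {}" using assms by blast
  have fin: "finite ?S" using assms(1) by (auto simp: is_normal_form_iff)
  have "Min ?S \<in> ?S" using ne fin by (intro Min_in) auto
  moreover have "Min ?S \<notin> rgt ` (D - T)"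
  proof
    assume "Min ?S \<in> rgt ` (D - T)"
    then obtain d where d: "d \<in> D - T" "Min ?S = rgt d" by blast
    then have "lft d < Min ?S" using assms(1) by (auto simp: is_normal_form_iff)
    moreover have "Min ?S \<le> lft d" using fin d by (intro Min_le) auto
    ultimately show False by simp
  qed
  ultimately have "Min ?S \<in> lft ` D" by blast
  moreover have "lft ` D \<noteq> choice D T" using choice_inj[OF assms(1) _ assms(2), of D] assms(3) by (auto simp: choice_full)
  ultimately show ?thesis unfolding lex_less_def choice_diff[OF assms(1,2)] by blast
qed

lemma positive_root_of:
  assumes "is_normal_form n k D"
  shows "positive n k (root_of D)"
  unfolding positive_def
proof (intro conjI exI[of _ "lft ` D"] allI impI)
  show "root_of D \<in> V n k" by (rule root_of_in_V[OF assms])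
  have "choice D D \<in> ksubs n k" by (rule choice_ksubs[OF assms order_refl])
  then show "lft ` D \<subseteq> {1..n}" "card (lft ` D) = k" by (simp_all add: choice_full ksubs_def)
  show "coeff_at (root_of D) (lft ` D) > 0"
    using coeff_at_root_of[OF assms order_refl] by (simp add: choice_full)
next
  fix J assume J: "J \<subseteq> {1..n}" "card J = k" "coeff_at (root_of D) J \<noteq> 0"
  then obtain T where "T \<subseteq> D" "J = choice D T"
    using coeff_at_root_of_nonzero[OF assms, of J] by (auto simp: ksubs_def)
  then show "J = lft ` D \<or> lex_less (lft ` D) J"
    using lex_less_choice[OF assms] choice_full by metis
qed

lemma lex_less_asym:
  assumes "finite I" "finite J" "lex_less I J" "lex_less J I"
  shows False
proof -
  let ?S = "(I - J) \<union> (J - I)"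
  have "?S \<noteq> {}" using assms(3) by (auto simp: lex_less_def)
  then have "Min ?S \<in> ?S" using assms by (intro Min_in) auto
  moreover have "Min ?S \<in> I" using assms(3) by (simp add: lex_less_def)
  moreover have "Min ?S \<in> J" using assms(4) by (simp add: lex_less_def Un_commute)
  ultimately show False by blast
qed

text \<open>The leading monomial of either root occurs in the other one, so neither can strictly
  precede the other.\<close>

lemma root_of_lefts:
  assumes D: "is_normal_form n k D" and D': "is_normal_form n k D'" and eq: "root_of D = root_of D'"
  shows "lft ` D = lft ` D'"
proof -
  have *: "lft ` D' = lft ` D \<or> lex_less (lft ` D) (lft ` D')"
    if D: "is_normal_form n k D" and D': "is_normal_form n k D'" and eq: "root_of D = root_of D'" for D D'
  proof -
    have mem: "choice D' D' \<in> ksubs n k" by (rule choice_ksubs[OF D' order_refl])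
    have "coeff_at (root_of D) (choice D' D') \<noteq> 0"
      unfolding eq by (simp add: coeff_at_root_of[OF D' order_refl])
    then obtain T where "T \<subseteq> D" "choice D' D' = choice D T"
      using coeff_at_root_of_nonzero[OF D mem] by blast
    then show ?thesis using lex_less_choice[OF D] choice_full by metis
  qed
  have "finite (lft ` D)" "finite (lft ` D')" using D D' by (auto simp: is_normal_form_iff)
  then show ?thesis using *[OF D D' eq] *[OF D' D eq[symmetric]] lex_less_asym by metis
qed

text \<open>A factor \<open>d\<close> is visible in the monomial in which \<open>d\<close> alone
  contributes its right term: it differs from the leading one by exchanging \<open>lft d\<close> for
  \<open>rgt d\<close>, and its coefficient is the sign of \<open>d\<close>.\<close>

lemma root_of_subset:
  assumes D: "is_normal_form n k D" and D': "is_normal_form n k D'" and eq: "root_of D = root_of D'"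
  shows "D \<subseteq> D'"
proof
  fix d assume d: "d \<in> D"
  have lefts: "lft ` D = lft ` D'" by (rule root_of_lefts[OF assms])
  let ?K = "choice D (D - {d})"
  have K: "?K \<in> ksubs n k" by (rule choice_ksubs[OF D]) auto
  have Dd: "D - (D - {d}) = {d}" using d by auto
  have c: "coeff_at (root_of D) ?K = sgnf d"
    using coeff_at_root_of[OF D, of "D - {d}"] by (simp add: Dd)
  have "sgnf d \<noteq> 0" by (cases d) auto
  then obtain T where T: "T \<subseteq> D'" "?K = choice D' T"
    using coeff_at_root_of_nonzero[OF D' K] c eq by auto
  have "lft ` (D' - T) = {lft d}"
    using choice_diff(1)[OF D' T(1)] choice_diff(1)[OF D, of "D - {d}"] T(2) lefts by (simp add: Dd)
  moreover have r: "rgt ` (D' - T) = {rgt d}"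
    using choice_diff(2)[OF D' T(1)] choice_diff(2)[OF D, of "D - {d}"] T(2) lefts by (simp add: Dd)
  moreover have "inj_on lft (D' - T)" using normal_form_inj(1)[OF D'] by (rule inj_on_subset) auto
  ultimately have "card (D' - T) = 1" by (metis card_image card.empty card.insert empty_iff finite.emptyI One_nat_def)
  then obtain d' where d': "D' - T = {d'}" by (rule card_1_singletonE)
  then have "lft d' = lft d" "rgt d' = rgt d"
    using \<open>lft ` (D' - T) = {lft d}\<close> r by auto
  moreover have "sgnf d' = sgnf d"
    using coeff_at_root_of[OF D' T(1)] c T(2) eq by (simp add: d')
  ultimately have "d' = d" by (cases d; cases d') (auto split: if_splits)
  then show "d \<in> D'" using d' by blast
qed

text \<open>\<open>has_defect\<close> ranges over all normal forms of a polynomial; uniqueness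
  allows a single one to be inspected.\<close>

lemma root_of_inj:
  assumes "is_normal_form n k D" "is_normal_form n k D'" "root_of D = root_of D'"
  shows "D = D'"
  using root_of_subset[OF assms] root_of_subset[OF assms(2,1)] assms(3) by auto

lemma is_k_root_root_of:
  assumes D: "is_normal_form n k D"
  shows "is_k_root n k (root_of D)"
proof -
  have fin: "finite D" "card D = k" using D by (auto simp: is_normal_form_iff)
  obtain e where e: "bij_betw e {1..k} D"
    using ex_bij_betw_nat_finite_1[OF fin(1)] fin(2) by blast
  note inj = normal_form_inj[OF D]
  \<comment> \<open>In the numbering of \<open>is_k_root\<close>, factor \<open>r\<close> has its
    left endpoint at the odd position \<open>2*r-1\<close> and its right endpoint at
    \<open>2*r\<close>.\<close>
  define i where "i m = (if odd m then lft (e ((m + 1) div 2)) else rgt (e (m div 2)))" for m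
  define s where "s m = (if odd m then 1 else sgnf (e (m div 2)))" for m
  have eD: "e r \<in> D" if "r \<in> {1..k}" for r using that e by (auto simp: bij_betw_def)
  have range: "lft (e r) \<in> {1..n}" "rgt (e r) \<in> {1..n}" if "r \<in> {1..k}" for r
    using eD[OF that] D unfolding is_normal_form_iff by fastforce+
  have half: "(m + 1) div 2 \<in> {1..k}" if "m \<in> {1..2*k}" "odd m" for m using that by (auto elim!: oddE)
  have half': "m div 2 \<in> {1..k}" if "m \<in> {1..2*k}" "even m" for m using that by (auto elim!: evenE)
  have einj: "r = r'" if "r \<in> {1..k}" "r' \<in> {1..k}" "e r = e r'" for r r'
    by (rule inj_onD[OF bij_betw_imp_inj_on[OF e] that(3,1,2)])
  have linj: "r = r'" if "r \<in> {1..k}" "r' \<in> {1..k}" "lft (e r) = lft (e r')" for r r'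
    by (rule einj[OF that(1,2) inj_onD[OF inj(1) that(3) eD[OF that(1)] eD[OF that(2)]]])
  have rinj: "r = r'" if "r \<in> {1..k}" "r' \<in> {1..k}" "rgt (e r) = rgt (e r')" for r r'
    by (rule einj[OF that(1,2) inj_onD[OF inj(2) that(3) eD[OF that(1)] eD[OF that(2)]]])
  have lr: "lft (e r) \<noteq> rgt (e r')" if "r \<in> {1..k}" "r' \<in> {1..k}" for r r'
    using inj(3) eD[OF that(1)] eD[OF that(2)] by blast
  have "inj_on i {1..2*k}"
  proof (rule inj_onI)
    fix m m' assume m: "m \<in> {1..2*k}" "m' \<in> {1..2*k}" "i m = i m'"
    show "m = m'"
    proof (cases "odd m"; cases "odd m'")
      assume o: "odd m" "odd m'"
      have "(m + 1) div 2 = (m' + 1) div 2"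
        by (rule linj[OF half[OF m(1) o(1)] half[OF m(2) o(2)]]) (use m(3) o in \<open>simp add: i_def\<close>)
      then show ?thesis using o by presburger
    next
      assume o: "odd m" "\<not> odd m'"
      then have "lft (e ((m + 1) div 2)) = rgt (e (m' div 2))" using m(3) by (simp add: i_def)
      then show ?thesis using lr[OF half[OF m(1)] half'[OF m(2)]] o by blast
    next
      assume o: "\<not> odd m" "odd m'"
      then have "lft (e ((m' + 1) div 2)) = rgt (e (m div 2))" using m(3) by (simp add: i_def)
      then show ?thesis using lr[OF half[OF m(2)] half'[OF m(1)]] o by blast
    next
      assume o: "\<not> odd m" "\<not> odd m'"
      then have "even m" "even m'" by simp_all
      have "m div 2 = m' div 2"
        by (rule rinj[OF half'[OF m(1) \<open>even m\<close>] half'[OF m(2) \<open>even m'\<close>]])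
          (use m(3) o in \<open>simp add: i_def\<close>)
      then show ?thesis using o by presburger
    qed
  qed
  moreover have "i ` {1..2*k} \<subseteq> {1..n}"
    using range half half' by (fastforce simp: i_def)
  moreover have "\<forall>r\<in>{1..2*k}. s r \<in> {1, -1}"
    by (auto simp: s_def sgnf_def split: prod.splits)
  moreover have "root_of D = (\<Prod>r=1..k. smult (s (2*r-1)) (Var (i (2*r-1))) + smult (s (2*r)) (Var (i (2*r))))"
  proof -
    have "root_of D = (\<Prod>r=1..k. factor (e r))"
      unfolding root_of_factor using e by (rule prod.reindex_bij_betw[symmetric])
    also have "\<dots> = (\<Prod>r=1..k. smult (s (2*r-1)) (Var (i (2*r-1))) + smult (s (2*r)) (Var (i (2*r))))"
    proof (intro prod.cong refl)
      fix r assume "r \<in> {1..k}"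
      then have "odd (2*r-1)" "(2*r-1+1) div 2 = r" by auto
      then show "factor (e r) = smult (s (2*r-1)) (Var (i (2*r-1))) + smult (s (2*r)) (Var (i (2*r)))"
        by (simp add: factor_eq s_def i_def)
    qed
    finally show ?thesis .
  qed
  ultimately show ?thesis unfolding is_k_root_def by blast
qed

text \<open>The disjunction of \<open>has_defect\<close> verbatim, so that it can be folded there,
  but attached to a normal form instead of a polynomial.\<close>

definition defective :: "nat \<Rightarrow> signed_pair set \<Rightarrow> bool" where
  "defective n D \<longleftrightarrow>
     (\<exists>i j r s e e'. i < j \<and> j < r \<and> r < s \<and> (i, r, e) \<in> D \<and> (j, s, e') \<in> D) \<or>
     (\<exists>i j r s e. i < j \<and> j < r \<and> r < s \<and> (i, s, e) \<in> D \<and> (j, r, True) \<in> D) \<or>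
     (\<exists>i j r e. i < j \<and> j < r \<and> (i, r, e) \<in> D \<and> unused n D j) \<or>
     (\<exists>i j r. i < j \<and> j < r \<and> (i, j, True) \<in> D \<and> unused n D r)"

lemma root_of_in_root_basis:
  assumes "is_normal_form n k D" "\<not> defective n D"
  shows "root_of D \<in> root_basis n k"
proof -
  have "\<not> has_defect n k (root_of D)"
    using root_of_inj[OF assms(1)] assms(2) unfolding has_defect_def defective_def[symmetric] by blast
  then show ?thesis
    using is_k_root_root_of[OF assms(1)] positive_root_of[OF assms(1)] by (simp add: root_basis_def)
qed

text \<open>Without finiteness the sum over \<open>root_basis n k\<close> would be 0 by convention.
  A root is determined by finitely many indices and signs.\<close>

lemma finite_root_basis: "finite (root_basis n k)"
proof -
  let ?F = "\<lambda>(i, s). \<Prod>r=1..k. smult (s (2*r-1)) (Var (i (2*r-1))) + smult (s (2*r)) (Var (i (2*r))) :: rat mpoly"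
  let ?X = "PiE {1..2*k} (\<lambda>_. {1..n}) \<times> PiE {1..2*k} (\<lambda>_. {1, -1})"
  have "root_basis n k \<subseteq> ?F ` ?X"
  proof
    fix f assume "f \<in> root_basis n k"
    then obtain i s where fs: "i ` {1..2*k} \<subseteq> {1..n}" "\<forall>r\<in>{1..2*k}. s r \<in> {1, -1}" "f = ?F (i, s)"
      by (auto simp: root_basis_def is_k_root_def)
    have "f = ?F (restrict i {1..2*k}, restrict s {1..2*k})"
      unfolding fs(3) prod.case by (intro prod.cong refl) auto
    moreover have "(restrict i {1..2*k}, restrict s {1..2*k}) \<in> ?X" using fs(1,2) by auto
    ultimately show "f \<in> ?F ` ?X" by blast
  qed
  moreover have "finite ?X" by (intro finite_cartesian_product finite_PiE) auto
  ultimately show ?thesis using finite_surj by blast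
qed

section \<open>Straightening roots into nonnegative integer combinations of the basis\<close>

definition nn_comb :: "nat \<Rightarrow> nat \<Rightarrow> rat mpoly \<Rightarrow> bool" where
  "nn_comb n k f \<longleftrightarrow> (\<exists>c :: rat mpoly \<Rightarrow> nat. f = (\<Sum>b\<in>root_basis n k. smult (of_nat (c b)) b))"

lemma nn_comb_0: "nn_comb n k 0"
  unfolding nn_comb_def by (intro exI[of _ "\<lambda>_. 0"]) simp

lemma nn_comb_add: "nn_comb n k f \<Longrightarrow> nn_comb n k g \<Longrightarrow> nn_comb n k (f + g)"
proof -
  assume "nn_comb n k f" "nn_comb n k g"
  then obtain c d :: "rat mpoly \<Rightarrow> nat" where
    "f = (\<Sum>b\<in>root_basis n k. smult (of_nat (c b)) b)" "g = (\<Sum>b\<in>root_basis n k. smult (of_nat (d b)) b)"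
    by (auto simp: nn_comb_def)
  then show ?thesis unfolding nn_comb_def
    by (intro exI[of _ "\<lambda>b. c b + d b"]) (simp add: mpoly.scale_left_distrib sum.distrib)
qed

lemma nn_comb_sum: "(\<And>i. i \<in> I \<Longrightarrow> nn_comb n k (f i)) \<Longrightarrow> nn_comb n k (\<Sum>i\<in>I. f i)"
  by (induction I rule: infinite_finite_induct) (auto intro: nn_comb_0 nn_comb_add)

lemma nn_comb_base:
  assumes "f \<in> root_basis n k"
  shows "nn_comb n k f"
proof -
  have "(\<Sum>b\<in>root_basis n k. smult (of_nat (if b = f then 1 else 0)) b) = (\<Sum>b\<in>root_basis n k. if b = f then f else 0)"
    by (intro sum.cong) auto
  also have "\<dots> = f" using assms finite_root_basis by simp
  finally have eq: "(\<Sum>b\<in>root_basis n k. smult (of_nat (if b = f then 1 else 0)) b) = f" .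
  show ?thesis
    unfolding nn_comb_def by (rule exI[of _ "\<lambda>b. if b = f then 1 else 0"]) (simp only: eq)
qed

text \<open>
Every resolution of a defect replaces factors so that either the left endpoints increase
(\<open>weight1\<close> decreases) or they are kept and \<open>weight2\<close> decreases: by the rearrangement inequality if a
crossing becomes a nesting, because a right endpoint decreases if an unused index lies inside a
factor, and through the second summand if a symmetric factor turns antisymmetric or its plus sign
moves to the outer factor of a nesting.
\<close>

definition weight1 :: "nat \<Rightarrow> signed_pair set \<Rightarrow> nat" where
  "weight1 n D = (\<Sum>d\<in>D. n - lft d)"

definition weight2 :: "signed_pair set \<Rightarrow> nat" where
  "weight2 D = (\<Sum>(a, b, s)\<in>D. a * b + (if s then a else 0))"

lemma nn_comb_replace:
  assumes D: "is_normal_form n k D" and F: "F \<subseteq> D"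
    and IH: "\<And>E. weight1 n E < weight1 n D \<or> weight1 n E = weight1 n D \<and> weight2 E < weight2 D \<Longrightarrow>
      is_normal_form n k E \<Longrightarrow> nn_comb n k (root_of E)"
    and G: "is_normal_form n (card F) G"
      "\<And>g x. g \<in> G \<Longrightarrow> x \<in> {lft g, rgt g} \<Longrightarrow> unused n D x \<or> (\<exists>d\<in>F. x \<in> {lft d, rgt d})"
    and less: "weight1 n G < weight1 n F \<or> weight1 n G = weight1 n F \<and> weight2 G < weight2 F"
  shows "nn_comb n k (root_of (D - F) * root_of G)"
proof -
  let ?E = "(D - F) \<union> G"
  have finD: "finite D" and finF: "finite F" and finG: "finite G"
    using D F G by (auto simp: is_normal_form_iff intro: finite_subset)
  have disj: "{lft d, rgt d} \<inter> {lft g, rgt g} = {}" if d: "d \<in> D - F" and g: "g \<in> G" for d g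
  proof (rule ccontr)
    assume "{lft d, rgt d} \<inter> {lft g, rgt g} \<noteq> {}"
    then obtain x where x: "x \<in> {lft d, rgt d}" "x \<in> {lft g, rgt g}" by blast
    have "\<not> unused n D x" using x(1) d unfolding unused_iff by blast
    then obtain d' where d': "d' \<in> F" "x \<in> {lft d', rgt d'}" using G(2)[OF g x(2)] by blast
    then have "d' \<in> D" "d \<noteq> d'" using d F by auto
    then have "{lft d, rgt d} \<inter> {lft d', rgt d'} = {}" using D d unfolding is_normal_form_iff by blast
    then show False using x(1) d'(2) by blast
  qed
  then have DG: "(D - F) \<inter> G = {}" by blast
  have "card ?E = card (D - F) + card G" using DG finD finG by (intro card_Un_disjoint) auto
  also have "\<dots> = k"
    using D G F finD finF card_mono[OF finD F] by (simp add: card_Diff_subset is_normal_form_iff)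
  finally have card: "card ?E = k" .
  have "is_normal_form n k ?E"
    unfolding is_normal_form_iff
  proof (intro conjI ballI impI)
    show "finite ?E" using finD finG by simp
    show "card ?E = k" by (rule card)
  next
    fix d assume "d \<in> ?E"
    then show "1 \<le> lft d" "lft d < rgt d" "rgt d \<le> n" using D G(1) by (auto simp: is_normal_form_iff)
  next
    fix d d' assume dd: "d \<in> ?E" "d' \<in> ?E" "d \<noteq> d'"
    consider "d \<in> D" "d' \<in> D" | "d \<in> G" "d' \<in> G" | "d \<in> D - F" "d' \<in> G" | "d \<in> G" "d' \<in> D - F"
      using dd by blast
    then show "{lft d, rgt d} \<inter> {lft d', rgt d'} = {}"
    proof cases
      case 1
      then show ?thesis using D dd(3) unfolding is_normal_form_iff by blast
    next
      case 2
      then show ?thesis using G(1) dd(3) unfolding is_normal_form_iff by blast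
    next
      case 3
      then show ?thesis by (rule disj)
    next
      case 4
      then show ?thesis using disj[of d' d] by (simp add: Int_commute)
    qed
  qed
  moreover have w: "weight1 n ?E = weight1 n (D - F) + weight1 n G" "weight2 ?E = weight2 (D - F) + weight2 G"
    using DG finD finG by (simp_all add: weight1_def weight2_def sum.union_disjoint)
  moreover have "weight1 n D = weight1 n (D - F) + weight1 n F" "weight2 D = weight2 (D - F) + weight2 F"
    using F finD by (simp_all add: weight1_def weight2_def sum.subset_diff)
  ultimately have "nn_comb n k (root_of ?E)" using less by (intro IH) auto
  moreover have "root_of ?E = root_of (D - F) * root_of G"
    using DG finD finG by (simp add: root_of_factor prod.union_disjoint)
  ultimately show ?thesis by simp
qed

lemma rearrangement_nat: "i < j \<Longrightarrow> r < s \<Longrightarrow> i * s + j * r < i * r + j * (s::nat)"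
proof -
  assume "i < j" "r < s"
  then obtain x y where "j = i + Suc x" "s = r + Suc y" by (metis add_Suc_right less_imp_Suc_add)
  then show ?thesis by (simp add: algebra_simps)
qed

lemma nn_comb_root_of: "is_normal_form n k D \<Longrightarrow> nn_comb n k (root_of D)"
proof (induction D rule: wf_induct_rule[OF wf_measures[of "[weight1 n, weight2]"]])
  case (1 D)
  note D = "1.prems"
  have IH: "nn_comb n k (root_of E)"
    if "weight1 n E < weight1 n D \<or> weight1 n E = weight1 n D \<and> weight2 E < weight2 D" "is_normal_form n k E" for E
    using "1.IH"[OF _ that(2)] that(1) by auto
  have split: "root_of D = root_of (D - F) * root_of F" if "F \<subseteq> D" for F
    using D that by (simp add: root_of_factor prod.subset_diff is_normal_form_iff)
  have bound: "1 \<le> a" "a < b" "b \<le> n" if "(a, b, s) \<in> D" for a b s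
    using D that by (auto simp: is_normal_form_iff)
  note rep = nn_comb_replace[OF D _ IH]
  show ?case
  proof (cases "defective n D")
    case False
    then show ?thesis by (intro nn_comb_base root_of_in_root_basis[OF D])
  next
    case True
    then show ?thesis
      unfolding defective_def
    proof (elim disjE exE conjE)
      fix i j r s e e'
      assume crossing: "i < j" "j < r" "r < s" "(i, r, e) \<in> D" "(j, s, e') \<in> D"
      \<comment> \<open>\<open>(x\<^sub>i - x\<^sub>r)(x\<^sub>j + d x\<^sub>s) = (x\<^sub>i + d x\<^sub>s)(x\<^sub>j - x\<^sub>r) + (x\<^sub>i - x\<^sub>j)(x\<^sub>r + d x\<^sub>s)\<close> and
        \<open>(x\<^sub>i + x\<^sub>r)(x\<^sub>j + d x\<^sub>s) = (x\<^sub>i - d x\<^sub>s)(x\<^sub>j - x\<^sub>r) + (x\<^sub>i + x\<^sub>j)(x\<^sub>r + d x\<^sub>s)\<close> for \<open>d = \<plusminus>1\<close>\<close>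
      let ?F = "{(i, r, e), (j, s, e')}"
      let ?G1 = "{(i, s, e \<noteq> e'), (j, r, False)}" and ?G2 = "{(i, j, e), (r, s, e')}"
      have F: "?F \<subseteq> D" using crossing by blast
      have b: "1 \<le> i" "s \<le> n" using bound crossing by blast+
      have "nn_comb n k (root_of (D - ?F) * root_of ?G1)"
      proof (rule rep[OF F])
        show "is_normal_form n (card ?F) ?G1" using crossing b by (auto simp: is_normal_form_iff)
        show "weight1 n ?G1 < weight1 n ?F \<or> weight1 n ?G1 = weight1 n ?F \<and> weight2 ?G1 < weight2 ?F"
          using crossing rearrangement_nat[of i j r s] by (auto simp: weight1_def weight2_def)
      qed auto
      moreover have "nn_comb n k (root_of (D - ?F) * root_of ?G2)"
      proof (rule rep[OF F])
        show "is_normal_form n (card ?F) ?G2" using crossing b by (auto simp: is_normal_form_iff)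
        show "weight1 n ?G2 < weight1 n ?F \<or> weight1 n ?G2 = weight1 n ?F \<and> weight2 ?G2 < weight2 ?F"
          using crossing b by (auto simp: weight1_def)
      qed auto
      moreover have "root_of ?F = root_of ?G1 + root_of ?G2"
        using crossing by (auto simp: root_of_factor factor_def algebra_simps)
      ultimately show "nn_comb n k (root_of D)"
        unfolding split[OF F] by (simp only: distrib_left nn_comb_add)
    next
      fix i j r s e
      assume nesting: "i < j" "j < r" "r < s" "(i, s, e) \<in> D" "(j, r, True) \<in> D"
      \<comment> \<open>For \<open>d\<close> equal to 1 or -1: \<open>(x_i + d x_s)(x_j + x_r) =
        (x_i - d x_s)(x_j - x_r) + (x_i + x_j)(x_r + d x_s) + (x_i - x_j)(x_r - d x_s)\<close>. The
        first product keeps the left endpoints; in the other two \<open>r\<close> replaces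
        \<open>j\<close> among them.\<close>
      let ?F = "{(i, s, e), (j, r, True)}"
      let ?G1 = "{(i, s, \<not> e), (j, r, False)}" and ?G2 = "{(i, j, True), (r, s, e)}"
        and ?G3 = "{(i, j, False), (r, s, \<not> e)}"
      have F: "?F \<subseteq> D" using nesting by blast
      have b: "1 \<le> i" "s \<le> n" using bound nesting by blast+
      have "nn_comb n k (root_of (D - ?F) * root_of ?G1)"
      proof (rule rep[OF F])
        show "is_normal_form n (card ?F) ?G1" using nesting b by (auto simp: is_normal_form_iff)
        show "weight1 n ?G1 < weight1 n ?F \<or> weight1 n ?G1 = weight1 n ?F \<and> weight2 ?G1 < weight2 ?F"
          using nesting by (auto simp: weight1_def weight2_def)
      qed auto
      moreover have "nn_comb n k (root_of (D - ?F) * root_of ?G2)"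
      proof (rule rep[OF F])
        show "is_normal_form n (card ?F) ?G2" using nesting b by (auto simp: is_normal_form_iff)
        show "weight1 n ?G2 < weight1 n ?F \<or> weight1 n ?G2 = weight1 n ?F \<and> weight2 ?G2 < weight2 ?F"
          using nesting b by (auto simp: weight1_def)
      qed auto
      moreover have "nn_comb n k (root_of (D - ?F) * root_of ?G3)"
      proof (rule rep[OF F])
        show "is_normal_form n (card ?F) ?G3" using nesting b by (auto simp: is_normal_form_iff)
        show "weight1 n ?G3 < weight1 n ?F \<or> weight1 n ?G3 = weight1 n ?F \<and> weight2 ?G3 < weight2 ?F"
          using nesting b by (auto simp: weight1_def)
      qed auto
      moreover have "root_of ?F = root_of ?G1 + root_of ?G2 + root_of ?G3"
        using nesting by (auto simp: root_of_factor factor_def algebra_simps)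
      ultimately show "nn_comb n k (root_of D)"
        unfolding split[OF F] by (simp only: distrib_left nn_comb_add)
    next
      fix i j r e
      assume inner: "i < j" "j < r" "(i, r, e) \<in> D" "unused n D j"
      \<comment> \<open>\<open>x_i + d x_r = (x_i - x_j) + (x_j + d x_r)\<close>: one term is
        shorter with the same left endpoint, the other has a larger left endpoint.\<close>
      let ?F = "{(i, r, e)}"
      have F: "?F \<subseteq> D" using inner by blast
      have b: "1 \<le> i" "r \<le> n" using bound inner by blast+
      have "nn_comb n k (root_of (D - ?F) * root_of {(i, j, False)})"
      proof (rule rep[OF F])
        show "is_normal_form n (card ?F) {(i, j, False)}" using inner b by (auto simp: is_normal_form_iff)
        show "weight1 n {(i, j, False)} < weight1 n ?F \<or>
            weight1 n {(i, j, False)} = weight1 n ?F \<and> weight2 {(i, j, False)} < weight2 ?F"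
          using inner b by (auto simp: weight1_def weight2_def intro: trans_less_add1)
      qed (use inner in auto)
      moreover have "nn_comb n k (root_of (D - ?F) * root_of {(j, r, e)})"
      proof (rule rep[OF F])
        show "is_normal_form n (card ?F) {(j, r, e)}" using inner b by (auto simp: is_normal_form_iff)
        show "weight1 n {(j, r, e)} < weight1 n ?F \<or>
            weight1 n {(j, r, e)} = weight1 n ?F \<and> weight2 {(j, r, e)} < weight2 ?F"
          using inner b by (auto simp: weight1_def)
      qed (use inner in auto)
      moreover have "root_of ?F = root_of {(i, j, False)} + root_of {(j, r, e)}"
        by (auto simp: root_of_factor factor_def)
      ultimately show "nn_comb n k (root_of D)"
        unfolding split[OF F] by (simp only: distrib_left nn_comb_add)
    next
      fix i j r
      assume right: "i < j" "j < r" "(i, j, True) \<in> D" "unused n D r"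
      \<comment> \<open>\<open>x_i + x_j = (x_i - x_j) + (x_j - x_r) + (x_j + x_r)\<close>. The
        first term lowers \<open>weight2\<close> by \<open>i\<close>, which is positive because
        indices start at 1.\<close>
      let ?F = "{(i, j, True)}"
      have F: "?F \<subseteq> D" using right by blast
      have b: "1 \<le> i" "r \<le> n" using bound right by (blast, simp add: unused_def)
      have "nn_comb n k (root_of (D - ?F) * root_of {(i, j, False)})"
      proof (rule rep[OF F])
        show "is_normal_form n (card ?F) {(i, j, False)}" using right b by (auto simp: is_normal_form_iff)
        show "weight1 n {(i, j, False)} < weight1 n ?F \<or>
            weight1 n {(i, j, False)} = weight1 n ?F \<and> weight2 {(i, j, False)} < weight2 ?F"
          using right b by (auto simp: weight1_def weight2_def)
      qed (use right in auto)
      moreover have "nn_comb n k (root_of (D - ?F) * root_of {(j, r, e)})" for e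
      proof (rule rep[OF F])
        show "is_normal_form n (card ?F) {(j, r, e)}" using right b by (auto simp: is_normal_form_iff)
        show "weight1 n {(j, r, e)} < weight1 n ?F \<or>
            weight1 n {(j, r, e)} = weight1 n ?F \<and> weight2 {(j, r, e)} < weight2 ?F"
          using right b by (auto simp: weight1_def)
      qed (use right in auto)
      moreover have "root_of ?F = root_of {(i, j, False)} + root_of {(j, r, False)} + root_of {(j, r, True)}"
        by (auto simp: root_of_factor factor_def)
      ultimately show "nn_comb n k (root_of D)"
        unfolding split[OF F] by (simp only: distrib_left nn_comb_add)
    qed
  qed
qed

section \<open>Nonnegativity\<close>

text \<open>The falling factorial, in the shape of the two products that form \<open>N\<close> in
  the theorem. Truncated subtraction makes it vanish for \<open>r < p\<close>.\<close>

definition falling :: "nat \<Rightarrow> nat \<Rightarrow> nat" where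
  "falling r p = (\<Prod>i<p. r - i)"

lemma falling_0 [simp]: "falling r 0 = 1"
  by (simp add: falling_def)

lemma falling_Suc: "falling r (Suc p) = falling r p * (r - p)"
  by (simp add: falling_def)

lemma falling_Suc': "falling r (Suc p) = r * falling (r - 1) p"
  unfolding falling_def prod.lessThan_Suc_shift by simp

lemma falling_eq_0: "r < p \<Longrightarrow> falling r p = 0"
  by (auto simp: falling_def)

lemma falling_fact: "p \<le> r \<Longrightarrow> falling r p * fact (r - p) = fact r"
proof (induction p)
  case (Suc p)
  then have "r - p = Suc (r - Suc p)" by simp
  then have "fact (r - p) = (r - p) * fact (r - Suc p)" by (metis fact_Suc of_nat_id)
  then show ?case using Suc by (simp add: falling_Suc mult.assoc)
qed simp

section \<open>Elementary symmetric polynomials as sums over matchings\<close>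

lemma esym_insert:
  assumes "finite Z" "z \<notin> Z"
  shows "esym (insert z Z) (Suc q) = esym Z (Suc q) + Var z * esym Z q"
proof -
  have fin: "finite K" if "K \<subseteq> Z" for K using that assms(1) finite_subset by blast
  have "{K. K \<subseteq> insert z Z \<and> card K = Suc q} =
      {K. K \<subseteq> Z \<and> card K = Suc q} \<union> insert z ` {K. K \<subseteq> Z \<and> card K = q}" (is "?A = ?B \<union> insert z ` ?C")
  proof (intro equalityI subsetI)
    fix K assume K: "K \<in> ?A"
    show "K \<in> ?B \<union> insert z ` ?C"
    proof (cases "z \<in> K")
      case True
      then have "K = insert z (K - {z})" "K - {z} \<in> ?C" using K by auto
      then show ?thesis by blast
    qed (use K in auto)
  next
    fix K assume "K \<in> ?B \<union> insert z ` ?C"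
    then show "K \<in> ?A" using assms fin by (auto simp: card_insert_if)
  qed
  moreover have "?B \<inter> insert z ` ?C = {}" using assms(2) by auto
  ultimately have "esym (insert z Z) (Suc q) = esym Z (Suc q) + (\<Sum>K\<in>insert z ` ?C. xmon K)"
    using finite_subsets_card[OF assms(1)] by (simp add: esym_def sum.union_disjoint)
  also have "(\<Sum>K\<in>insert z ` ?C. xmon K) = (\<Sum>K\<in>?C. xmon (insert z K))"
  proof (rule sum.reindex_cong[OF _ refl refl])
    show "inj_on (insert z) ?C" using assms(2) by (intro inj_onI) (auto dest: insert_ident[THEN iffD1, rotated 2])
  qed
  also have "\<dots> = (\<Sum>K\<in>?C. Var z * xmon K)"
    using assms(2) fin by (intro sum.cong refl xmon_insert) auto
  finally show ?thesis by (simp add: esym_def sum_distrib_left)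
qed

text \<open>Double counting: a \<open>q\<close>-set \<open>K\<close> survives the removal of
  \<open>y\<close> exactly for the \<open>card Z - q\<close> elements \<open>y\<close> outside
  \<open>K\<close>.\<close>

lemma sum_esym_remove:
  assumes "finite Z"
  shows "(\<Sum>y\<in>Z. esym (Z - {y}) q) = of_nat (card Z - q) * esym Z q"
proof -
  let ?C = "{K. K \<subseteq> Z \<and> card K = q}"
  have "(\<Sum>y\<in>Z. esym (Z - {y}) q) = (\<Sum>y\<in>Z. \<Sum>K\<in>{K\<in>?C. y \<notin> K}. xmon K)"
    unfolding esym_def by (intro sum.cong refl) auto
  also have "\<dots> = (\<Sum>K\<in>?C. \<Sum>y\<in>{y\<in>Z. y \<notin> K}. xmon K)"
    by (rule sum.swap_restrict[OF assms finite_subsets_card[OF assms]])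
  also have "\<dots> = (\<Sum>K\<in>?C. of_nat (card Z - q) * xmon K)"
  proof (intro sum.cong refl)
    fix K assume K: "K \<in> ?C"
    have "{y\<in>Z. y \<notin> K} = Z - K" by auto
    then have "card {y\<in>Z. y \<notin> K} = card Z - q"
      using K finite_subset[OF _ assms, of K] by (simp add: card_Diff_subset)
    then show "(\<Sum>y\<in>{y\<in>Z. y \<notin> K}. xmon K) = of_nat (card Z - q) * xmon K" by simp
  qed
  finally show ?thesis by (simp add: esym_def sum_distrib_left)
qed

text \<open>Double counting: a set \<open>K\<close> of size \<open>Suc q\<close> is produced once
  for each of its elements \<open>y\<close>.\<close>

lemma sum_Var_esym_remove:
  assumes "finite Z"
  shows "(\<Sum>y\<in>Z. Var y * esym (Z - {y}) q) = of_nat (Suc q) * esym Z (Suc q)"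
proof -
  let ?C = "{K. K \<subseteq> Z \<and> card K = Suc q}"
  have fin: "finite K" if "K \<subseteq> Z" for K using that assms finite_subset by blast
  have "(\<Sum>y\<in>Z. Var y * esym (Z - {y}) q) = (\<Sum>y\<in>Z. \<Sum>K\<in>{K\<in>?C. y \<in> K}. xmon K)"
  proof (intro sum.cong refl)
    fix y assume y: "y \<in> Z"
    have "Var y * esym (Z - {y}) q = (\<Sum>K | K \<subseteq> Z - {y} \<and> card K = q. xmon (insert y K))"
      unfolding esym_def sum_distrib_left
      by (intro sum.cong refl xmon_insert[symmetric]) (auto dest: subset_Diff_insert[THEN iffD1] intro: fin)
    also have "\<dots> = (\<Sum>K\<in>{K\<in>?C. y \<in> K}. xmon K)"
      by (rule sum.reindex_bij_witness[where i="\<lambda>K. K - {y}" and j="insert y"])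
        (use y fin in \<open>auto simp: card_insert_if subset_Diff_insert\<close>)
    finally show "Var y * esym (Z - {y}) q = (\<Sum>K\<in>{K\<in>?C. y \<in> K}. xmon K)" .
  qed
  also have "\<dots> = (\<Sum>K\<in>?C. \<Sum>y\<in>{y\<in>Z. y \<in> K}. xmon K)"
    by (rule sum.swap_restrict[OF assms finite_subsets_card[OF assms]])
  also have "\<dots> = (\<Sum>K\<in>?C. of_nat (Suc q) * xmon K)"
  proof (intro sum.cong refl)
    fix K assume K: "K \<in> ?C"
    then have "{y\<in>Z. y \<in> K} = K" by auto
    then show "(\<Sum>y\<in>{y\<in>Z. y \<in> K}. xmon K) = of_nat (Suc q) * xmon K" using K by simp
  qed
  finally show ?thesis by (simp only: esym_def sum_distrib_left)
qed

definition matching :: "nat \<Rightarrow> nat set \<Rightarrow> nat \<Rightarrow> signed_pair set \<Rightarrow> bool" where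
  "matching n Z p M \<longleftrightarrow> is_normal_form n p M \<and> (\<forall>d\<in>M. lft d \<in> Z \<and> rgt d \<in> Z \<and> snd (snd d))"

text \<open>
With \<open>m = card Z\<close>, each \<open>p\<close>-set \<open>K \<subseteq> Z\<close> is a transversal of \<open>falling (m - p) p\<close> matchings, one for each
injection of \<open>K\<close> into \<open>Z - K\<close>; hence the constant. The induction distinguishes the partner \<open>y\<close> of the least element \<open>z\<close> of \<open>Z\<close>,
and \<open>c\<close> accumulates the factors \<open>Var z + Var y\<close>. The identity remains true, with both sides zero, if
\<open>m < 2 * p\<close>.
\<close>

lemma esym_matchings_induct:
  fixes c :: "rat mpoly"
  assumes "finite Z" "Z \<subseteq> {1..n}"
    and P0: "P 0" and Padd: "\<And>f g. P f \<Longrightarrow> P g \<Longrightarrow> P (f + g)"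
    and PM: "\<And>M. matching n Z p M \<Longrightarrow> P (c * root_of M)"
  shows "P (c * (of_nat (falling (card Z - p) p) * esym Z p))"
  using assms(1,2) PM
proof (induction "card Z" arbitrary: Z p c rule: less_induct)
  case less
  have Psum: "P (\<Sum>i\<in>I. f i)" if "\<And>i. i \<in> I \<Longrightarrow> P (f i)" for I and f :: "nat \<Rightarrow> rat mpoly"
    using that by (induction I rule: infinite_finite_induct) (auto intro: P0 Padd)
  show ?case
  proof (cases p)
    case 0
    have "matching n Z 0 {}" by (simp add: matching_def is_normal_form_iff)
    then have "P (c * root_of {})" using less.prems 0 by blast
    then show ?thesis using 0 less.prems(1) by (simp add: esym_0 root_of_def)
  next
    case (Suc q)
    show ?thesis
    proof (cases "2 * p \<le> card Z")
      case False
      then have "falling (card Z - p) p = 0" using Suc by (intro falling_eq_0) auto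
      then show ?thesis using P0 by simp
    next
      case True
      define z where "z = Min Z"
      define Y where "Y = Z - {z}"
      have "Z \<noteq> {}" using True Suc by auto
      then have z: "z \<in> Z" unfolding z_def using less.prems(1) by (intro Min_in)
      have Z: "Z = insert z Y" "z \<notin> Y" "finite Y" using z less.prems(1) by (auto simp: Y_def)
      have zy: "z < y" if "y \<in> Y" for y
      proof -
        have "z \<le> y" unfolding z_def using that less.prems(1) by (intro Min_le) (auto simp: Y_def)
        then show ?thesis using that Z(2) by (metis le_neq_implies_less)
      qed
      have cZ: "card Z = Suc (card Y)" using Z by simp
      \<comment> \<open>With \<open>m = card Z\<close>, the constants for \<open>Z\<close> and
        \<open>p\<close>, for \<open>Y\<close> and \<open>p\<close>, and for \<open>Y - {y}\<close>
        and \<open>q\<close> are \<open>(m - p) * t\<close>, \<open>(m - 2 * p) * t\<close> and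
        \<open>t\<close>.\<close>
      define t where "t = falling (card Z - p - 1) q"
      have f1: "falling (card Z - p) p = (card Z - p) * t"
        by (simp add: Suc t_def falling_Suc')
      have f2: "falling (card Y - p) p = (card Z - 2 * p) * t"
      proof -
        have "card Y - p = card Z - p - 1" "card Z - p - 1 - q = card Z - 2 * p" using cZ Suc by auto
        then show ?thesis by (simp add: Suc t_def falling_Suc)
      qed
      have f3: "falling (card (Y - {y}) - q) q = t" if "y \<in> Y" for y
      proof -
        have "card (Y - {y}) - q = card Z - p - 1" using that Z(3) cZ Suc by simp
        then show ?thesis by (simp add: t_def)
      qed
      have part1: "P (c * (of_nat (falling (card Y - p) p) * esym Y p))"
      proof (rule less.hyps)
        show "card Y < card Z" using cZ by simp
        show "P (c * root_of M)" if "matching n Y p M" for M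
          using that Z(1) by (intro less.prems(3)) (auto simp: matching_def)
      qed (use less.prems Z in auto)
      have part2: "P (c * (Var z + Var y) * (of_nat (falling (card (Y - {y}) - q) q) * esym (Y - {y}) q))"
        if y: "y \<in> Y" for y
      proof (rule less.hyps)
        have "card (Y - {y}) < card Y" using y Z(3) by (intro card_Diff1_less)
        then show "card (Y - {y}) < card Z" using cZ by simp
        show "finite (Y - {y})" "Y - {y} \<subseteq> {1..n}" using Z less.prems by auto
        fix M assume M: "matching n (Y - {y}) q M"
        have MY: "lft d \<in> Y - {y}" "rgt d \<in> Y - {y}" "snd (snd d)" if "d \<in> M" for d
          using M that by (auto simp: matching_def)
        have nf: "is_normal_form n q M" using M by (simp add: matching_def)
        have new: "(z, y, True) \<notin> M" using MY(2)[of "(z, y, True)"] by auto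
        have "is_normal_form n p (insert (z, y, True) M)"
          unfolding is_normal_form_iff
        proof (intro conjI ballI impI)
          show "finite (insert (z, y, True) M)" "card (insert (z, y, True) M) = p"
            using nf new Suc by (auto simp: is_normal_form_iff)
        next
          fix d assume "d \<in> insert (z, y, True) M"
          then show "1 \<le> lft d" "lft d < rgt d" "rgt d \<le> n"
            using nf zy[OF y] z y less.prems(2) Z(1) by (auto simp: is_normal_form_iff)
        next
          fix d d' assume d: "d \<in> insert (z, y, True) M" "d' \<in> insert (z, y, True) M" "d \<noteq> d'"
          have disj: "{z, y} \<inter> {lft d, rgt d} = {}" if "d \<in> M" for d
            using MY[OF that] Z(2) by auto
          have nf': "{lft d, rgt d} \<inter> {lft d', rgt d'} = {}" if "d \<in> M" "d' \<in> M"
            using nf that d(3) unfolding is_normal_form_iff by blast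
          show "{lft d, rgt d} \<inter> {lft d', rgt d'} = {}"
          proof (cases "d = (z, y, True)")
            case True
            then have "d' \<in> M" using d by auto
            then show ?thesis using disj[of d'] True by simp
          next
            case False
            then have dM: "d \<in> M" using d by auto
            show ?thesis
            proof (cases "d' = (z, y, True)")
              case True
              then show ?thesis using disj[OF dM] by (simp add: Int_commute)
            next
              case False
              then show ?thesis using nf' dM d by auto
            qed
          qed
        qed
        then have "matching n Z p (insert (z, y, True) M)"
          using MY y Z(1) by (auto simp: matching_def)
        then have "P (c * root_of (insert (z, y, True) M))" by (rule less.prems(3))
        moreover have "root_of (insert (z, y, True) M) = (Var z + Var y) * root_of M"
          using new nf by (simp add: root_of_factor is_normal_form_iff factor_def)
        ultimately show "P (c * (Var z + Var y) * root_of M)" by (simp add: mult.assoc)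
      qed
      \<comment> \<open>A matching of \<open>Z\<close> either avoids \<open>z\<close> or pairs it
        with some \<open>y\<close>. After extraction of \<open>t\<close>, the polynomial
        \<open>esym Y p\<close> receives the weight \<open>(m - 2 * p) + p\<close> and
        \<open>Var z * esym Y q\<close> the weight \<open>card Y - q\<close>; both equal
        \<open>m - p\<close>, so they recombine to \<open>esym Z p\<close>.\<close>
      have "P (c * (of_nat (falling (card Y - p) p) * esym Y p) +
          (\<Sum>y\<in>Y. c * (Var z + Var y) * (of_nat t * esym (Y - {y}) q)))"
        using part2 f3 by (intro Padd part1 Psum) simp
      also have "c * (of_nat (falling (card Y - p) p) * esym Y p) +
          (\<Sum>y\<in>Y. c * (Var z + Var y) * (of_nat t * esym (Y - {y}) q)) =
          c * of_nat t * (of_nat (card Z - 2 * p) * esym Y p + Var z * (\<Sum>y\<in>Y. esym (Y - {y}) q) +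
          (\<Sum>y\<in>Y. Var y * esym (Y - {y}) q))"
      proof -
        have "c * (x * t' * e) + (\<Sum>y\<in>Y. c * (u + Var y) * (t' * E y)) =
            c * t' * (x * e + u * (\<Sum>y\<in>Y. E y) + (\<Sum>y\<in>Y. Var y * E y))"
          for x t' e u :: "rat mpoly" and E
          by (simp add: algebra_simps sum_distrib_left sum.distrib)
        then show ?thesis by (simp only: f2 of_nat_mult)
      qed
      also have "of_nat (card Z - 2 * p) * esym Y p + Var z * (\<Sum>y\<in>Y. esym (Y - {y}) q) +
          (\<Sum>y\<in>Y. Var y * esym (Y - {y}) q) =
          (of_nat (card Z - 2 * p) + of_nat p) * esym Y p + of_nat (card Y - q) * (Var z * esym Y q)"
        unfolding sum_esym_remove[OF Z(3)] sum_Var_esym_remove[OF Z(3)] Suc by (simp add: algebra_simps)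
      also have "of_nat (card Z - 2 * p) + of_nat p = (of_nat (card Z - p) :: rat mpoly)"
        using True by (simp flip: of_nat_add)
      also have "card Y - q = card Z - p" using cZ Suc by simp
      also have "of_nat (card Z - p) * esym Y p + of_nat (card Z - p) * (Var z * esym Y q) =
          (of_nat (card Z - p) * esym Z p :: rat mpoly)"
        unfolding Z(1) Suc esym_insert[OF Z(3,2)] by (simp add: algebra_simps)
      finally show ?thesis unfolding f1 by (simp add: ac_simps)
    qed
  qed
qed

text \<open>A symmetric factor may be reversed freely, while reversing an antisymmetric one would
  cost a sign. If the latter keep their order, sorting the endpoints of each image factor gives a
  normal form of the permuted root.\<close>

lemma nn_comb_act_root_of:
  assumes E: "is_normal_form n k E" and \<sigma>: "\<sigma> permutes {1..n}"
    and mono: "\<And>a b. (a, b, False) \<in> E \<Longrightarrow> \<sigma> a < \<sigma> b"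
  shows "nn_comb n k (act \<sigma> (root_of E))"
proof -
  define \<tau> :: "signed_pair \<Rightarrow> signed_pair" where
    "\<tau> d = (min (\<sigma> (lft d)) (\<sigma> (rgt d)), max (\<sigma> (lft d)) (\<sigma> (rgt d)), snd (snd d))" for d
  have b: "bij \<sigma>" using \<sigma> by (rule permutes_bij)
  have sel: "lft (\<tau> d) = min (\<sigma> (lft d)) (\<sigma> (rgt d))" "rgt (\<tau> d) = max (\<sigma> (lft d)) (\<sigma> (rgt d))" for d
    by (simp_all add: \<tau>_def)
  have used: "{lft (\<tau> d), rgt (\<tau> d)} = \<sigma> ` {lft d, rgt d}" for d
    by (auto simp: sel min_def max_def)
  have disj: "{lft (\<tau> d), rgt (\<tau> d)} \<inter> {lft (\<tau> d'), rgt (\<tau> d')} = {}" if "d \<in> E" "d' \<in> E" "d \<noteq> d'" for d d'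
  proof -
    have "{lft d, rgt d} \<inter> {lft d', rgt d'} = {}" using E that unfolding is_normal_form_iff by blast
    then show ?thesis
      unfolding used image_Int[OF bij_is_inj[OF b], symmetric] by simp
  qed
  have inj: "inj_on \<tau> E"
  proof (rule inj_onI, rule ccontr)
    fix d d' assume "d \<in> E" "d' \<in> E" "\<tau> d = \<tau> d'" "d \<noteq> d'"
    then show False using disj[of d d'] by auto
  qed
  have "act \<sigma> (factor d) = factor (\<tau> d)" if d: "d \<in> E" for d
  proof -
    obtain a b' s where abs: "d = (a, b', s)" by (cases d)
    show ?thesis
    proof (cases s)
      case True
      then show ?thesis
        by (auto simp: abs factor_def \<tau>_def act_add[OF b] act_Var[OF b] min_def max_def add.commute)
    next
      case False
      then have "\<sigma> a < \<sigma> b'" using mono[of a b'] d by (simp add: abs)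
      then show ?thesis using False
        by (simp add: abs factor_def \<tau>_def act_diff[OF b] act_Var[OF b])
    qed
  qed
  then have "act \<sigma> (root_of E) = root_of (\<tau> ` E)"
    using inj by (simp add: root_of_factor act_prod[OF b] prod.reindex)
  moreover have "is_normal_form n k (\<tau> ` E)"
    unfolding is_normal_form_iff
  proof (intro conjI ballI impI)
    show "finite (\<tau> ` E)" "card (\<tau> ` E) = k"
      using E inj by (simp_all add: is_normal_form_iff card_image)
  next
    fix x assume "x \<in> \<tau> ` E"
    then obtain d where d: "d \<in> E" "x = \<tau> d" by blast
    have "lft d < rgt d" "lft d \<in> {1..n}" "rgt d \<in> {1..n}"
      using E d(1) unfolding is_normal_form_iff by fastforce+
    then have "\<sigma> (lft d) \<noteq> \<sigma> (rgt d)" "\<sigma> (lft d) \<in> {1..n}" "\<sigma> (rgt d) \<in> {1..n}"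
      using permutes_in_image[OF \<sigma>] bij_is_inj[OF b] by (auto dest: injD)
    then show "1 \<le> lft x" "lft x < rgt x" "rgt x \<le> n"
      unfolding d(2) sel by (auto simp: min_def max_def)
  next
    fix x y assume "x \<in> \<tau> ` E" "y \<in> \<tau> ` E" "x \<noteq> y"
    then show "{lft x, rgt x} \<inter> {lft y, rgt y} = {}" using disj by blast
  qed
  ultimately show ?thesis using nn_comb_root_of by simp
qed

text \<open>The antisymmetric factors start in \<open>{1..k}\<close> and end in
  \<open>{k+1..n}\<close>; \<open>v\<close> and \<open>w\<close> preserve these two blocks and so
  keep the order of the endpoints. The factors of \<open>M\<close> are symmetric.\<close>

lemma nn_comb_act_mirror_diffs_matching:
  assumes kn: "2 * k \<le> n" and jk: "j \<le> k"
    and v: "v permutes {1..k}" and w: "w permutes {k+1..n}"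
    and M: "matching n {j+1..n-j} (k - j) M"
  shows "nn_comb n k (act v (act w (mirror_diffs n j * root_of M)))"
proof -
  define A where "A = (\<lambda>i. (i, Suc n - i, False)) ` {1..j}"
  have nfM: "is_normal_form n (k - j) M" using M by (simp add: matching_def)
  have MZ: "lft d \<in> {j+1..n-j}" "rgt d \<in> {j+1..n-j}" "snd (snd d)" if "d \<in> M" for d
    using M that by (auto simp: matching_def)
  have AM: "A \<inter> M = {}" using MZ(3) by (auto simp: A_def)
  have injA: "inj_on (\<lambda>i. (i, Suc n - i, False)) {1..j}" by (auto intro: inj_onI)
  have "is_normal_form n k (A \<union> M)"
    unfolding is_normal_form_iff
  proof (intro conjI ballI impI)
    show "finite (A \<union> M)" using nfM by (simp add: A_def is_normal_form_iff)
    have "card (A \<union> M) = card A + card M"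
      using AM nfM by (intro card_Un_disjoint) (auto simp: A_def is_normal_form_iff)
    also have "card A = j" unfolding A_def card_image[OF injA] by simp
    also have "j + card M = k" using nfM jk by (simp add: is_normal_form_iff)
    finally show "card (A \<union> M) = k" .
  next
    fix d assume "d \<in> A \<union> M"
    then show "1 \<le> lft d" "lft d < rgt d" "rgt d \<le> n"
      using nfM kn jk by (auto simp: A_def is_normal_form_iff)
  next
    fix d d' assume d: "d \<in> A \<union> M" "d' \<in> A \<union> M" "d \<noteq> d'"
    have am: "{lft a, rgt a} \<inter> {lft m, rgt m} = {}" if "a \<in> A" "m \<in> M" for a m
      using that(1) MZ(1,2)[OF that(2)] by (auto simp: A_def)
    consider "d \<in> A" "d' \<in> A" | "d \<in> M" "d' \<in> M" | "d \<in> A" "d' \<in> M" | "d \<in> M" "d' \<in> A" using d by blast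
    then show "{lft d, rgt d} \<inter> {lft d', rgt d'} = {}"
    proof cases
      case 1
      then show ?thesis using d(3) kn jk by (auto simp: A_def)
    next
      case 2
      then show ?thesis using nfM d(3) unfolding is_normal_form_iff by blast
    next
      case 3
      then show ?thesis by (rule am)
    next
      case 4
      then show ?thesis using am[of d' d] by (simp add: Int_commute)
    qed
  qed
  moreover have perm: "v \<circ> w permutes {1..n}"
    using permutes_subset[OF v, of "{1..n}"] permutes_subset[OF w, of "{1..n}"] kn
    by (intro permutes_compose) auto
  moreover have "(v \<circ> w) a < (v \<circ> w) b" if "(a, b, False) \<in> A \<union> M" for a b
  proof -
    have "(a, b, False) \<in> A" using that MZ(3)[of "(a, b, False)"] by auto
    then have ab: "a \<in> {1..k}" "b \<in> {k+1..n}" using kn jk by (auto simp: A_def)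
    have "w a = a" using ab by (intro permutes_not_in[OF w]) auto
    then have "(v \<circ> w) a \<in> {1..k}" using ab(1) permutes_in_image[OF v] by simp
    moreover have wb: "w b \<in> {k+1..n}" using ab(2) permutes_in_image[OF w] by simp
    moreover have "v (w b) = w b" using wb by (intro permutes_not_in[OF v]) auto
    ultimately show ?thesis by simp
  qed
  ultimately have "nn_comb n k (act (v \<circ> w) (root_of (A \<union> M)))" by (rule nn_comb_act_root_of)
  moreover have "root_of (A \<union> M) = mirror_diffs n j * root_of M"
  proof -
    have "root_of A = mirror_diffs n j"
      unfolding A_def root_of_factor prod.reindex[OF injA] by (simp add: mirror_diffs_def factor_def)
    moreover have "root_of (A \<union> M) = root_of A * root_of M"
      unfolding root_of_factor using AM nfM by (intro prod.union_disjoint) (auto simp: A_def is_normal_form_iff)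
    ultimately show ?thesis by simp
  qed
  ultimately show ?thesis using v w by (simp add: act_comp permutes_bij)
qed

lemma nn_comb_act_gen:
  assumes kn: "2 * k \<le> n" and jk: "j \<le> k"
    and v: "v permutes {1..k}" and w: "w permutes {k+1..n}"
  shows "nn_comb n k (smult (of_nat (falling (n - j - k) (k - j))) (act v (act w (summand_gen n k j))))"
proof -
  \<comment> \<open>The permutations belong to the predicate, so that each matching term is
    straightened after they have acted.\<close>
  let ?P = "\<lambda>f. nn_comb n k (act v (act w f))"
  have b: "bij v" "bij w" using v w by (auto intro: permutes_bij)
  have "?P (mirror_diffs n j * (of_nat (falling (card {j+1..n-j} - (k - j)) (k - j)) * esym {j+1..n-j} (k - j)))"
  proof (rule esym_matchings_induct)
    show "?P 0" by (simp add: act_zero b nn_comb_0)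
    show "?P (f + g)" if "?P f" "?P g" for f g using that by (simp add: act_add b nn_comb_add)
    show "?P (mirror_diffs n j * root_of M)" if "matching n {j+1..n-j} (k - j) M" for M
      by (rule nn_comb_act_mirror_diffs_matching[OF assms that])
  qed auto
  moreover have "card {j+1..n-j} - (k - j) = n - j - k" using kn jk by simp
  moreover have "mirror_diffs n j * (of_nat c * esym {j+1..n-j} (k - j)) = smult (of_nat c) (summand_gen n k j :: rat mpoly)" for c
    by (simp add: summand_gen_def smult_of_nat ac_simps)
  ultimately show ?thesis using b by (simp only: act_smult)
qed

text \<open>All permutations in one left coset of the symmetric group on \<open>S\<close> act on
  \<open>f\<close> alike, so \<open>R\<close> consists of coset representatives. Keeping the sum
  over \<open>R\<close>, rather than dividing, preserves integrality.\<close>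

lemma sym_sum_cosets:
  fixes f :: "'a::field_char_0 mpoly"
  assumes A: "finite A" and S: "S \<subseteq> A" and inv: "\<And>u. u permutes S \<Longrightarrow> act u f = f"
  shows "\<exists>R \<subseteq> {v. v permutes A}. sym_sum A f = smult (fact (card S)) (\<Sum>v\<in>R. act v f)"
proof -
  let ?X = "{v. v permutes A}"
  \<comment> \<open>Two permutations lie in the same left coset exactly if they agree outside
    \<open>S\<close>; the restriction to the complement thus labels the cosets, and \<open>r\<close>
    chooses representatives.\<close>
  define key where "key v = (\<lambda>x. if x \<in> S then undefined else v x)" for v :: "nat \<Rightarrow> nat"
  define r where "r y = (SOME v. v \<in> ?X \<and> key v = y)" for y
  have r: "r y \<in> ?X" "key (r y) = y" if "y \<in> key ` ?X" for y
  proof -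
    have "\<exists>v. v \<in> ?X \<and> key v = y" using that by auto
    then have "r y \<in> ?X \<and> key (r y) = y" unfolding r_def by (rule someI_ex)
    then show "r y \<in> ?X" "key (r y) = y" by auto
  qed
  have finX: "finite ?X" using A by (rule finite_permutations)
  have finS: "finite S" using S A finite_subset by blast
  have fiber: "{v \<in> ?X. key v = key v0} = (\<lambda>u. v0 \<circ> u) ` {u. u permutes S}" if v0: "v0 \<in> ?X" for v0
  proof (intro equalityI subsetI)
    fix v assume v: "v \<in> {v \<in> ?X. key v = key v0}"
    have v0p: "v0 permutes A" and vp: "v permutes A" using v v0 by auto
    have agree: "v x = v0 x" if "x \<notin> S" for x
      using v that by (auto simp: key_def fun_eq_iff dest!: spec[of _ x])
    have "inv v0 \<circ> v permutes A" using v0p vp by (simp add: permutes_compose permutes_inv)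
    then have "bij (inv v0 \<circ> v)" by (rule permutes_bij)
    moreover have "(inv v0 \<circ> v) x = x" if "x \<notin> S" for x
      using agree[OF that] permutes_inverses(2)[OF v0p] by simp
    ultimately have "inv v0 \<circ> v permutes S" by (auto simp: permutes_def bij_iff)
    moreover have "v = v0 \<circ> (inv v0 \<circ> v)" by (simp add: o_assoc permutes_inv_o[OF v0p])
    ultimately show "v \<in> (\<lambda>u. v0 \<circ> u) ` {u. u permutes S}" by blast
  next
    fix v assume "v \<in> (\<lambda>u. v0 \<circ> u) ` {u. u permutes S}"
    then obtain u where u: "u permutes S" "v = v0 \<circ> u" by auto
    have "v permutes A" using u v0 permutes_subset[OF u(1) S] by (simp add: permutes_compose)
    moreover have "key v = key v0" using permutes_not_in[OF u(1)] u(2) by (auto simp: key_def)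
    ultimately show "v \<in> {v \<in> ?X. key v = key v0}" by simp
  qed
  have "sym_sum A f = (\<Sum>y\<in>key ` ?X. \<Sum>v\<in>{v \<in> ?X. key v = y}. act v f)"
    unfolding sym_sum_def by (rule sum.image_gen[OF finX])
  also have "\<dots> = (\<Sum>y\<in>key ` ?X. smult (fact (card S)) (act (r y) f))"
  proof (intro sum.cong refl)
    fix y assume y: "y \<in> key ` ?X"
    have rp: "r y permutes A" using r(1)[OF y] by simp
    have "{v \<in> ?X. key v = y} = (\<lambda>u. r y \<circ> u) ` {u. u permutes S}"
      using fiber[OF r(1)[OF y]] r(2)[OF y] by simp
    moreover have "inj_on (\<lambda>u. r y \<circ> u) {u. u permutes S}"
      by (simp add: inj_on_def fun_eq_iff inj_eq[OF permutes_inj[OF rp]])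
    ultimately have "(\<Sum>v\<in>{v \<in> ?X. key v = y}. act v f) = (\<Sum>u | u permutes S. act (r y \<circ> u) f)"
      by (simp add: sum.reindex)
    also have "\<dots> = (\<Sum>u | u permutes S. act (r y) f)"
      using inv by (intro sum.cong refl) (simp add: act_comp permutes_bij[OF rp] permutes_bij)
    also have "\<dots> = smult (fact (card S)) (act (r y) f)"
    proof -
      have "(\<Sum>u | u permutes S. act (r y) f) = smult (of_nat (fact (card S))) (act (r y) f)"
        using card_permutations[OF refl finS] by (simp add: smult_of_nat del: of_nat_fact)
      then show ?thesis by simp
    qed
    finally show "(\<Sum>v\<in>{v \<in> ?X. key v = y}. act v f) = smult (fact (card S)) (act (r y) f)" .
  qed
  also have "\<dots> = smult (fact (card S)) (\<Sum>v\<in>r ` key ` ?X. act v f)"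
  proof -
    have "inj_on r (key ` ?X)" using r(2) by (metis inj_onI)
    then show ?thesis by (simp add: sum.reindex mpoly.scale_sum_right)
  qed
  finally have "sym_sum A f = smult (fact (card S)) (\<Sum>v\<in>r ` key ` ?X. act v f)" .
  moreover have "r ` key ` ?X \<subseteq> ?X" using r(1) by blast
  ultimately show ?thesis by blast
qed

text \<open>The generator is fixed by the groups on \<open>{k+1..n-j}\<close> and
  \<open>{j+1..k}\<close>, and the second commutes with the inner sum. Coset sums thus extract
  \<open>(n-j-k)!\<close> and \<open>(k-j)!\<close>. Dividing by \<open>(k-j)! (n-2k)!\<close>
  leaves precisely the factor \<open>falling (n - j - k) (k - j)\<close> under which each translate
  of the generator is a nonnegative combination.\<close>

lemma nn_comb_spherical:
  assumes kn: "2 * k \<le> n" and jk: "j \<le> k"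
  shows "nn_comb n k (smult (1 / (fact (k - j) * fact (n - 2 * k))) (sym_sum {1..k} (sym_sum {k+1..n} (summand_gen n k j))))"
proof -
  let ?g = "summand_gen n k j :: rat mpoly" and ?h = "sym_sum {k+1..n} (summand_gen n k j) :: rat mpoly"
  have gZ: "act u ?g = ?g" if "u permutes {j+1..n-j}" for u
    using alternating_gen[OF kn jk, where 'a=rat] that by (simp add: alternating_def)
  have "\<exists>R\<subseteq>{w. w permutes {k+1..n}}. ?h = smult (fact (card {k+1..n-j})) (\<Sum>w\<in>R. act w ?g)"
  proof (rule sym_sum_cosets)
    show "act u ?g = ?g" if "u permutes {k+1..n-j}" for u
      using that by (intro gZ permutes_subset[OF that]) (use jk in auto)
  qed auto
  then obtain R2 where R2: "R2 \<subseteq> {w. w permutes {k+1..n}}" "?h = smult (fact (n - j - k)) (\<Sum>w\<in>R2. act w ?g)"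
    by (auto simp: diff_right_commute)
  have "\<exists>R\<subseteq>{v. v permutes {1..k}}. sym_sum {1..k} ?h = smult (fact (card {j+1..k})) (\<Sum>v\<in>R. act v ?h)"
  proof (rule sym_sum_cosets)
    show "act u ?h = ?h" if u: "u permutes {j+1..k}" for u
    proof -
      have "act u ?h = sym_sum {k+1..n} (act u ?g)"
        by (rule act_sym_sum_commute[OF permutes_bij[OF u]]) (auto intro!: permutes_not_in[OF u])
      also have "act u ?g = ?g" by (intro gZ permutes_subset[OF u]) (use kn jk in auto)
      finally show ?thesis .
    qed
  qed auto
  then obtain R1 where R1: "R1 \<subseteq> {v. v permutes {1..k}}"
    "sym_sum {1..k} ?h = smult (fact (k - j)) (\<Sum>v\<in>R1. act v ?h)"
    by auto
  have "fact (n - j - k) = (of_nat (falling (n - j - k) (k - j)) * fact (n - 2 * k) :: rat)"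
  proof -
    have "n - j - k - (k - j) = n - 2 * k" "k - j \<le> n - j - k" using kn jk by auto
    then have "fact (n - j - k) = falling (n - j - k) (k - j) * fact (n - 2 * k)"
      using falling_fact[of "k - j" "n - j - k"] by simp
    then have "(of_nat (fact (n - j - k)) :: rat) = of_nat (falling (n - j - k) (k - j) * fact (n - 2 * k))"
      by simp
    then show ?thesis by simp
  qed
  then have c: "1 / (fact (k - j) * fact (n - 2 * k)) * (fact (k - j) * fact (n - j - k)) =
      (of_nat (falling (n - j - k) (k - j)) :: rat)"
    by simp
  have "(\<Sum>v\<in>R1. act v ?h) = smult (fact (n - j - k)) (\<Sum>v\<in>R1. \<Sum>w\<in>R2. act v (act w ?g))"
    unfolding R2(2) mpoly.scale_sum_right
    using R1(1) by (intro sum.cong refl) (auto simp: act_sum act_smult permutes_bij mpoly.scale_sum_right dest!: subsetD)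
  then have "smult (1 / (fact (k - j) * fact (n - 2 * k))) (sym_sum {1..k} ?h) =
      smult (of_nat (falling (n - j - k) (k - j))) (\<Sum>v\<in>R1. \<Sum>w\<in>R2. act v (act w ?g))"
    unfolding R1(2) by (simp only: mpoly.scale_scale c)
  also have "\<dots> = (\<Sum>v\<in>R1. \<Sum>w\<in>R2. smult (of_nat (falling (n - j - k) (k - j))) (act v (act w ?g)))"
    by (simp only: mpoly.scale_sum_right)
  also have "nn_comb n k \<dots>"
    using R1(1) R2(1) by (intro nn_comb_sum nn_comb_act_gen[OF kn jk]) blast+
  finally show ?thesis .
qed

section \<open>Extension of scalars and the final normalisation\<close>

lemma lookup_complexify: "Poly_Mapping.lookup (complexify p) m = of_rat (Poly_Mapping.lookup p m)"
  by (simp add: complexify_def Poly_Mapping.map.rep_eq when_def)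

lemma complexify_0 [simp]: "complexify 0 = 0"
  by (rule poly_mapping_eqI) (simp add: lookup_complexify)

lemma complexify_add: "complexify (p + q) = complexify p + complexify q"
  by (rule poly_mapping_eqI) (simp add: lookup_complexify lookup_add of_rat_add)

lemma complexify_sum: "complexify (\<Sum>i\<in>I. f i) = (\<Sum>i\<in>I. complexify (f i))"
  by (induction I rule: infinite_finite_induct) (simp_all add: complexify_add)

lemma complexify_smult: "complexify (smult c p) = smult (of_rat c) (complexify p)"
  by (rule poly_mapping_eqI) (simp add: lookup_complexify of_rat_mult)

lemma complexify_act: "bij \<sigma> \<Longrightarrow> complexify (act \<sigma> p) = act \<sigma> (complexify p)"
  by (rule poly_mapping_eqI) (simp add: lookup_complexify lookup_act)

lemma complexify_sym_sum: "complexify (sym_sum A p) = sym_sum A (complexify p)"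
  unfolding sym_sum_def complexify_sum
  by (intro sum.cong refl complexify_act) (auto intro: permutes_bij)

lemma complexify_xmon: "finite I \<Longrightarrow> complexify (xmon I) = xmon I"
  by (rule poly_mapping_eqI) (simp add: lookup_complexify xmon_eq_single lookup_single when_def)

lemma complexify_gen:
  assumes "2 * k \<le> n" "j \<le> k"
  shows "complexify (summand_gen n k j) = summand_gen n k j"
  unfolding gen_expand[OF assms] complexify_sum complexify_smult
  by (intro sum.cong refl arg_cong2[where f=smult])
    (auto simp: of_rat_power of_rat_minus intro!: complexify_xmon dest: finite_subset)

lemma of_nat_falling_mult:
  assumes "2 * k \<le> n" "j \<le> k"
  shows "of_nat (falling k j * falling (n - k) k) * (fact (k - j) * fact (n - 2 * k)) =
    (fact k * fact (n - k) :: 'a::field_char_0)"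
proof -
  have e: "n - k - k = n - 2 * k" "k \<le> n - k" using assms by simp_all
  have "falling k j * falling (n - k) k * (fact (k - j) * fact (n - 2 * k)) =
      (falling k j * fact (k - j)) * (falling (n - k) k * fact (n - k - k))"
    unfolding e(1) by (simp only: ac_simps)
  also have "\<dots> = fact k * fact (n - k)"
    by (simp only: falling_fact[OF assms(2)] falling_fact[OF e(2)])
  finally have "of_nat (falling k j * falling (n - k) k * (fact (k - j) * fact (n - 2 * k))) =
      (of_nat (fact k * fact (n - k)) :: 'a)"
    by (simp only:)
  then show ?thesis by (simp only: of_nat_mult of_nat_fact)
qed

theorem theorem4p5:
  fixes n k j :: nat
  assumes "n \<ge> 2" and "2 * k \<le> n" and "j \<le> k"
  shows "spherical n k j =
           smult (1 / (fact k * fact (n - k) * 2 ^ (k - j) * fact (k - j)))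
             (sym_sum {1..k} (sym_sum {j+1..n} (beta k j)))
       \<and> (let N = (\<Prod>i<j. k - i) * (\<Prod>i<k. n - k - i) in
            real N = fact k * fact (n - k) / (fact (k - j) * fact (n - 2 * k)) \<and>
            (\<exists>c :: rat mpoly \<Rightarrow> nat.
               spherical n k j =
                 (\<Sum>b\<in>root_basis n k. smult (of_nat (c b) / of_nat N) (complexify b))))"
proof -
  define N where "N = falling k j * falling (n - k) k"
  have N: "(\<Prod>i<j. k - i) * (\<Prod>i<k. n - k - i) = N" by (simp add: N_def falling_def)
  note fN = of_nat_falling_mult[OF assms(2,3), folded N_def]
  have realN: "real N = fact k * fact (n - k) / (fact (k - j) * fact (n - 2 * k))"
    by (simp add: nonzero_eq_divide_eq fN)
  let ?S = "sym_sum {1..k} (sym_sum {k+1..n} (summand_gen n k j)) :: rat mpoly"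
  obtain c :: "rat mpoly \<Rightarrow> nat" where c:
    "smult (1 / (fact (k - j) * fact (n - 2 * k))) ?S = (\<Sum>b\<in>root_basis n k. smult (of_nat (c b)) b)"
    using nn_comb_spherical[OF assms(2,3)] by (auto simp: nn_comb_def)
  have of_rat_fact: "complex_of_rat (fact m) = fact m" for m
    by (metis of_nat_fact of_rat_of_nat_eq)
  have "spherical n k j = smult (1 / (fact k * fact (n - k))) (complexify ?S)"
    by (simp only: spherical_eq_sym_sum_gen[OF assms(2,3)] complexify_sym_sum complexify_gen[OF assms(2,3)])
  \<comment> \<open>\<open>k! (n-k)! = N (k-j)! (n-2k)!\<close> splits the averaging constant into
    \<open>1 / N\<close> and the scaling for which the rational sum has nonnegative integer
    coefficients.\<close>
  also have "\<dots> = smult (1 / of_nat N) (complexify (smult (1 / (fact (k - j) * fact (n - 2 * k))) ?S))"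
    unfolding complexify_smult mpoly.scale_scale
    by (rule arg_cong2[where f=smult])
      (simp_all add: fN[symmetric] of_rat_divide of_rat_mult of_rat_fact)
  also have "\<dots> = (\<Sum>b\<in>root_basis n k. smult (of_nat (c b) / of_nat N) (complexify b))"
    unfolding c complexify_sum complexify_smult mpoly.scale_sum_right by simp
  finally have "spherical n k j = (\<Sum>b\<in>root_basis n k. smult (of_nat (c b) / of_nat N) (complexify b))" .
  then show ?thesis
    unfolding N Let_def using spherical_eq_sym_sum_beta[OF assms(2,3)] realN by blast
qed

end
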